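(* Let $n\ge 3$, let $\Omega\subset\mathbf{R}^n$ be a domain with $C^1$ boundary, let $b\in\Omega$, and let $\beta\in(0,1)$ be fixed. For every $\alpha\in(0,1-\beta)$ and every $K\ge 1$ there is a constant $M=M(\alpha,b,K,\Omega)$, depending only on $\alpha$, $b$, $K$ and $\Omega$ (in particular, the same constant can be used for all $\beta\in(0,1-\alpha)$), such that every $K$-quasiconformal mapping $f:\mathbf{B}\to\Omega$ that belongs to the harmonic $\beta$-Bloch space and satisfies $f(0)=b$ is $\alpha$-H\"older continuous with H\"older coefficient $M$, i.e. \[ |f(x)-f(y)|\le M|x-y|^{\alpha}\quad\text{for all } x,y\in\mathbf{B}. \]
   Context: Notation: $\mathbf{B}=\{x\in\mathbf{R}^n:|x|<1\}$ is the open unit ball, with the Euclidean norm. $C^1$ boundary: a domain $\Omega\subset\mathbf{R}^n$ has $C^1$ boundary if there is a $C^1$ diffeomorphism (up to the boundary) $\Phi:\overline{\mathbf{B}}\to\overline{\Omega}$. Quasiconformal mapping: for domains $U,V\subset\mathbf{R}^n$ and $K\ge1$, a homeomorphism $f:U\to V$ (onto $V$) is $K$-quasiconformal if $f$ is absolutely continuous on lines (i.e. absolutely continuous on almost every segment parallel to one of the coordinate axes, with partial derivatives that exist and are locally $L^n$-integrable in $U$) and $|\nabla f(x)|\le K\, l(\nabla f(x))$ for all $x\in U$, where $|\nabla f(x)|=\sup\{|f'(x)h|:|h|=1\}$ and $l(\nabla f(x))=\inf\{|f'(x)h|:|h|=1\}$. (Mappings in the harmonic $\beta$-Bloch space are smooth,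 so the derivative $f'(x)$ exists at every point.) Harmonic $\beta$-Bloch space: the space of harmonic functions $u:\mathbf{B}\to\mathbf{R}$ with $\sup_{x\in\mathbf{B}}(1-|x|)^{\beta}|\nabla u(x)|<\infty$. A mapping $f=(f_1,\dots,f_n):\mathbf{B}\to\mathbf{R}^n$ belongs to the harmonic $\beta$-Bloch space if each component $f_j$ does. The value of this supremum is not bounded by any prescribed constant, and $M$ does not depend on it. *)

theory Defs
  imports "HOL-Analysis.Analysis"
begin

section \<open>Domains with \<open>C\<^sup>1\<close> boundary\<close>

text \<open>
  The derivative is taken relative to \<open>S\<close>. On an open set this is the usual notion of a \<open>C\<^sup>1\<close> map;
  on the closure of a domain it expresses being \<open>C\<^sup>1\<close> up to the boundary.
\<close>

definition C1_on :: "'a::real_normed_vector set \<Rightarrow> ('a \<Rightarrow> 'b::real_normed_vector) \<Rightarrow> bool" where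
  "C1_on S f \<longleftrightarrow> (\<exists>f' :: 'a \<Rightarrow> 'a \<Rightarrow>\<^sub>L 'b.
     (\<forall>x\<in>S. (f has_derivative blinfun_apply (f' x)) (at x within S)) \<and> continuous_on S f')"

definition C1_diffeomorphism ::
  "'a::real_normed_vector set \<Rightarrow> 'b::real_normed_vector set \<Rightarrow> ('a \<Rightarrow> 'b) \<Rightarrow> bool" where
  "C1_diffeomorphism S T \<Phi> \<longleftrightarrow>
     (\<exists>\<Psi>. homeomorphism S T \<Phi> \<Psi> \<and> C1_on S \<Phi> \<and> C1_on T \<Psi>)"

text \<open>
  ``Diffeomorphism up to the boundary'' means that the open ball itself is mapped onto \<open>\<Omega>\<close>;
  the condition on the closures alone would also admit, say, a punctured or slit ball.
\<close>

definition has_C1_boundary :: "(real ^ 'n) set \<Rightarrow> bool" where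
  "has_C1_boundary \<Omega> \<longleftrightarrow>
     (\<exists>\<Phi> :: real ^ 'n \<Rightarrow> real ^ 'n.
        C1_diffeomorphism (cball 0 1) (closure \<Omega>) \<Phi> \<and> \<Phi> ` ball 0 1 = \<Omega>)"


section \<open>Partial derivatives\<close>

definition partial :: "'n \<Rightarrow> (real ^ 'n \<Rightarrow> 'b::real_normed_vector) \<Rightarrow> real ^ 'n \<Rightarrow> 'b" where
  "partial i f x = vector_derivative (\<lambda>t. f (x + t *\<^sub>R axis i 1)) (at 0)"

definition partial_exists :: "'n \<Rightarrow> (real ^ 'n \<Rightarrow> 'b::real_normed_vector) \<Rightarrow> real ^ 'n \<Rightarrow> bool" where
  "partial_exists i f x \<longleftrightarrow> (\<lambda>t. f (x + t *\<^sub>R axis i 1)) differentiable (at 0)"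

definition gradient :: "(real ^ 'n \<Rightarrow> real) \<Rightarrow> real ^ 'n \<Rightarrow> real ^ 'n" where
  "gradient u x = (\<chi> i. partial i u x)"


section \<open>Quasiconformal mappings\<close>

text \<open>\<open>D\<close> ranges over the finite families of non-overlapping compact intervals contained in \<open>S\<close>.\<close>

definition abs_continuous_on :: "real set \<Rightarrow> (real \<Rightarrow> 'b::real_normed_vector) \<Rightarrow> bool" where
  "abs_continuous_on S g \<longleftrightarrow>
     (\<forall>e>0. \<exists>d>0. \<forall>D T. D division_of T \<and> T \<subseteq> S \<and> (\<Sum>I\<in>D. Sup I - Inf I) < d
        \<longrightarrow> (\<Sum>I\<in>D. norm (g (Sup I) - g (Inf I))) < e)"

text \<open>
  Segments in direction \<open>i\<close> of a box with corners \<open>a\<close>, \<open>b\<close> are parametrised by their remaining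
  \<open>n - 1\<close> coordinates \<open>p\<close>, and almost every refers to \<open>(n - 1)\<close>-dimensional Lebesgue measure.
  As usual, the partial derivatives are required to exist almost everywhere only.
\<close>

definition ACL_on :: "(real ^ 'n) set \<Rightarrow> (real ^ 'n \<Rightarrow> real ^ 'n) \<Rightarrow> bool" where
  "ACL_on U f \<longleftrightarrow>
     (\<forall>a b i. cbox a b \<subseteq> U \<longrightarrow>
        (AE p in Pi\<^sub>M (UNIV - {i}) (\<lambda>_. lborel :: real measure).
           (\<forall>j. j \<noteq> i \<longrightarrow> a $ j \<le> p j \<and> p j \<le> b $ j) \<longrightarrow>
           abs_continuous_on {a $ i..b $ i} (\<lambda>t. f (\<chi> j. if j = i then t else p j)))) \<and>
     (\<forall>i. (AE x in lebesgue. x \<in> U \<longrightarrow> partial_exists i f x) \<and>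
          (\<forall>C. compact C \<and> C \<subseteq> U \<longrightarrow>
             (\<lambda>x. norm (partial i f x) ^ CARD('n)) absolutely_integrable_on C))"

definition max_stretch :: "(real ^ 'n \<Rightarrow> real ^ 'n) \<Rightarrow> real ^ 'n \<Rightarrow> real" where
  "max_stretch f x = (SUP h\<in>sphere 0 1. norm (frechet_derivative f (at x) h))"

definition min_stretch :: "(real ^ 'n \<Rightarrow> real ^ 'n) \<Rightarrow> real ^ 'n \<Rightarrow> real" where
  "min_stretch f x = (INF h\<in>sphere 0 1. norm (frechet_derivative f (at x) h))"

definition quasiconformal ::
  "real \<Rightarrow> (real ^ 'n) set \<Rightarrow> (real ^ 'n) set \<Rightarrow> (real ^ 'n \<Rightarrow> real ^ 'n) \<Rightarrow> bool" where
  "quasiconformal K U V f \<longleftrightarrow>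
     (\<exists>g. homeomorphism U V f g) \<and>
     ACL_on U f \<and>
     (\<forall>x\<in>U. f differentiable (at x) \<and> max_stretch f x \<le> K * min_stretch f x)"


section \<open>The harmonic Bloch spaces\<close>

text \<open>
  Being differentiable with a \<open>C\<^sup>1\<close> gradient is the same as being of class \<open>C\<^sup>2\<close>.
\<close>

definition harmonic_on :: "(real ^ 'n) set \<Rightarrow> (real ^ 'n \<Rightarrow> real) \<Rightarrow> bool" where
  "harmonic_on S u \<longleftrightarrow>
     open S \<and> u differentiable_on S \<and> C1_on S (gradient u) \<and>
     (\<forall>x\<in>S. (\<Sum>i\<in>UNIV. partial i (partial i u) x) = 0)"

definition harmonic_Bloch :: "real \<Rightarrow> (real ^ 'n \<Rightarrow> real) set" where
  "harmonic_Bloch \<beta> =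
     {u. harmonic_on (ball 0 1) u \<and>
         bdd_above ((\<lambda>x. (1 - norm x) powr \<beta> * norm (gradient u x)) ` ball 0 1)}"

definition harmonic_Bloch_map :: "real \<Rightarrow> (real ^ 'n \<Rightarrow> real ^ 'm) set" where
  "harmonic_Bloch_map \<beta> = {f. \<forall>j. (\<lambda>x. f x $ j) \<in> harmonic_Bloch \<beta>}"

end

theory Submission
  imports Defs
begin

text \<open>
  Write \<open>d(x) = 1 - \<bar>x\<bar>\<close>, let \<open>\<bar>\<nabla>f\<bar>\<close> be the maximal stretch, and put \<open>S = sup d\<^bsup>1-\<alpha>\<^esup> \<bar>\<nabla>f\<bar>\<close>. The Bloch condition
  makes \<open>S\<close> finite because \<open>\<beta> < 1 - \<alpha>\<close>, and integrating the gradient along radii shows that \<open>f\<close>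
  is Hoelder continuous with coefficient \<open>(2/\<alpha> + 1) S\<close> (\<open>hoelder_of_stretch_bound\<close>). What has to be
  proved is a bound for \<open>S\<close> in terms of \<open>\<alpha>\<close>, \<open>b\<close>, \<open>K\<close> and \<open>\<Omega>\<close>.
  
  Choose \<open>x\<^sub>0\<close> where the supremum is attained up to a factor 2 and let \<open>d = d(x\<^sub>0)\<close>. The interior gradient
  estimate gives \<open>S \<le> C / d\<close>, so the point is that \<open>d\<close> cannot be small. Look at \<open>f\<close> at scale \<open>d\<close> near
  \<open>\<xi> = x\<^sub>0/\<bar>x\<^sub>0\<bar>\<close>, with \<open>q = f(\<xi>) \<in> \<partial>\<Omega>\<close> and \<open>\<lambda> = S d\<^sup>\<alpha>\<close>, which is comparable to \<open>d \<bar>\<nabla>f(x\<^sub>0)\<bar>\<close>. Hoelder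
  continuity keeps \<open>f\<close> within \<open>C \<lambda> R\<^sup>\<alpha>\<close> of \<open>q\<close> on the ball of radius \<open>Rd\<close> about \<open>\<xi>\<close>. Since \<open>\<partial>\<Omega>\<close> is \<open>C\<^sup>1\<close>,
  it deviates from its tangent plane at \<open>q\<close> by a small multiple \<open>\<tau>\<close> of the distance, so for the normal \<open>\<nu>\<close>
  the harmonic function \<open>u = (f - q) \<bullet> \<nu>\<close> is at most \<open>C \<tau> \<lambda> R\<^sup>\<alpha>\<close> on the unit sphere near \<open>\<xi>\<close>. Comparison with
  a harmonic barrier gives \<open>\<bar>u\<bar> \<le> C \<lambda> (\<tau> R\<^sup>\<alpha> + R\<^bsup>\<alpha>-1\<^esup>)\<close> near \<open>x\<^sub>0\<close>. As \<open>\<alpha> < 1\<close>, the factor of \<open>\<lambda>\<close> is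
  as small as desired when \<open>R\<close> is chosen first and \<open>\<tau>\<close> afterwards. Hence \<open>\<bar>\<nabla>u(x\<^sub>0)\<bar>\<close> is much smaller than
  \<open>\<lambda>/d\<close>, whereas quasiconformality forces \<open>\<bar>\<nabla>u(x\<^sub>0)\<bar> \<ge> \<bar>\<nabla>f(x\<^sub>0)\<bar>/K \<ge> \<lambda>/(2Kd)\<close>. This is
  \<open>near_maximal_stretch_estimate\<close>; it is a quantitative form of the fact that a blow-up limit would have a
  component that is harmonic in a half-space, zero on its boundary and of sublinear growth, hence zero.
  
  The argument needs \<open>\<lambda>\<close> to be small, that is, \<open>d \<bar>\<nabla>f\<bar> \<rightarrow> 0\<close> at the sphere uniformly in \<open>f\<close>
  (\<open>stretch_uniformly_small\<close>). The image of \<open>B(z, d(z)/8)\<close> contains a ball of radius comparable to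
  \<open>(d(z) \<bar>\<nabla>f(z)\<bar>)\<^sup>2\<close> (\<open>image_contains_ball\<close>), so \<open>d \<bar>\<nabla>f\<bar>\<close> is controlled both by the distance from \<open>f(z)\<close> to
  \<open>\<partial>\<Omega>\<close> and by the volume of the image of that ball. If \<open>f(z)\<close> lies deep inside \<open>\<Omega>\<close>, it is joined to \<open>b = f(0)\<close> by
  a connected set of deep points, whose preimage joins \<open>z\<close> to \<open>0\<close> and meets all spheres about \<open>z/\<bar>z\<bar>\<close>
  of radius between \<open>d(z)\<close> and \<open>1\<close>. Around each such sphere an annulus has image of volume bounded below
  (\<open>boundary_distance_le_vol_annulus\<close>). The annuli at the scales \<open>64\<^bsup>-j\<^esup>\<close> are disjoint and \<open>\<Omega>\<close> is bounded,
  so there are only boundedly many of them, and \<open>d(z)\<close> is bounded below. In this way volumes of images take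
  the place of moduli of curve families.
  
  The facts on harmonic functions all come from the weak maximum principle: comparing the odd part of a
  function in a coordinate with the same barrier yields the interior gradient estimate.
\<close>

section \<open>The Laplacian along coordinate lines and the maximum principle\<close>

text \<open>
  A pointwise form of \<open>\<Delta>u(x) = L\<close> through iterated derivatives along the coordinate lines through \<open>x\<close>.
  It is what the definition of harmonic functions provides, it suffices for the second derivative test, and it is
  stable under the affine changes of variables that occur below.
\<close>

definition has_laplacian :: "(real ^ 'n \<Rightarrow> real) \<Rightarrow> real \<Rightarrow> real ^ 'n \<Rightarrow> bool" where
  "has_laplacian u L x \<longleftrightarrow>
     (\<exists>g s. (\<forall>i. (\<forall>\<^sub>F t in nhds 0. ((\<lambda>t. u (x + t *\<^sub>R axis i 1)) has_real_derivative g i t) (at t)) \<and>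
                 (g i has_real_derivative s i) (at 0)) \<and>
            L = (\<Sum>i\<in>UNIV. s i))"

lemma has_laplacianI:
  assumes "\<And>i. \<forall>\<^sub>F t in nhds 0. ((\<lambda>t. u (x + t *\<^sub>R axis i 1)) has_real_derivative g i t) (at t)"
    and "\<And>i. (g i has_real_derivative s i) (at 0)"
    and "L = (\<Sum>i\<in>UNIV. s i)"
  shows "has_laplacian u L x"
  unfolding has_laplacian_def using assms by (intro exI[of _ g] exI[of _ s]) simp

lemma has_laplacianE:
  assumes "has_laplacian u L x"
  obtains g s where "\<And>i. \<forall>\<^sub>F t in nhds 0. ((\<lambda>t. u (x + t *\<^sub>R axis i 1)) has_real_derivative g i t) (at t)"
    "\<And>i. (g i has_real_derivative s i) (at 0)" "L = (\<Sum>i\<in>UNIV. s i)"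
proof -
  from assms obtain g s where
    "(\<forall>i. (\<forall>\<^sub>F t in nhds 0. ((\<lambda>t. u (x + t *\<^sub>R axis i 1)) has_real_derivative g i t) (at t)) \<and>
                 (g i has_real_derivative s i) (at 0)) \<and> L = (\<Sum>i\<in>UNIV. s i)"
    unfolding has_laplacian_def by (elim exE)
  then show ?thesis by (intro that[of g s]) simp_all
qed

lemma has_laplacian_add:
  assumes "has_laplacian u L x" "has_laplacian v M x"
  shows "has_laplacian (\<lambda>x. u x + v x) (L + M) x"
proof -
  obtain g s where g: "\<And>i. \<forall>\<^sub>F t in nhds 0. ((\<lambda>t. u (x + t *\<^sub>R axis i 1)) has_real_derivative g i t) (at t)"
    "\<And>i. (g i has_real_derivative s i) (at 0)" "L = (\<Sum>i\<in>UNIV. s i)"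
    by (rule has_laplacianE[OF assms(1)]) (rule that; simp)
  obtain h r where h: "\<And>i. \<forall>\<^sub>F t in nhds 0. ((\<lambda>t. v (x + t *\<^sub>R axis i 1)) has_real_derivative h i t) (at t)"
    "\<And>i. (h i has_real_derivative r i) (at 0)" "M = (\<Sum>i\<in>UNIV. r i)"
    by (rule has_laplacianE[OF assms(2)]) (rule that; simp)
  show ?thesis
  proof (rule has_laplacianI)
    show "\<forall>\<^sub>F t in nhds 0. ((\<lambda>t. u (x + t *\<^sub>R axis i 1) + v (x + t *\<^sub>R axis i 1)) has_real_derivative g i t + h i t) (at t)" for i
      using g(1)[of i] h(1)[of i] by eventually_elim (rule DERIV_add)
    show "((\<lambda>t. g i t + h i t) has_real_derivative s i + r i) (at 0)" for i
      by (intro DERIV_add g h)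
  qed (simp add: g h sum.distrib)
qed

lemma has_laplacian_cmult:
  assumes "has_laplacian u L x"
  shows "has_laplacian (\<lambda>x. c * u x) (c * L) x"
proof -
  obtain g s where g: "\<And>i. \<forall>\<^sub>F t in nhds 0. ((\<lambda>t. u (x + t *\<^sub>R axis i 1)) has_real_derivative g i t) (at t)"
    "\<And>i. (g i has_real_derivative s i) (at 0)" "L = (\<Sum>i\<in>UNIV. s i)"
    by (rule has_laplacianE[OF assms(1)]) (rule that; simp)
  show ?thesis
  proof (rule has_laplacianI)
    show "\<forall>\<^sub>F t in nhds 0. ((\<lambda>t. c * u (x + t *\<^sub>R axis i 1)) has_real_derivative c * g i t) (at t)" for i
      using g(1)[of i] by eventually_elim (rule DERIV_cmult)
    show "((\<lambda>t. c * g i t) has_real_derivative c * s i) (at 0)" for i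
      by (intro DERIV_cmult g)
  qed (simp add: g sum_distrib_left)
qed

lemma has_laplacian_uminus:
  "has_laplacian u L x \<Longrightarrow> has_laplacian (\<lambda>x. - u x) (- L) x"
  using has_laplacian_cmult[of u L x "-1"] by simp

lemma has_laplacian_diff:
  assumes "has_laplacian u L x" "has_laplacian v M x"
  shows "has_laplacian (\<lambda>x. u x - v x) (L - M) x"
  using has_laplacian_add[OF assms(1) has_laplacian_uminus[OF assms(2)]] by simp

lemma has_laplacian_const: "has_laplacian (\<lambda>x. c) 0 x"
  by (rule has_laplacianI[where g="\<lambda>i t. 0" and s="\<lambda>i. 0"]) auto

lemma has_laplacian_sum:
  assumes "finite I" "\<And>j. j \<in> I \<Longrightarrow> has_laplacian (u j) (L j) x"
  shows "has_laplacian (\<lambda>x. \<Sum>j\<in>I. u j x) (\<Sum>j\<in>I. L j) x"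
  using assms by (induction I) (auto intro: has_laplacian_add has_laplacian_const)

lemma has_laplacian_inner: "has_laplacian (\<lambda>x. (x - c) \<bullet> e) 0 x"
  by (rule has_laplacianI[where g="\<lambda>i t. axis i 1 \<bullet> e" and s="\<lambda>i. 0"])
     (auto intro!: derivative_eq_intros always_eventually simp: inner_simps)

lemma has_laplacian_inner_square:
  fixes c e x :: "real ^ 'n"
  shows "has_laplacian (\<lambda>x. ((x - c) \<bullet> e)\<^sup>2) (2 * (norm e)\<^sup>2) x"
proof (rule has_laplacianI[where g="\<lambda>i t. 2 * ((x - c) \<bullet> e + t * (e $ i)) * (e $ i)" and s="\<lambda>i. 2 * (e $ i)\<^sup>2"])
  have ax: "axis i 1 \<bullet> e = e $ i" for i
    by (simp add: inner_axis' )
  show "\<forall>\<^sub>F t in nhds 0. ((\<lambda>t. ((x + t *\<^sub>R axis i 1 - c) \<bullet> e)\<^sup>2) has_real_derivative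
           2 * ((x - c) \<bullet> e + t * (e $ i)) * (e $ i)) (at t)" for i
    by (rule always_eventually)
       (auto intro!: derivative_eq_intros simp: inner_simps ax algebra_simps)
  show "((\<lambda>t. 2 * ((x - c) \<bullet> e + t * (e $ i)) * (e $ i)) has_real_derivative 2 * (e $ i)\<^sup>2) (at 0)" for i
    by (auto intro!: derivative_eq_intros simp: power2_eq_square)
  show "2 * (norm e)\<^sup>2 = (\<Sum>i\<in>UNIV. 2 * (e $ i)\<^sup>2)"
    unfolding power2_norm_eq_inner by (simp add: inner_vec_def sum_distrib_left power2_eq_square)
qed

lemma has_laplacian_norm_square:
  fixes c x :: "real ^ 'n"
  shows "has_laplacian (\<lambda>x. (norm (x - c))\<^sup>2) (2 * CARD('n)) x"
proof -
  have eq: "(norm (y - c))\<^sup>2 = (\<Sum>j\<in>UNIV. ((y - c) \<bullet> axis j 1)\<^sup>2)" for y :: "real ^ 'n"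
    unfolding power2_norm_eq_inner inner_vec_def[of "y - c" "y - c"] by (simp add: inner_axis power2_eq_square)
  have "has_laplacian (\<lambda>x. \<Sum>j\<in>UNIV. ((x - c) \<bullet> axis j (1::real))\<^sup>2) (\<Sum>j\<in>(UNIV::'n set). 2 * (norm (axis j (1::real)))\<^sup>2) x"
    by (intro has_laplacian_sum has_laplacian_inner_square) auto
  then show ?thesis
    by (simp add: eq mult.commute)
qed

lemma has_laplacian_shift:
  assumes "has_laplacian u L (x + v)"
  shows "has_laplacian (\<lambda>x. u (x + v)) L x"
  using assms unfolding has_laplacian_def by (simp add: add_ac)

lemma eventually_line_in_open:
  fixes x v :: "'a::real_normed_vector"
  assumes "open S" "x \<in> S"
  shows "\<forall>\<^sub>F t in nhds (0::real). x + t *\<^sub>R v \<in> S"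
proof -
  have "((\<lambda>t::real. x + t *\<^sub>R v) \<longlongrightarrow> x) (nhds 0)"
    by (auto intro!: tendsto_eq_intros filterlim_ident)
  then show ?thesis using assms by (rule topological_tendstoD)
qed

lemma has_laplacian_cong:
  assumes "open S" "x \<in> S" "\<And>y. y \<in> S \<Longrightarrow> u y = w y" and u: "has_laplacian u L x"
  shows "has_laplacian w L x"
proof -
  obtain g s where g: "\<And>i. \<forall>\<^sub>F t in nhds 0. ((\<lambda>t. u (x + t *\<^sub>R axis i 1)) has_real_derivative g i t) (at t)"
    "\<And>i. (g i has_real_derivative s i) (at 0)" "L = (\<Sum>i\<in>UNIV. s i)"
    by (rule has_laplacianE[OF u]) (rule that; simp)
  show ?thesis
  proof (rule has_laplacianI[OF _ g(2,3)])
    fix i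
    have "\<forall>\<^sub>F t in nhds (0::real). \<forall>\<^sub>F r in nhds t. x + r *\<^sub>R axis i 1 \<in> S"
      using eventually_line_in_open[OF assms(1,2)] by (simp add: eventually_eventually)
    with g(1)[of i] show "\<forall>\<^sub>F t in nhds 0. ((\<lambda>t. w (x + t *\<^sub>R axis i 1)) has_real_derivative g i t) (at t)"
    proof eventually_elim
      case (elim t)
      have "\<forall>\<^sub>F r in nhds t. u (x + r *\<^sub>R axis i 1) = w (x + r *\<^sub>R axis i 1)"
        using elim(2) by eventually_elim (rule assms(3))
      then show ?case using elim(1) by (subst (asm) DERIV_cong_ev[OF refl _ refl])
    qed
  qed
qed

text \<open>
  Along the reflected coordinate the first derivative changes its sign and the second one does not; along the other
  coordinates nothing changes.
\<close>

lemma has_laplacian_reflect: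
  fixes x z :: "real ^ 'n"
  assumes "has_laplacian u L (z + (x - (2 * x $ k) *\<^sub>R axis k 1))"
  shows "has_laplacian (\<lambda>x. u (z + (x - (2 * x $ k) *\<^sub>R axis k 1))) L x"
proof -
  define R where "R = (\<lambda>x::real^'n. z + (x - (2 * x $ k) *\<^sub>R axis k 1))"
  have "has_laplacian u L (R x)" using assms by (simp add: R_def)
  then obtain g s where g: "\<And>i. \<forall>\<^sub>F t in nhds 0. ((\<lambda>t. u (R x + t *\<^sub>R axis i 1)) has_real_derivative g i t) (at t)"
    "\<And>i. (g i has_real_derivative s i) (at 0)" "L = (\<Sum>i\<in>UNIV. s i)"
    by (rule has_laplacianE) (rule that; simp)
  have Rk: "R (x + t *\<^sub>R axis k 1) = R x + (- t) *\<^sub>R axis k 1" for t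
    by (simp add: R_def vec_eq_iff axis_def algebra_simps)
  have Ri: "R (x + t *\<^sub>R axis i 1) = R x + t *\<^sub>R axis i 1" if "i \<noteq> k" for t i
    using that by (simp add: R_def vec_eq_iff axis_def algebra_simps)
  have "has_laplacian (\<lambda>x. u (R x)) L x"
  proof (rule has_laplacianI[where g="\<lambda>i t. if i = k then - g i (- t) else g i t" and s = s])
    fix i
    show "\<forall>\<^sub>F t in nhds 0. ((\<lambda>t. u (R (x + t *\<^sub>R axis i 1))) has_real_derivative
             (if i = k then - g i (- t) else g i t)) (at t)"
    proof (cases "i = k")
      case True
      have "filterlim (\<lambda>t::real. - t) (nhds 0) (nhds 0)"
        using tendsto_minus[OF filterlim_ident[of "nhds (0::real)"]] by simp
      with g(1)[of k] have "\<forall>\<^sub>F t in nhds 0. ((\<lambda>t. u (R x + t *\<^sub>R axis k 1)) has_real_derivative g k (- t)) (at (- t))"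
        by (rule eventually_compose_filterlim)
      then show ?thesis
      proof eventually_elim
        case (elim t)
        have "((\<lambda>t. u (R x + (- t) *\<^sub>R axis k 1)) has_real_derivative g k (- t) * (- 1)) (at t)"
          by (rule DERIV_chain2[where f = "\<lambda>t. u (R x + t *\<^sub>R axis k 1)" and g = uminus]) (use elim in \<open>auto intro!: derivative_eq_intros\<close>)
        then show ?case using True by (simp add: Rk)
      qed
    next
      case False
      then show ?thesis using g(1)[of i] by (simp add: Ri)
    qed
    show "((\<lambda>t. if i = k then - g i (- t) else g i t) has_real_derivative s i) (at 0)"
    proof (cases "i = k")
      case True
      have "((\<lambda>t. g k (- t)) has_real_derivative s k * (- 1)) (at 0)"
        by (rule DERIV_chain2[where f = "g k" and g = uminus]) (use g(2)[of k] in \<open>auto intro!: derivative_eq_intros\<close>)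
      then have "((\<lambda>t. - g k (- t)) has_real_derivative s k) (at 0)"
        using DERIV_minus by fastforce
      then show ?thesis using True by simp
    qed (use g(2)[of i] in simp)
  qed (rule g(3))
  then show ?thesis by (simp add: R_def)
qed

lemma has_laplacian_nonpos_at_max:
  assumes "open S" "x \<in> S" "\<And>y. y \<in> S \<Longrightarrow> u y \<le> u x" and "has_laplacian u L x"
  shows "L \<le> 0"
proof -
  obtain g s where g: "\<And>i. \<forall>\<^sub>F t in nhds 0. ((\<lambda>t. u (x + t *\<^sub>R axis i 1)) has_real_derivative g i t) (at t)"
    "\<And>i. (g i has_real_derivative s i) (at 0)" "L = (\<Sum>i\<in>UNIV. s i)"
    by (rule has_laplacianE[OF assms(4)]) (rule that; simp)
  have "s i \<le> 0" for i
  proof (rule ccontr)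
    assume "\<not> s i \<le> 0"
    then have pos: "0 < s i" by simp
    define p where "p = (\<lambda>t. u (x + t *\<^sub>R axis i 1))"
    have "\<forall>\<^sub>F t in nhds 0. (p has_real_derivative g i t) (at t) \<and> x + t *\<^sub>R axis i 1 \<in> S"
      using g(1)[of i] eventually_line_in_open[OF assms(1,2), of "axis i 1"]
      unfolding p_def by eventually_elim simp
    then obtain e where e: "e > 0" "\<And>t. \<bar>t\<bar> < e \<Longrightarrow> (p has_real_derivative g i t) (at t) \<and> x + t *\<^sub>R axis i 1 \<in> S"
      unfolding eventually_nhds_metric by (auto simp: dist_real_def)
    have le: "p t \<le> p 0" if "\<bar>t\<bar> < e" for t
      using assms(3)[of "x + t *\<^sub>R axis i 1"] e(2)[OF that] by (simp add: p_def)
    have "g i 0 = 0"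
    proof (rule DERIV_local_max)
      show "(p has_real_derivative g i 0) (at 0)" using e by simp
      show "0 < e" by (rule e)
      show "\<forall>y. \<bar>0 - y\<bar> < e \<longrightarrow> p y \<le> p 0" using le by simp
    qed
    obtain d where d: "d > 0" "\<And>h. 0 < h \<Longrightarrow> h < d \<Longrightarrow> g i 0 < g i (0 + h)"
      using DERIV_pos_inc_right[OF g(2)[of i] pos] by auto
    define t where "t = min d e / 2"
    have t: "0 < t" "t < d" "t < e" using d e by (auto simp: t_def)
    obtain c where c: "0 < c" "c < t" "p t - p 0 = (t - 0) * g i c"
      using MVT2[of 0 t p "g i"] t e(2) by fastforce
    have "0 < g i c" using d(2)[of c] c t \<open>g i 0 = 0\<close> by simp
    then have "0 < p t - p 0" using c t by simp
    then have "p t > p 0" by simp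
    with le[of t] t show False by simp
  qed
  then show ?thesis using g(3) by (simp add: sum_nonpos)
qed

text \<open>
  Adding \<open>e \<bar>x\<bar>\<^sup>2\<close> makes the Laplacian positive, so the maximum over the closure cannot be attained inside; \<open>e\<close> is
  small enough for the perturbation not to absorb the assumed excess over \<open>c\<close>.
\<close>

lemma weak_maximum_principle:
  fixes w :: "real ^ 'n \<Rightarrow> real"
  assumes "open D" "bounded D" and cont: "continuous_on (closure D) w"
    and lap: "\<And>x. x \<in> D \<Longrightarrow> has_laplacian w 0 x"
    and fr: "\<And>x. x \<in> frontier D \<Longrightarrow> w x \<le> c" and x: "x \<in> D"
  shows "w x \<le> c"
proof (rule ccontr)
  assume "\<not> w x \<le> c"
  obtain B where B: "B > 0" "\<And>y. y \<in> closure D \<Longrightarrow> norm y \<le> B"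
    using bounded_closure[OF assms(2)] bounded_pos by blast
  define e where "e = (w x - c) / (2 * B\<^sup>2)"
  have e: "e > 0" using \<open>\<not> w x \<le> c\<close> B by (simp add: e_def)
  define v where "v = (\<lambda>y. w y + e * (norm (y - 0))\<^sup>2)"
  have "compact (closure D)" using assms(2) by (simp add: compact_closure)
  moreover have "continuous_on (closure D) v"
    unfolding v_def by (intro continuous_intros cont)
  ultimately obtain y where y: "y \<in> closure D" "\<And>z. z \<in> closure D \<Longrightarrow> v z \<le> v y"
    using continuous_attains_sup[of "closure D" v] x closure_subset by blast
  have "y \<in> D"
  proof (rule ccontr)
    assume "y \<notin> D"
    then have "y \<in> frontier D" using y(1) assms(1) by (simp add: frontier_def interior_open)
    then have "w y \<le> c" by (rule fr)
    moreover have "(norm y)\<^sup>2 \<le> B\<^sup>2" using B(2)[OF y(1)] by (simp add: power_mono)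
    then have "e * (norm y)\<^sup>2 \<le> e * B\<^sup>2" using e by simp
    moreover have "e * B\<^sup>2 = (w x - c) / 2" using B by (simp add: e_def)
    moreover have "v x \<le> v y" using y(2) x closure_subset by blast
    moreover have "w x \<le> v x" using e by (simp add: v_def)
    ultimately show False using \<open>\<not> w x \<le> c\<close> by (simp add: v_def)
  qed
  have "has_laplacian v (0 + e * (2 * CARD('n))) y"
    unfolding v_def by (intro has_laplacian_add has_laplacian_cmult has_laplacian_norm_square lap \<open>y \<in> D\<close>)
  moreover have "\<And>z. z \<in> D \<Longrightarrow> v z \<le> v y" using y(2) closure_subset by blast
  ultimately have "0 + e * (2 * CARD('n)) \<le> 0"
    using has_laplacian_nonpos_at_max[OF assms(1) \<open>y \<in> D\<close>] by blast
  moreover have "0 < e * (2 * real CARD('n))" using e by simp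
  ultimately show False by linarith
qed

section \<open>Gradient estimates for harmonic functions\<close>

text \<open>
  With \<open>t = (y - \<xi>) \<bullet> e\<close>, the function \<open>h = (\<bar>y - \<xi>\<bar>\<^sup>2 - n t\<^sup>2)/\<rho>\<^sup>2 + n t/\<rho>\<close> is harmonic, non-negative on the half-ball
  \<open>\<bar>y - \<xi>\<bar> \<le> \<rho>\<close>, \<open>t \<ge> 0\<close> and at least \<open>1\<close> on its spherical part. It therefore dominates what comes in through
  the sphere, while near the flat part it is only of size \<open>t/\<rho>\<close>. The domain \<open>D\<close> may be any open part of the
  half-ball; it will be a half-ball itself, or the intersection of the unit ball with a ball about a boundary point.
\<close>

lemma half_ball_comparison_upper:
  fixes w :: "real ^ 'n \<Rightarrow> real" and e \<xi> :: "real ^ 'n" and A \<rho> \<tau> :: real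
  assumes e: "norm e = 1" and \<rho>: "\<rho> > 0" and D: "open D"
    and sub: "\<And>y. y \<in> D \<Longrightarrow> norm (y - \<xi>) < \<rho> \<and> 0 < (y - \<xi>) \<bullet> e"
    and cont: "continuous_on (closure D) w"
    and lap: "\<And>y. y \<in> D \<Longrightarrow> has_laplacian w 0 y"
    and A: "A \<ge> 0" "\<And>y. y \<in> frontier D \<Longrightarrow> w y \<le> A"
    and \<tau>: "\<tau> \<ge> 0" "\<And>y. y \<in> frontier D \<Longrightarrow> norm (y - \<xi>) < \<rho> \<Longrightarrow> w y \<le> \<tau>"
    and y: "y \<in> D"
  shows "w y \<le> \<tau> + A * (((norm (y - \<xi>))\<^sup>2 - CARD('n) * ((y - \<xi>) \<bullet> e)\<^sup>2) / \<rho>\<^sup>2 + CARD('n) * ((y - \<xi>) \<bullet> e) / \<rho>)"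
proof -
  define n where "n = real CARD('n)"
  define h where "h = (\<lambda>y. ((norm (y - \<xi>))\<^sup>2 - n * ((y - \<xi>) \<bullet> e)\<^sup>2) / \<rho>\<^sup>2 + n * ((y - \<xi>) \<bullet> e) / \<rho>)"
  have n0: "n \<ge> 0" by (simp add: n_def)
  have laph: "has_laplacian h 0 y" for y
  proof -
    have "has_laplacian (\<lambda>y. (1 / \<rho>\<^sup>2) * ((norm (y - \<xi>))\<^sup>2 - n * ((y - \<xi>) \<bullet> e)\<^sup>2) + (n / \<rho>) * ((y - \<xi>) \<bullet> e))
       ((1 / \<rho>\<^sup>2) * (2 * CARD('n) - n * (2 * (norm e)\<^sup>2)) + (n / \<rho>) * 0) y"
      by (intro has_laplacian_add has_laplacian_cmult has_laplacian_diff
          has_laplacian_norm_square has_laplacian_inner_square has_laplacian_inner)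
    then show ?thesis
      by (simp add: h_def n_def e)
  qed
  have bnd: "bounded D"
    using sub by (intro bounded_subset[OF bounded_ball[of \<xi> \<rho>]]) (auto simp: dist_norm norm_minus_commute)
  have cl: "norm (y - \<xi>) \<le> \<rho> \<and> 0 \<le> (y - \<xi>) \<bullet> e" if "y \<in> closure D" for y
  proof -
    have "closed ({y. norm (y - \<xi>) \<le> \<rho>} \<inter> {y. 0 \<le> (y - \<xi>) \<bullet> e})"
      by (intro closed_Int closed_Collect_le continuous_intros)
    moreover have "D \<subseteq> {y. norm (y - \<xi>) \<le> \<rho>} \<inter> {y. 0 \<le> (y - \<xi>) \<bullet> e}"
      using sub by force
    ultimately show ?thesis using closure_minimal that by blast
  qed
  have "w y - A * h y \<le> \<tau>"
  proof (rule weak_maximum_principle[OF D bnd _ _ _ y])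
    show "continuous_on (closure D) (\<lambda>y. w y - A * h y)"
      unfolding h_def using \<rho> by (intro continuous_intros cont) auto
    show "has_laplacian (\<lambda>y. w y - A * h y) 0 x" if "x \<in> D" for x
      using has_laplacian_diff[OF lap[OF that] has_laplacian_cmult[OF laph, of A]] by simp
    fix x assume x: "x \<in> frontier D"
    then have "x \<in> closure D" by (simp add: frontier_def)
    note c = cl[OF this]
    define p where "p = norm (x - \<xi>) / \<rho>"
    define s where "s = (x - \<xi>) \<bullet> e / \<rho>"
    have ps: "0 \<le> s" "s \<le> p" "p \<le> 1"
      using c \<rho> norm_cauchy_schwarz[of "x - \<xi>" e] by (auto simp: p_def s_def e divide_right_mono)
    \<comment> \<open>Both properties of the barrier are visible in this form, since \<open>0 \<le> s \<le> 1\<close>.\<close>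
    have h: "h x = p\<^sup>2 + n * (s * (1 - s))"
      using \<rho> by (simp add: h_def p_def s_def field_simps power2_eq_square)
    have ns: "n * (s * (1 - s)) \<ge> 0" using ps n0 by (intro mult_nonneg_nonneg) auto
    show "w x - A * h x \<le> \<tau>"
    proof (cases "norm (x - \<xi>) < \<rho>")
      case True
      have "A * h x \<ge> 0" using A ns by (simp add: h)
      then show ?thesis using \<tau>(2)[OF x True] by simp
    next
      case False
      then have "p = 1" using c \<rho> by (simp add: p_def)
      then have "1 \<le> h x" using ns by (simp add: h)
      then have "A * 1 \<le> A * h x" using A(1) by (rule mult_left_mono)
      then show ?thesis using A(2)[OF x] \<tau> by simp
    qed
  qed
  then show ?thesis by (simp add: h_def n_def)
qed

lemma half_ball_comparison:
  fixes w :: "real ^ 'n \<Rightarrow> real" and e \<xi> :: "real ^ 'n" and A \<rho> \<tau> :: real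
  assumes e: "norm e = 1" and \<rho>: "\<rho> > 0" and D: "open D"
    and sub: "\<And>y. y \<in> D \<Longrightarrow> norm (y - \<xi>) < \<rho> \<and> 0 < (y - \<xi>) \<bullet> e"
    and cont: "continuous_on (closure D) w"
    and lap: "\<And>y. y \<in> D \<Longrightarrow> has_laplacian w 0 y"
    and A: "A \<ge> 0" "\<And>y. y \<in> frontier D \<Longrightarrow> \<bar>w y\<bar> \<le> A"
    and \<tau>: "\<tau> \<ge> 0" "\<And>y. y \<in> frontier D \<Longrightarrow> norm (y - \<xi>) < \<rho> \<Longrightarrow> \<bar>w y\<bar> \<le> \<tau>"
    and y: "y \<in> D"
  shows "\<bar>w y\<bar> \<le> \<tau> + A * (((norm (y - \<xi>))\<^sup>2 - CARD('n) * ((y - \<xi>) \<bullet> e)\<^sup>2) / \<rho>\<^sup>2 + CARD('n) * ((y - \<xi>) \<bullet> e) / \<rho>)"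
proof -
  have "w y \<le> \<tau> + A * (((norm (y - \<xi>))\<^sup>2 - CARD('n) * ((y - \<xi>) \<bullet> e)\<^sup>2) / \<rho>\<^sup>2 + CARD('n) * ((y - \<xi>) \<bullet> e) / \<rho>)"
    by (rule half_ball_comparison_upper[OF e \<rho> D sub cont lap A(1) _ \<tau>(1) _ y])
       (use A(2) \<tau>(2) in \<open>auto simp: abs_le_iff\<close>)
  moreover have "- w y \<le> \<tau> + A * (((norm (y - \<xi>))\<^sup>2 - CARD('n) * ((y - \<xi>) \<bullet> e)\<^sup>2) / \<rho>\<^sup>2 + CARD('n) * ((y - \<xi>) \<bullet> e) / \<rho>)"
  proof (rule half_ball_comparison_upper[OF e \<rho> D sub _ _ A(1) _ \<tau>(1) _ y])
    show "continuous_on (closure D) (\<lambda>y. - w y)" by (intro continuous_intros cont)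
    show "has_laplacian (\<lambda>y. - w y) 0 y" if "y \<in> D" for y
      using has_laplacian_uminus[OF lap[OF that]] by simp
  qed (use A(2) \<tau>(2) in \<open>auto simp: abs_le_iff\<close>)
  ultimately show ?thesis by (simp add: abs_le_iff)
qed

lemma has_real_derivative_abs_le:
  fixes p :: "real \<Rightarrow> real"
  assumes "(p has_real_derivative l) (at 0)" "p 0 = 0" "r > 0"
    and "\<And>t. 0 < t \<Longrightarrow> t < r \<Longrightarrow> \<bar>p t\<bar> \<le> c * t"
  shows "\<bar>l\<bar> \<le> c"
proof -
  have "((\<lambda>t. p t / t) \<longlongrightarrow> l) (at 0)"
    using assms(1,2) by (simp add: DERIV_def)
  then have "((\<lambda>t. \<bar>p t / t\<bar>) \<longlongrightarrow> \<bar>l\<bar>) (at_right 0)"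
    by (intro tendsto_rabs) (rule filterlim_mono[OF _ order_refl], auto simp: at_le)
  moreover have "\<forall>\<^sub>F t in at_right 0. \<bar>p t / t\<bar> \<le> c"
    using eventually_at_right_real[OF assms(3)]
  proof eventually_elim
    case (elim t)
    then show ?case using assms(4)[of t] by (simp add: abs_divide field_simps)
  qed
  ultimately show ?thesis
    by (rule tendsto_upperbound) simp
qed

lemma has_derivative_translate:
  assumes "(u has_derivative u') (at (x + p))"
  shows "((\<lambda>x. u (x + p)) has_derivative u') (at x)"
  using has_derivative_compose[where f = "\<lambda>x. x + p" and f' = "\<lambda>h. h" and g = u and x = x and s = UNIV, OF _ assms]
  by (simp add: has_derivative_add_const)

lemma norm_reflect_axis: "norm (y - (2 * y $ k) *\<^sub>R axis k 1) = norm (y :: real ^ 'n)"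
proof -
  have "(norm (y - (2 * y $ k) *\<^sub>R axis k 1))\<^sup>2 = (norm y)\<^sup>2"
    unfolding power2_norm_eq_inner by (simp add: inner_simps inner_axis inner_axis' algebra_simps)
  then show ?thesis by simp
qed

text \<open>
  The difference of \<open>u\<close> and its reflection in the hyperplane through \<open>z\<close> vanishes on that hyperplane, so it is at most
  \<open>2 m\<close> times the barrier on a half-ball. On the axis the barrier is at most \<open>n t/r\<close>, and dividing by \<open>2 t\<close> yields
  the derivative.
\<close>

lemma partial_derivative_estimate:
  fixes u :: "real ^ 'n \<Rightarrow> real" and m r :: real
  assumes r: "r > 0" and lap: "\<And>x. x \<in> cball z r \<Longrightarrow> has_laplacian u 0 x"
    and cont: "continuous_on (cball z r) u"
    and m: "\<And>x. x \<in> cball z r \<Longrightarrow> \<bar>u x\<bar> \<le> m"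
    and der: "(u has_derivative u') (at z)"
  shows "\<bar>u' (axis k 1)\<bar> \<le> CARD('n) * m / r"
proof -
  define e where "e = (axis k 1 :: real ^ 'n)"
  have e: "norm e = 1" by (simp add: e_def)
  define R where "R = (\<lambda>y::real^'n. y - (2 * y $ k) *\<^sub>R axis k 1)"
  define w where "w = (\<lambda>y. u (y + z) - u (z + R y))"
  define D where "D = {y::real^'n. norm (y - 0) < r} \<inter> {y. 0 < (y - 0) \<bullet> e}"
  have ye: "y \<bullet> e = y $ k" for y :: "real ^ 'n" by (simp add: e_def inner_axis)
  have oD: "open D"
    unfolding D_def by (intro open_Int open_Collect_less continuous_intros)
  have cl: "norm y \<le> r \<and> 0 \<le> y \<bullet> e" if "y \<in> closure D" for y
  proof -
    have "closed ({y. norm y \<le> r} \<inter> {y. 0 \<le> y \<bullet> e})"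
      by (intro closed_Int closed_Collect_le continuous_intros)
    moreover have "D \<subseteq> {y. norm y \<le> r} \<inter> {y. 0 \<le> y \<bullet> e}"
      by (auto simp: D_def)
    ultimately show ?thesis using closure_minimal that by blast
  qed
  have in1: "y + z \<in> cball z r" "z + R y \<in> cball z r" if "norm y \<le> r" for y
    using that norm_reflect_axis[of y k] by (auto simp: dist_norm R_def norm_minus_commute)
  have m0: "m \<ge> 0" using m[of z] r by force
  have bound: "\<bar>w y\<bar> \<le> 2 * m" if "norm y \<le> r" for y
    using m[OF in1(1)[OF that]] m[OF in1(2)[OF that]] by (simp add: w_def)
  have quot: "\<bar>u (z + t *\<^sub>R e) - u (z - t *\<^sub>R e)\<bar> \<le> (2 * (CARD('n) * m / r)) * t" if t: "0 < t" "t < r" for t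
  proof -
    have tD: "t *\<^sub>R e \<in> D" using t by (auto simp: D_def e_def inner_axis)
    have "\<bar>w (t *\<^sub>R e)\<bar> \<le> 0 + 2 * m * (((norm (t *\<^sub>R e - 0))\<^sup>2 - CARD('n) * ((t *\<^sub>R e - 0) \<bullet> e)\<^sup>2) / r\<^sup>2 + CARD('n) * ((t *\<^sub>R e - 0) \<bullet> e) / r)"
    proof (rule half_ball_comparison[OF e r oD _ _ _ _ _ _ _ tD])
      have "continuous_on (closure D) (\<lambda>y. u (y + z))"
        by (rule continuous_on_compose2[OF cont]) (use cl in1 in \<open>auto intro!: continuous_intros\<close>)
      moreover have "continuous_on (closure D) (\<lambda>y. u (z + R y))"
        by (rule continuous_on_compose2[OF cont])
           (use cl in1 in \<open>auto intro!: continuous_intros simp: R_def\<close>)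
      ultimately show "continuous_on (closure D) w"
        unfolding w_def by (rule continuous_on_diff)
      show "has_laplacian w 0 y" if "y \<in> D" for y
      proof -
        have "norm y \<le> r" using that by (simp add: D_def)
        from lap[OF in1(1)[OF this]] lap[OF in1(2)[OF this]]
        have "has_laplacian (\<lambda>y. u (y + z)) 0 y" "has_laplacian (\<lambda>y. u (z + R y)) 0 y"
          unfolding R_def by (auto intro: has_laplacian_shift has_laplacian_reflect)
        from has_laplacian_diff[OF this] show ?thesis by (simp add: w_def)
      qed
      show "\<bar>w y\<bar> \<le> 2 * m" if "y \<in> frontier D" for y
        using that cl bound by (auto simp: frontier_def)
      show "\<bar>w y\<bar> \<le> 0" if "y \<in> frontier D" "norm (y - 0) < r" for y
      proof -
        have "y \<notin> D" "y \<in> closure D" using that(1) oD by (auto simp: frontier_def interior_open)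
        then have "y $ k = 0" using that(2) cl[of y] by (auto simp: D_def ye)
        then show ?thesis by (simp add: w_def R_def add.commute)
      qed
    qed (use m0 in \<open>auto simp: D_def\<close>)
    also have "\<dots> = 2 * m * ((1 - real CARD('n)) * (t / r)\<^sup>2 + CARD('n) * t / r)"
      using e by (simp add: e_def inner_axis power_divide algebra_simps diff_divide_distrib)
    also have "\<dots> \<le> 2 * m * (CARD('n) * t / r)"
    proof -
      have "1 \<le> CARD('n)" by (simp add: Suc_leI)
      then have "(1 - real CARD('n)) * (t / r)\<^sup>2 \<le> 0" by (intro mult_nonpos_nonneg) auto
      then show ?thesis using m0 by (intro mult_left_mono) auto
    qed
    finally have "\<bar>w (t *\<^sub>R e)\<bar> \<le> (2 * (CARD('n) * m / r)) * t" by (simp add: field_simps)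
    moreover have "R (t *\<^sub>R e) = - (t *\<^sub>R e)"
      by (simp add: R_def e_def vec_eq_iff axis_def)
    ultimately show ?thesis by (simp add: w_def add.commute)
  qed
  have "((\<lambda>t. u (z + t *\<^sub>R e) - u (z - t *\<^sub>R e)) has_real_derivative 2 * u' e) (at 0)"
  proof -
    have lin: "linear u'" using der by (simp add: has_derivative_linear)
    have "((\<lambda>t. u (z + t *\<^sub>R e)) has_derivative (\<lambda>t. u' (t *\<^sub>R e))) (at 0)"
      by (rule has_derivative_compose[where g = u and f = "\<lambda>t. z + t *\<^sub>R e" and f' = "\<lambda>t. t *\<^sub>R e"])
         (use der in \<open>auto intro!: derivative_eq_intros\<close>)
    moreover have "((\<lambda>t. u (z - t *\<^sub>R e)) has_derivative (\<lambda>t. u' (- (t *\<^sub>R e)))) (at 0)"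
      by (rule has_derivative_compose[where g = u and f = "\<lambda>t. z - t *\<^sub>R e" and f' = "\<lambda>t. - (t *\<^sub>R e)"])
         (use der in \<open>auto intro!: derivative_eq_intros simp: algebra_simps\<close>)
    ultimately have "((\<lambda>t. u (z + t *\<^sub>R e) - u (z - t *\<^sub>R e)) has_derivative (\<lambda>t. u' (t *\<^sub>R e) - u' (- (t *\<^sub>R e)))) (at 0)"
      by (rule has_derivative_diff)
    moreover have "(\<lambda>t. u' (t *\<^sub>R e) - u' (- (t *\<^sub>R e))) = (*) (2 * u' e)"
      by (rule ext) (simp add: linear_neg[OF lin] linear_scale[OF lin])
    ultimately show ?thesis by (simp add: has_field_derivative_def)
  qed
  then have "\<bar>2 * u' e\<bar> \<le> 2 * (CARD('n) * m / r)"
    by (rule has_real_derivative_abs_le[OF _ _ r quot]) auto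
  then show ?thesis by (simp add: e_def)
qed

text \<open>
  Differentiability is demanded separately because \<open>has_laplacian\<close> only concerns the coordinate lines.
\<close>

definition harmonic_fun :: "(real ^ 'n) set \<Rightarrow> (real ^ 'n \<Rightarrow> real) \<Rightarrow> bool" where
  "harmonic_fun S u \<longleftrightarrow> (\<forall>x\<in>S. has_laplacian u 0 x \<and> u differentiable (at x))"

lemma harmonic_fun_continuous: "harmonic_fun S u \<Longrightarrow> T \<subseteq> S \<Longrightarrow> continuous_on T u"
  unfolding harmonic_fun_def
  by (meson continuous_at_imp_continuous_on differentiable_imp_continuous_within subsetD)

lemma harmonic_gradient_estimate:
  fixes u :: "real ^ 'n \<Rightarrow> real" and m r :: real
  assumes r: "r > 0" and u: "harmonic_fun (cball z r) u"
    and m: "\<And>x. x \<in> cball z r \<Longrightarrow> \<bar>u x\<bar> \<le> m"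
    and der: "(u has_derivative u') (at z)"
  shows "\<bar>u' h\<bar> \<le> CARD('n)\<^sup>2 * m / r * norm h"
proof -
  have lin: "linear u'" using der by (simp add: has_derivative_linear)
  have "u' h = (\<Sum>k\<in>UNIV. h $ k * u' (axis k 1))"
  proof -
    have "u' h = u' (\<Sum>k\<in>UNIV. (h $ k) *\<^sub>R axis k 1)"
      using basis_expansion[of h] by (simp add: scalar_mult_eq_scaleR)
    then show ?thesis by (simp add: linear_sum[OF lin] linear_scale[OF lin])
  qed
  then have "\<bar>u' h\<bar> \<le> (\<Sum>k\<in>UNIV. \<bar>h $ k * u' (axis k 1)\<bar>)" by (simp add: sum_abs)
  also have "\<dots> \<le> (\<Sum>k\<in>(UNIV::'n set). norm h * (CARD('n) * m / r))"
  proof (rule sum_mono)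
    fix k
    have "\<bar>u' (axis k 1)\<bar> \<le> CARD('n) * m / r"
      by (rule partial_derivative_estimate[OF r _ harmonic_fun_continuous[OF u order_refl] m der])
         (use u in \<open>auto simp: harmonic_fun_def\<close>)
    then show "\<bar>h $ k * u' (axis k 1)\<bar> \<le> norm h * (CARD('n) * m / r)"
      unfolding abs_mult by (intro mult_mono component_le_norm_cart) auto
  qed
  also have "\<dots> = CARD('n)\<^sup>2 * m / r * norm h" by (simp add: power2_eq_square)
  finally show ?thesis .
qed

text \<open>
  Instead of a bound for second derivatives, the gradient estimate is applied twice: to \<open>u\<close>, which makes
  \<open>u(x + p) - u(x)\<close> of size \<open>\<bar>p\<bar>\<close>, and then to this difference, which is harmonic as well. So the gradient of
  \<open>u\<close> is Lipschitz continuous, and no third derivative of \<open>u\<close> is ever formed.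
\<close>

lemma harmonic_taylor_estimate:
  fixes u :: "real ^ 'n \<Rightarrow> real" and m r :: real
  assumes r: "r > 0" and u: "harmonic_fun (cball z r) u"
    and m: "\<And>x. x \<in> cball z r \<Longrightarrow> \<bar>u x\<bar> \<le> m"
    and der: "(u has_derivative u') (at z)" and v: "norm v \<le> r / 4"
  shows "\<bar>u (z + v) - u z - u' v\<bar> \<le> 8 * CARD('n)^4 * m / r\<^sup>2 * (norm v)\<^sup>2"
proof -
  define n where "n = real CARD('n)"
  have n0: "n \<ge> 0" by (simp add: n_def)
  have m0: "m \<ge> 0" using m[of z] r by force
  define G where "G = (\<lambda>x. frechet_derivative u (at x))"
  have G: "(u has_derivative G x) (at x)" if "x \<in> cball z r" for x
    using u that by (auto simp: harmonic_fun_def G_def frechet_derivative_works)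
  have Gz: "G z = u'" using has_derivative_unique[OF G[of z] der] r by simp
  have Gb: "\<bar>G x h\<bar> \<le> 2 * n\<^sup>2 * m / r * norm h" if "x \<in> cball z (r/2)" for x h
  proof -
    have sub: "cball x (r/2) \<subseteq> cball z r"
      using that by (intro subset_ball cball_subset_cball_iff[THEN iffD2]) (auto simp: dist_commute)
    have "\<bar>G x h\<bar> \<le> CARD('n)\<^sup>2 * m / (r/2) * norm h"
      by (rule harmonic_gradient_estimate[of "r/2" x u])
         (use r u m sub G that in \<open>auto simp: harmonic_fun_def\<close>)
    then show ?thesis by (simp add: n_def field_simps)
  qed
  have diff: "\<bar>u x - u y\<bar> \<le> 2 * n\<^sup>2 * m / r * norm (x - y)" if "x \<in> cball z (r/2)" "y \<in> cball z (r/2)" for x y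
  proof -
    have "norm (u x - u y) \<le> 2 * n\<^sup>2 * m / r * norm (x - y)"
    proof (rule differentiable_bound[where f' = G and S = "cball z (r/2)"])
      show "(u has_derivative G x) (at x within cball z (r / 2))" if "x \<in> cball z (r/2)" for x
        by (rule has_derivative_at_withinI[OF G]) (use that r in auto)
      show "onorm (G x) \<le> 2 * n\<^sup>2 * m / r" if "x \<in> cball z (r/2)" for x
        by (rule onorm_le) (use Gb[OF that] in auto)
    qed (use that in auto)
    then show ?thesis by simp
  qed
  have Gd: "\<bar>G (z + p) h - G z h\<bar> \<le> 8 * n^4 * m / r\<^sup>2 * norm v * norm h" if p: "norm p \<le> norm v" for p h
  proof -
    have sub: "x \<in> cball z (r/2)" "x + p \<in> cball z (r/2)" if "x \<in> cball z (r/4)" for x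
      using that p v r norm_triangle_ineq4[of "z - x" p] by (auto simp: dist_norm algebra_simps)
    have sub2: "x \<in> cball z r" "x + p \<in> cball z r" if "x \<in> cball z (r/4)" for x
      using sub[OF that] r by auto
    have hw: "harmonic_fun (cball z (r/4)) (\<lambda>x. u (x + p) - u x)"
      unfolding harmonic_fun_def
    proof (intro ballI conjI)
      fix x assume x: "x \<in> cball z (r/4)"
      have "has_laplacian (\<lambda>x. u (x + p)) 0 x" "has_laplacian u 0 x"
        using u sub2[OF x] by (auto simp: harmonic_fun_def intro: has_laplacian_shift)
      from has_laplacian_diff[OF this] show "has_laplacian (\<lambda>x. u (x + p) - u x) 0 x" by simp
      have "(u has_derivative G (x + p)) (at (x + p))" using G sub2[OF x] by blast
      then have "((\<lambda>x. u (x + p)) has_derivative G (x + p)) (at x)"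
        by (rule has_derivative_translate)
      from has_derivative_diff[OF this G[OF sub2(1)[OF x]]]
      show "(\<lambda>x. u (x + p) - u x) differentiable at x"
        by (rule differentiableI)
    qed
    have "\<bar>(\<lambda>h. G (z + p) h - G z h) h\<bar> \<le> CARD('n)\<^sup>2 * (2 * n\<^sup>2 * m / r * norm v) / (r/4) * norm h"
    proof (rule harmonic_gradient_estimate[OF _ hw])
      show "\<bar>u (x + p) - u x\<bar> \<le> 2 * n\<^sup>2 * m / r * norm v" if "x \<in> cball z (r/4)" for x
      proof -
        have "\<bar>u (x + p) - u x\<bar> \<le> 2 * n\<^sup>2 * m / r * norm p"
          using diff[OF sub(2)[OF that] sub(1)[OF that]] by simp
        also have "\<dots> \<le> 2 * n\<^sup>2 * m / r * norm v"
          using p m0 n0 r by (intro mult_left_mono) auto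
        finally show ?thesis .
      qed
      have z: "z \<in> cball z (r/4)" using r by simp
      have "(u has_derivative G (z + p)) (at (z + p))" using G sub2[OF z] by blast
      then have "((\<lambda>x. u (x + p)) has_derivative G (z + p)) (at z)"
        by (rule has_derivative_translate)
      then show "((\<lambda>x. u (x + p) - u x) has_derivative (\<lambda>h. G (z + p) h - G z h)) (at z)"
        using G[OF sub2(1)[OF z]] by (rule has_derivative_diff)
    qed (use r in auto)
    then show ?thesis by (simp add: n_def power2_eq_square power4_eq_xxxx field_simps)
  qed
  have "norm (u (z + v) - u z - G z (z + v - z)) \<le> norm (z + v - z) * (8 * n^4 * m / r\<^sup>2 * norm v)"
  proof (rule differentiable_bound_linearization[where f' = G and S = "cball z (norm v)"])
    show "z + t *\<^sub>R (z + v - z) \<in> cball z (norm v)" if "t \<in> {0..1}" for t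
      using that by (auto simp: dist_norm mult_left_le_one_le)
    show "(u has_derivative G x) (at x within cball z (norm v))" if "x \<in> cball z (norm v)" for x
      by (rule has_derivative_at_withinI[OF G]) (use that v r in auto)
    show "onorm (G x - G z) \<le> 8 * n^4 * m / r\<^sup>2 * norm v" if "x \<in> cball z (norm v)" for x
      by (rule onorm_le) (use Gd[of "x - z"] that in \<open>auto simp: dist_norm norm_minus_commute\<close>)
  qed auto
  then show ?thesis by (simp add: Gz n_def power2_eq_square mult_ac)
qed

section \<open>Volume of images under harmonic quasiconformal maps\<close>

text \<open>
  The constants are written out as functions of the dimension, \<open>K\<close> and a bound \<open>D\<close> for the domain in order to make their
  independence of the map visible.
\<close>

definition stretch_const :: "nat \<Rightarrow> real \<Rightarrow> real \<Rightarrow> real" where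
  "stretch_const n K D = root (2 * n) ((128 * K\<^sup>2 * real n ^ 4 * D) ^ n / unit_ball_vol n)"

definition depth_const :: "nat \<Rightarrow> real \<Rightarrow> real \<Rightarrow> real" where
  "depth_const n K D = 13 * stretch_const n K D / (1 - root (2 * n) (1 / 2))"

text \<open>
  Spheres are connected in dimension two and higher.
\<close>

lemma sphere_intermediate_distance:
  fixes p q c :: "real ^ 'n"
  assumes "2 \<le> CARD('n)" "norm p = \<rho>" "norm q = \<rho>" "norm (p - c) \<le> t" "t \<le> norm (q - c)"
  obtains b where "norm b = \<rho>" "norm (b - c) = t"
proof -
  have "connected (sphere (0::real^'n) \<rho>)"
    using assms(1) by (simp add: connected_sphere)
  then have "connected ((\<lambda>b. norm (b - c)) ` sphere 0 \<rho>)"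
    by (intro connected_continuous_image continuous_intros)
  then have "{norm (p - c)..norm (q - c)} \<subseteq> (\<lambda>b. norm (b - c)) ` sphere 0 \<rho>"
    by (rule connected_contains_Icc) (use assms in auto)
  then have "t \<in> (\<lambda>b. norm (b - c)) ` sphere 0 \<rho>" using assms by auto
  then show ?thesis using that by auto
qed

lemma unit_direction:
  fixes y :: "real ^ 'n"
  obtains \<nu> where "norm \<nu> = 1" "norm y = y \<bullet> \<nu>"
proof (cases "y = 0")
  case True
  then show ?thesis using that[of "axis undefined 1"] by simp
next
  case False
  then show ?thesis
    using that[of "y /\<^sub>R norm y"] by (simp add: dot_square_norm power2_eq_square)
qed

lemma compact_deep_points:
  fixes \<Omega> :: "'a::heine_borel set"
  assumes "bounded \<Omega>" and e: "e > 0"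
  shows "compact {y \<in> \<Omega>. e \<le> infdist y (frontier \<Omega>)}"
proof -
  have "{y \<in> \<Omega>. e \<le> infdist y (frontier \<Omega>)} = closure \<Omega> \<inter> {y. e \<le> infdist y (frontier \<Omega>)}"
    using e closure_subset[of \<Omega>] by (auto simp: closure_Un_frontier)
  moreover have "closed {y. e \<le> infdist y (frontier \<Omega>)}"
    by (intro closed_Collect_le continuous_intros)
  ultimately show ?thesis using assms(1) by (simp add: compact_closure compact_Int_closed)
qed

text \<open>
  The properties of the map that enter the estimates. Here \<open>f'\<close> is its derivative, and \<open>s\<close> its maximal stretch, up to
  \<open>K\<close> also a lower bound for the stretch in every direction. Harmonicity is stated for all projections because
  vector estimates are reduced to scalar ones by projecting to a suitable direction. The dimension \<open>N\<close> is a parameter, so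
  that the constants can be mentioned without reference to the type.
\<close>

locale harmonic_qc_map =
  fixes \<Omega> :: "(real ^ 'n) set" and f g :: "real ^ 'n \<Rightarrow> real ^ 'n"
    and f' :: "real ^ 'n \<Rightarrow> real ^ 'n \<Rightarrow> real ^ 'n" and s :: "real ^ 'n \<Rightarrow> real" and K D :: real and N :: nat
  assumes N_eq: "N = CARD('n)" and dim: "2 \<le> CARD('n)" and K: "K \<ge> 1" and D: "D > 0"
    and open_\<Omega>: "open \<Omega>" and \<Omega>_bound: "\<Omega> \<subseteq> cball 0 D"
    and hom: "homeomorphism (ball 0 1) \<Omega> f g"
    and der: "\<And>x. x \<in> ball 0 1 \<Longrightarrow> (f has_derivative f' x) (at x)"
    and upper: "\<And>x h. x \<in> ball 0 1 \<Longrightarrow> norm (f' x h) \<le> s x * norm h"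
    and lower: "\<And>x h. x \<in> ball 0 1 \<Longrightarrow> s x * norm h \<le> K * norm (f' x h)"
    and harm: "\<And>\<nu>. harmonic_fun (ball 0 1) (\<lambda>x. f x \<bullet> \<nu>)"
begin

abbreviation n :: real where "n \<equiv> real N"
abbreviation C :: real where "C \<equiv> stretch_const N K D"
abbreviation root2n :: "real \<Rightarrow> real" where "root2n \<equiv> root (2 * N)"

definition vol :: "(real ^ 'n) set \<Rightarrow> real" where
  "vol S = measure lebesgue (f ` S)"

lemma n_ge_1: "n \<ge> 1" using dim N_eq by simp

lemma N_pos: "0 < 2 * N" using dim N_eq by simp

lemma f_in: "x \<in> ball 0 1 \<Longrightarrow> f x \<in> \<Omega>"
  using hom by (auto simp: homeomorphism_def)

lemma f_surj: "f ` ball 0 1 = \<Omega>"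
  using hom by (auto simp: homeomorphism_def)

lemma f_inj: "inj_on f (ball 0 1)"
  by (rule inj_on_inverseI[of _ g]) (use hom in \<open>auto simp: homeomorphism_def\<close>)

lemma f_cont: "continuous_on (ball 0 1) f"
  using hom by (auto simp: homeomorphism_def)

lemma f_norm: "x \<in> ball 0 1 \<Longrightarrow> norm (f x) \<le> D"
  using f_in \<Omega>_bound by fastforce

lemma bounded_\<Omega>: "bounded \<Omega>"
  using \<Omega>_bound bounded_cball bounded_subset by blast

lemma frontier_nonempty: "frontier \<Omega> \<noteq> {}"
  using bounded_\<Omega> f_in[of 0] by (auto simp: frontier_eq_empty)

lemma s_nonneg: "x \<in> ball 0 1 \<Longrightarrow> 0 \<le> s x"
  using order_trans[OF norm_ge_zero upper[of x "axis undefined 1"]] by simp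

lemma f'_inner: "x \<in> ball 0 1 \<Longrightarrow> ((\<lambda>x. f x \<bullet> \<nu>) has_derivative (\<lambda>h. f' x h \<bullet> \<nu>)) (at x)"
  by (intro derivative_intros der)

lemma inner_bound:
  assumes "norm \<nu> = 1" "x \<in> ball 0 1"
  shows "\<bar>f x \<bullet> \<nu>\<bar> \<le> D"
  using Cauchy_Schwarz_ineq2[of "f x" \<nu>] f_norm[OF assms(2)] assms(1) by simp

lemma half_depth_cball:
  assumes "x \<in> ball (0::real^'n) 1"
  shows "cball x ((1 - norm x) / 2) \<subseteq> ball 0 1"
proof
  fix y assume "y \<in> cball x ((1 - norm x) / 2)"
  then have "norm (y - x) \<le> (1 - norm x) / 2" by (simp add: dist_norm norm_minus_commute)
  then show "y \<in> ball 0 1" using norm_triangle_sub[of y x] assms by simp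
qed

lemma stretch_bound:
  assumes x: "x \<in> ball 0 1"
  shows "(1 - norm x) * s x \<le> 2 * K * n\<^sup>2 * D"
proof -
  define d where "d = 1 - norm x"
  have d: "d > 0" using x by (simp add: d_def)
  define h :: "real ^ 'n" where "h = axis undefined 1"
  obtain \<nu> where \<nu>: "norm \<nu> = 1" "norm (f' x h) = f' x h \<bullet> \<nu>" by (rule unit_direction)
  have "\<bar>f' x h \<bullet> \<nu>\<bar> \<le> N\<^sup>2 * D / (d/2) * norm h"
  unfolding N_eq
  proof (rule harmonic_gradient_estimate[OF _ _ _ f'_inner[OF x]])
    show "harmonic_fun (cball x (d / 2)) (\<lambda>x. f x \<bullet> \<nu>)"
      using harm[of \<nu>] half_depth_cball[OF x] unfolding harmonic_fun_def d_def by blast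
    show "\<bar>f y \<bullet> \<nu>\<bar> \<le> D" if "y \<in> cball x (d/2)" for y
      using half_depth_cball[OF x] that by (intro inner_bound \<nu>) (auto simp: d_def)
  qed (use d N_eq in auto)
  then have "norm (f' x h) \<le> n\<^sup>2 * D / (d/2)" using \<nu> by (simp add: h_def)
  then have "K * norm (f' x h) \<le> K * (n\<^sup>2 * D / (d/2))" using K by (intro mult_left_mono) auto
  then have "s x \<le> K * (n\<^sup>2 * D / (d/2))" using lower[OF x, of h] by (simp add: h_def)
  then show ?thesis using d by (simp add: d_def[symmetric] field_simps)
qed

lemma taylor:
  assumes x: "x \<in> ball 0 1" and v: "norm v \<le> (1 - norm x) / 8"
  shows "norm (f (x + v) - f x - f' x v) \<le> 32 * n ^ 4 * D * (norm v)\<^sup>2 / (1 - norm x)\<^sup>2"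
proof -
  define d where "d = 1 - norm x"
  have d: "d > 0" using x by (simp add: d_def)
  obtain \<nu> where \<nu>: "norm \<nu> = 1" "norm (f (x + v) - f x - f' x v) = (f (x + v) - f x - f' x v) \<bullet> \<nu>"
    by (rule unit_direction)
  have "\<bar>f (x + v) \<bullet> \<nu> - f x \<bullet> \<nu> - f' x v \<bullet> \<nu>\<bar> \<le> 8 * N^4 * D / (d/2)\<^sup>2 * (norm v)\<^sup>2"
  unfolding N_eq
  proof (rule harmonic_taylor_estimate[OF _ _ _ f'_inner[OF x]])
    show "harmonic_fun (cball x (d / 2)) (\<lambda>x. f x \<bullet> \<nu>)"
      using harm[of \<nu>] half_depth_cball[OF x] unfolding harmonic_fun_def d_def by blast
    show "\<bar>f y \<bullet> \<nu>\<bar> \<le> D" if "y \<in> cball x (d/2)" for y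
      using half_depth_cball[OF x] that by (intro inner_bound \<nu>) (auto simp: d_def)
  qed (use d v N_eq in \<open>auto simp: d_def\<close>)
  moreover have "8 * N^4 * D / (d/2)\<^sup>2 * (norm v)\<^sup>2 = 32 * n ^ 4 * D * (norm v)\<^sup>2 / d\<^sup>2"
    by (simp add: power_divide)
  moreover have "norm (f (x + v) - f x - f' x v) = f (x + v) \<bullet> \<nu> - f x \<bullet> \<nu> - f' x v \<bullet> \<nu>"
    unfolding \<nu>(2) inner_diff_left ..
  ultimately have "norm (f (x + v) - f x - f' x v) \<le> 32 * n ^ 4 * D * (norm v)\<^sup>2 / d\<^sup>2"
    by linarith
  then show ?thesis by (simp add: d_def)
qed

lemma open_image:
  assumes "open S" "S \<subseteq> ball 0 1"
  shows "open (f ` S)"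
proof -
  have "openin (top_of_set \<Omega>) (f ` S)"
    by (rule homeomorphism_imp_open_map[OF hom]) (use assms in \<open>simp add: open_openin_trans\<close>)
  then show ?thesis using open_\<Omega> openin_open_trans by blast
qed

text \<open>
  On the sphere of radius \<open>\<rho>\<close> about \<open>x\<close> the linear part moves points by at least \<open>s \<rho>/K\<close> and the quadratic error is at most
  \<open>C\<^sub>1 \<rho>\<^sup>2/d\<^sup>2\<close>. The choice of \<open>\<rho>\<close> makes the error half of the linear part, so \<open>f\<close> maps the sphere outside the ball in question.
  That ball is connected and meets the open set \<open>f(B(x,\<rho>))\<close>, hence is contained in it.
\<close>

lemma image_contains_ball:
  assumes x: "x \<in> ball 0 1"
  shows "ball (f x) (((1 - norm x) * s x)\<^sup>2 / (128 * K\<^sup>2 * n ^ 4 * D)) \<subseteq> f ` ball x ((1 - norm x) / 8)"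
proof (cases "s x = 0")
  case True
  then show ?thesis by simp
next
  case False
  define d where "d = 1 - norm x"
  define l where "l = d * s x"
  define C1 where "C1 = 32 * n ^ 4 * D"
  \<comment> \<open>The value of \<open>\<rho>\<close> that maximises \<open>s \<rho>/K - C\<^sub>1 \<rho>\<^sup>2/d\<^sup>2\<close>.\<close>
  define \<rho> where "\<rho> = d * l / (2 * K * C1)"
  have d: "d > 0" using x by (simp add: d_def)
  have l: "l > 0" "l \<le> 2 * K * n\<^sup>2 * D"
    using False s_nonneg[OF x] d stretch_bound[OF x] by (auto simp: l_def d_def)
  have C1: "C1 > 0" using n_ge_1 D by (simp add: C1_def)
  have \<rho>0: "\<rho> > 0" using d l C1 K by (simp add: \<rho>_def)
  have "l \<le> 2 * K * C1 / 8"
  proof -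
    have "n\<^sup>2 \<le> n ^ 4" using n_ge_1 by (intro power_increasing) auto
    then have "n\<^sup>2 * (K * D) \<le> n ^ 4 * (K * D)" using K D by (intro mult_right_mono) auto
    moreover have "0 \<le> n ^ 4 * (K * D)" using K D by simp
    ultimately have "2 * (n\<^sup>2 * (K * D)) \<le> 8 * (n ^ 4 * (K * D))" by linarith
    then have "2 * K * n\<^sup>2 * D \<le> 2 * K * C1 / 8"
      by (simp add: C1_def mult_ac)
    then show ?thesis using l by linarith
  qed
  then have "d * l \<le> d * (2 * K * C1 / 8)" using d by (intro mult_left_mono) auto
  then have \<rho>d: "\<rho> \<le> d / 8" using C1 K by (simp add: \<rho>_def field_simps)
  define c where "c = l\<^sup>2 / (128 * K\<^sup>2 * n ^ 4 * D)"
  have c: "c = l\<^sup>2 / (4 * K\<^sup>2 * C1)" by (simp add: c_def C1_def)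
  have c0: "c > 0" using l C1 K by (simp add: c)
  have sphere: "norm (f y - f x) \<ge> c" if "norm (y - x) = \<rho>" for y
  proof -
    have "norm (f (x + (y - x)) - f x - f' x (y - x)) \<le> 32 * n ^ 4 * D * (norm (y - x))\<^sup>2 / (1 - norm x)\<^sup>2"
      by (rule taylor[OF x]) (use that \<rho>d in \<open>simp add: d_def\<close>)
    then have 1: "norm (f y - f x - f' x (y - x)) \<le> C1 * \<rho>\<^sup>2 / d\<^sup>2"
      using that by (simp add: C1_def d_def)
    have 2: "s x * \<rho> / K \<le> norm (f' x (y - x))"
      using lower[OF x, of "y - x"] that K by (simp add: field_simps)
    have 3: "norm (f' x (y - x)) \<le> norm (f y - f x) + norm (f y - f x - f' x (y - x))"
      using norm_triangle_ineq4[of "f y - f x" "f y - f x - f' x (y - x)"] by simp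
    have "s x * \<rho> / K = 2 * c"
      using d l C1 K by (simp add: c \<rho>_def l_def field_simps power2_eq_square)
    moreover have "C1 * \<rho>\<^sup>2 / d\<^sup>2 = c"
      using d l C1 K by (simp add: c \<rho>_def field_simps power2_eq_square)
    ultimately show ?thesis using 1 2 3 by linarith
  qed
  have sub: "cball x \<rho> \<subseteq> ball 0 1"
    using half_depth_cball[OF x] \<rho>d d by (auto simp: d_def)
  have U: "open (f ` ball x \<rho>)"
    using sub by (intro open_image) auto
  have "compact (f ` cball x \<rho>)"
    using sub f_cont by (intro compact_continuous_image compact_cball) (rule continuous_on_subset)
  then have V: "open (- (f ` cball x \<rho>))" using compact_imp_closed by blast
  have "ball (f x) c \<subseteq> f ` ball x \<rho> \<union> - (f ` cball x \<rho>)"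
  proof
    fix w assume w: "w \<in> ball (f x) c"
    show "w \<in> f ` ball x \<rho> \<union> - (f ` cball x \<rho>)"
    proof (rule ccontr)
      assume "\<not> ?thesis"
      then obtain y where y: "w = f y" "y \<in> cball x \<rho>" "y \<notin> ball x \<rho>" by blast
      then have "norm (y - x) = \<rho>" by (auto simp: dist_norm norm_minus_commute)
      from sphere[OF this] w y show False by (simp add: dist_norm norm_minus_commute)
    qed
  qed
  moreover have "f ` ball x \<rho> \<inter> - (f ` cball x \<rho>) \<inter> ball (f x) c = {}"
    by (auto simp: image_iff)
  moreover have "f x \<in> f ` ball x \<rho> \<inter> ball (f x) c" using \<rho>0 c0 by auto
  ultimately have "- (f ` cball x \<rho>) \<inter> ball (f x) c = {}"
    using connectedD[OF connected_ball[of "f x" c] U V] by blast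
  then have "ball (f x) c \<subseteq> f ` ball x \<rho>"
    using \<open>ball (f x) c \<subseteq> f ` ball x \<rho> \<union> - (f ` cball x \<rho>)\<close> by blast
  also have "\<dots> \<subseteq> f ` ball x (d / 8)" using \<rho>d by (intro image_mono subset_ball)
  finally show ?thesis by (simp add: c_def l_def d_def)
qed

lemma lmeasurable_image:
  assumes "open S" "S \<subseteq> ball 0 1"
  shows "f ` S \<in> lmeasurable"
  using assms open_image f_surj bounded_\<Omega>
  by (intro lmeasurable_open) (auto intro: bounded_subset)

lemma vol_nonneg: "0 \<le> vol S" by (simp add: vol_def)

lemma vol_mono:
  assumes "open S" "open T" "S \<subseteq> T" "T \<subseteq> ball 0 1"
  shows "vol S \<le> vol T"
  unfolding vol_def using assms lmeasurable_image
  by (intro measure_mono_fmeasurable) (auto intro: fmeasurableD)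

text \<open>
  For harmonic functions the gradient is controlled by an average over a ball. Here the volume of the image takes the
  place of the average of \<open>\<bar>\<nabla>f\<bar>\<^sup>n\<close>; the price is the exponent \<open>1/(2n)\<close> instead of \<open>1/n\<close>.
\<close>

lemma stretch_le_vol:
  assumes x: "x \<in> ball 0 1" and S: "open S" "S \<subseteq> ball 0 1" "ball x ((1 - norm x) / 8) \<subseteq> S"
  shows "(1 - norm x) * s x \<le> C * root2n (vol S)"
proof -
  define l where "l = (1 - norm x) * s x"
  define A where "A = 128 * K\<^sup>2 * n ^ 4 * D"
  define V where "V = unit_ball_vol n"
  have l: "l \<ge> 0" using x s_nonneg[OF x] by (simp add: l_def)
  have A: "A > 0" using K D n_ge_1 by (simp add: A_def)
  have V: "V > 0" by (simp add: V_def)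
  have "ball (f x) (l\<^sup>2 / A) \<subseteq> f ` S"
    using image_contains_ball[OF x] S(3) by (force simp: l_def A_def)
  then have "measure lebesgue (ball (f x) (l\<^sup>2 / A)) \<le> vol S"
    unfolding vol_def using S by (intro measure_mono_fmeasurable lmeasurable_image) auto
  moreover have "measure lebesgue (ball (f x) (l\<^sup>2 / A)) = V * (l\<^sup>2 / A) ^ N"
    using A by (simp add: content_ball measure_completion V_def N_eq)
  ultimately have "V * (l\<^sup>2 / A) ^ N \<le> vol S" by simp
  then have "(l\<^sup>2) ^ N \<le> A ^ N / V * vol S"
    using A V by (simp add: power_divide field_simps)
  then have "l ^ (2 * N) \<le> A ^ N / V * vol S"
    unfolding power_mult .
  then have "root2n (l ^ (2 * N)) \<le> root2n (A ^ N / V * vol S)"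
    by (intro real_root_le_mono N_pos)
  also have "\<dots> = C * root2n (vol S)"
    unfolding real_root_mult stretch_const_def A_def V_def ..
  finally show ?thesis using l N_pos by (simp add: real_root_power_cancel l_def)
qed

lemma C_nonneg: "C \<ge> 0"
  using K D by (auto simp: stretch_const_def intro!: real_root_ge_zero divide_nonneg_nonneg zero_le_power mult_nonneg_nonneg)

lemma C_root_nonneg: "0 \<le> C * root2n (vol S)"
  using C_nonneg vol_nonneg by (intro mult_nonneg_nonneg real_root_ge_zero)

lemma variation_on_segment:
  assumes z: "z \<in> ball 0 1" "z' \<in> ball 0 1" and S: "open S" "S \<subseteq> ball 0 1" and \<delta>: "\<delta> > 0"
    and seg: "\<And>w. w \<in> closed_segment z z' \<Longrightarrow> \<delta> \<le> 1 - norm w \<and> ball w ((1 - norm w) / 8) \<subseteq> S"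
  shows "norm (f z - f z') \<le> C * root2n (vol S) / \<delta> * norm (z - z')"
proof (rule differentiable_bound[where f' = f' and S = "closed_segment z z'"])
  have sub: "closed_segment z z' \<subseteq> ball 0 1"
    using z by (simp add: closed_segment_subset)
  show "(f has_derivative f' w) (at w within closed_segment z z')" if "w \<in> closed_segment z z'" for w
    using der sub that has_derivative_at_withinI by blast
  show "onorm (f' w) \<le> C * root2n (vol S) / \<delta>" if w: "w \<in> closed_segment z z'" for w
  proof (rule onorm_le)
    fix h
    have wB: "w \<in> ball 0 1" using sub w by blast
    have "\<delta> * s w \<le> (1 - norm w) * s w"
      using seg[OF w] s_nonneg[OF wB] by (intro mult_right_mono) auto
    also have "\<dots> \<le> C * root2n (vol S)" using seg[OF w] by (intro stretch_le_vol wB S) auto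
    finally have "s w \<le> C * root2n (vol S) / \<delta>" using \<delta> by (simp add: field_simps)
    then show "norm (f' w h) \<le> C * root2n (vol S) / \<delta> * norm h"
      using upper[OF wB, of h] by (meson mult_right_mono norm_ge_zero order_trans)
  qed
qed auto

section \<open>Distance to the boundary and volume of images\<close>

text \<open>
  A Carleson box: it contains the shadow of \<open>z\<close> on the sphere, and the boxes of suitable points closer to the sphere are
  contained in it.
\<close>

definition tent :: "real ^ 'n \<Rightarrow> (real ^ 'n) set" where
  "tent z = ball 0 1 \<inter> ball z (3 * (1 - norm z))"

lemma tent_open: "open (tent z)" and tent_subset: "tent z \<subseteq> ball 0 1"
  by (auto simp: tent_def)

text \<open>
  Two points eight times closer to the sphere than \<open>z\<close>, the first one on the radius through \<open>z\<close> and the second one beside it,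
  have disjoint tents inside the tent of \<open>z\<close>. As \<open>f\<close> is injective, the image of one of these tents has at most half of the volume.
\<close>

lemma smaller_tent:
  assumes z: "z \<in> ball 0 1" "z \<noteq> 0"
  obtains z' where "z' \<in> ball 0 1" "z' \<noteq> 0" "1 - norm z' = (1 - norm z) / 8"
    "vol (tent z') \<le> vol (tent z) / 2" "norm (f z - f z') \<le> 13 * C * root2n (vol (tent z))"
proof -
  define d where "d = 1 - norm z"
  have d: "0 < d" "d < 1" using z by (auto simp: d_def)
  define a where "a = ((1 - d/8) / norm z) *\<^sub>R z"
  have a: "norm a = 1 - d/8" using z d by (simp add: a_def)
  have az: "norm (a - z) = 7/8 * d"
  proof -
    have "a - z = ((1 - d/8) / norm z - 1) *\<^sub>R z" by (simp add: a_def algebra_simps)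
    then have "norm (a - z) = \<bar>(1 - d/8) / norm z - 1\<bar> * norm z" by simp
    also have "\<dots> = \<bar>((1 - d/8) / norm z - 1) * norm z\<bar>" by (simp add: abs_mult)
    also have "((1 - d/8) / norm z - 1) * norm z = 7/8 * d"
      using z by (simp add: d_def field_simps)
    finally show ?thesis using d by simp
  qed
  have "norm (- a - a) = 2 * (1 - d/8)"
  proof -
    have "- a - a = (- 2) *\<^sub>R a" by (simp add: scaleR_2)
    then show ?thesis using a by (simp del: scaleR_minus_left)
  qed
  \<comment> \<open>Both tents have radius \<open>3d/8\<close>, so this is the least distance that makes them disjoint.\<close>
  then obtain b where b: "norm b = 1 - d/8" "norm (b - a) = 3/4 * d"
    using sphere_intermediate_distance[OF dim a, of "- a" a "3/4 * d"] a d by auto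
  have bz: "norm (b - z) \<le> 13/8 * d"
    using norm_triangle_ineq[of "b - a" "a - z"] az b by simp
  have props: "p \<in> ball 0 1 \<and> p \<noteq> 0 \<and> 1 - norm p = d / 8 \<and> tent p \<subseteq> tent z \<and>
      norm (f z - f p) \<le> 13 * C * root2n (vol (tent z))"
    if p: "norm p = 1 - d/8" "norm (p - z) \<le> 13/8 * d" for p
  proof (intro conjI)
    show pB: "p \<in> ball 0 1" using p d by simp
    show "p \<noteq> 0" using p d by auto
    show "1 - norm p = d / 8" using p by simp
    show "tent p \<subseteq> tent z"
    proof -
      have "dist z y < 3 * d" if "dist p y < 3 * (d/8)" for y
        using dist_triangle[of z y p] that p d by (simp add: dist_norm norm_minus_commute)
      then show ?thesis using p by (auto simp: tent_def d_def)
    qed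
    have "norm (f z - f p) \<le> C * root2n (vol (tent z)) / (d/8) * norm (z - p)"
    proof (rule variation_on_segment[OF z(1) pB tent_open tent_subset])
      fix w assume w: "w \<in> closed_segment z p"
      have "closed_segment z p \<subseteq> cball 0 (1 - d/8)"
        using p d z(1) by (intro closed_segment_subset) (auto simp: d_def field_simps)
      with w have w1: "d/8 \<le> 1 - norm w" by auto
      have w2: "norm (w - z) \<le> norm (p - z)"
        using w by (simp add: segment_bound(1))
      have "1 - norm w \<le> d + norm (w - z)"
        using norm_triangle_sub[of z w] by (simp add: d_def norm_minus_commute)
      then have w3: "1 - norm w \<le> 21/8 * d" using w2 p by simp
      have "y \<in> tent z" if "y \<in> ball w ((1 - norm w) / 8)" for y
      proof -
        have yw: "norm (y - w) < (1 - norm w) / 8" using that by (simp add: dist_norm norm_minus_commute)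
        have "norm y < 1" using norm_triangle_sub[of y w] yw w1 d by simp
        moreover have "norm (y - z) < 3 * d"
          using norm_triangle_ineq[of "y - w" "w - z"] yw w3 w2 p d by simp
        ultimately show ?thesis by (simp add: tent_def d_def dist_norm norm_minus_commute)
      qed
      with w1 show "d / 8 \<le> 1 - norm w \<and> ball w ((1 - norm w) / 8) \<subseteq> tent z" by blast
    qed (use d in auto)
    also have "\<dots> \<le> C * root2n (vol (tent z)) / (d/8) * (13/8 * d)"
      using p d C_root_nonneg[of "tent z"]
      by (intro mult_left_mono divide_nonneg_nonneg) (auto simp: norm_minus_commute)
    also have "\<dots> = 13 * C * root2n (vol (tent z))" using d by simp
    finally show "norm (f z - f p) \<le> 13 * C * root2n (vol (tent z))" .
  qed
  note pa = props[OF a] and pb = props[OF b(1) bz]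
  have "tent a \<inter> tent b = {}"
  proof -
    have False if "dist a y < 3 * (d/8)" "dist b y < 3 * (d/8)" for y
      using dist_triangle2[of b a y] that b by (simp add: dist_norm)
    then show ?thesis using a b by (auto simp: tent_def)
  qed
  then have "f ` tent a \<inter> f ` tent b = {}"
    using f_inj tent_subset by (auto simp: inj_on_def) blast
  then have "vol (tent a) + vol (tent b) = measure lebesgue (f ` tent a \<union> f ` tent b)"
    using measure_Un3[of "f ` tent a" lebesgue "f ` tent b"]
    by (simp add: vol_def lmeasurable_image tent_open tent_subset)
  also have "\<dots> \<le> vol (tent z)"
    unfolding vol_def using pa pb az d
    by (intro measure_mono_fmeasurable lmeasurable_image tent_open tent_subset)
       (auto intro!: sets.Un fmeasurableD lmeasurable_image tent_open tent_subset)
  finally consider "vol (tent a) \<le> vol (tent z) / 2" | "vol (tent b) \<le> vol (tent z) / 2"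
    by linarith
  then show ?thesis
    using that[of a] that[of b] pa pb az d by cases (auto simp: d_def)
qed

lemma half_root_less_1: "root2n (1/2) < 1"
proof -
  have "root2n (1/2) < root2n 1" by (rule real_root_less_mono) (use N_pos in auto)
  then show ?thesis using N_pos by simp
qed

text \<open>
  Always moving on to the smaller tent halves the volume in each step, and the displacement of \<open>f\<close> is bounded by a root
  of the volume. So the displacements are dominated by a geometric series with the ratio \<open>(1/2)\<^bsup>1/(2n)\<^esup>\<close>, independently of the
  number of steps.
\<close>

lemma descend:
  assumes "z \<in> ball 0 1" "z \<noteq> 0"
  shows "\<exists>z'\<in>ball 0 1. 1 - norm z' = (1 - norm z) / 8 ^ m \<and>
     norm (f z - f z') \<le> depth_const N K D * root2n (vol (tent z))"
  using assms
proof (induction m arbitrary: z)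
  case 0
  have "0 \<le> depth_const N K D * root2n (vol (tent z))"
    using half_root_less_1 C_nonneg vol_nonneg[of "tent z"] N_pos
    by (auto simp: depth_const_def intro!: divide_nonneg_nonneg mult_nonneg_nonneg real_root_ge_zero)
  then show ?case using 0 by (intro bexI[of _ z]) auto
next
  case (Suc m)
  define q where "q = root2n (1/2)"
  define E where "E = depth_const N K D"
  define R where "R = root2n (vol (tent z))"
  have q: "0 \<le> q" "q < 1" using half_root_less_1 by (auto simp: q_def intro: real_root_ge_zero)
  have "E = 13 * C / (1 - q)" by (simp only: E_def depth_const_def q_def)
  then have E0: "E \<ge> 0" "E = 13 * C + E * q"
    using q C_nonneg by (simp, simp add: field_simps)
  obtain z1 where z1: "z1 \<in> ball 0 1" "z1 \<noteq> 0" "1 - norm z1 = (1 - norm z) / 8"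
    "vol (tent z1) \<le> vol (tent z) / 2" "norm (f z - f z1) \<le> 13 * C * R"
    using smaller_tent[OF Suc.prems] unfolding R_def by blast
  obtain z' where z': "z' \<in> ball 0 1" "1 - norm z' = (1 - norm z1) / 8 ^ m"
    "norm (f z1 - f z') \<le> E * root2n (vol (tent z1))"
    using Suc.IH[OF z1(1,2)] unfolding E_def by blast
  have "root2n (vol (tent z1)) \<le> root2n (1/2 * vol (tent z))"
    using z1(4) by (intro real_root_le_mono N_pos) simp
  also have "\<dots> = q * R" unfolding real_root_mult q_def R_def ..
  finally have "E * root2n (vol (tent z1)) \<le> E * (q * R)" using E0 by (intro mult_left_mono)
  then have "norm (f z1 - f z') \<le> E * q * R" using z'(3) by simp
  then have "norm (f z - f z') \<le> 13 * C * R + E * q * R"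
    using z1(5) norm_triangle_ineq[of "f z - f z1" "f z1 - f z'"] by simp
  also have "\<dots> = (13 * C + E * q) * R" by (simp add: algebra_simps)
  also have "\<dots> = E * R" using E0 by simp
  finally show ?case using z' z1(3) by (intro bexI[of _ z']) (auto simp: E_def R_def field_simps)
qed

text \<open>
  A homeomorphism pulls the compact set of points at distance at least \<open>e\<close> from the boundary back to a compact set.
  The resulting \<open>\<delta>\<close> depends on \<open>f\<close>.
\<close>

lemma near_boundary:
  assumes e: "e > 0"
  shows "\<exists>\<delta>>0. \<forall>x\<in>ball 0 1. 1 - norm x < \<delta> \<longrightarrow> infdist (f x) (frontier \<Omega>) < e"
proof -
  define Y where "Y = {y \<in> \<Omega>. e \<le> infdist y (frontier \<Omega>)}"
  have "compact Y" unfolding Y_def by (rule compact_deep_points[OF bounded_\<Omega> e])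
  then have cg: "compact (g ` Y)"
    using hom by (intro compact_continuous_image) (auto simp: homeomorphism_def Y_def intro: continuous_on_subset)
  have gY: "g ` Y \<subseteq> ball 0 1" using hom by (auto simp: homeomorphism_def Y_def)
  show ?thesis
  proof (cases "Y = {}")
    case True
    then show ?thesis using f_in by (intro exI[of _ 1]) (force simp: Y_def)
  next
    case False
    then obtain w where w: "w \<in> g ` Y" "\<And>x. x \<in> g ` Y \<Longrightarrow> norm x \<le> norm w"
      using continuous_attains_sup[OF cg, of norm] by (auto intro: continuous_intros)
    show ?thesis
    proof (intro exI[of _ "1 - norm w"] conjI ballI impI)
      show "0 < 1 - norm w" using w gY by auto
      fix x :: "real ^ 'n" assume x: "x \<in> ball 0 1" "1 - norm x < 1 - norm w"
      show "infdist (f x) (frontier \<Omega>) < e"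
      proof (rule ccontr)
        assume "\<not> ?thesis"
        then have "f x \<in> Y" using f_in[OF x(1)] by (simp add: Y_def)
        then have "x \<in> g ` Y" using hom x(1) by (force simp: homeomorphism_def)
        from w(2)[OF this] x show False by simp
      qed
    qed
  qed
qed

text \<open>
  Following \<open>descend\<close> for many steps leads to points whose images are as close to the boundary as desired, while the bound
  for the total displacement stays the same.
\<close>

lemma boundary_distance_le_vol_tent:
  assumes z: "z \<in> ball 0 1" "z \<noteq> 0"
  shows "infdist (f z) (frontier \<Omega>) \<le> depth_const N K D * root2n (vol (tent z))"
proof (rule field_le_epsilon)
  fix e :: real assume "e > 0"
  then obtain \<delta> where \<delta>: "\<delta> > 0" "\<And>x. x \<in> ball 0 1 \<Longrightarrow> 1 - norm x < \<delta> \<Longrightarrow> infdist (f x) (frontier \<Omega>) < e"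
    using near_boundary by blast
  obtain m where m: "(1 / 8) ^ m < \<delta>" using real_arch_pow_inv[of \<delta> "1/8"] \<delta> by auto
  obtain z' where z': "z' \<in> ball 0 1" "1 - norm z' = (1 - norm z) / 8 ^ m"
    "norm (f z - f z') \<le> depth_const N K D * root2n (vol (tent z))"
    using descend[OF z] by blast
  have "(1 - norm z) / 8 ^ m \<le> (1 / 8) ^ m"
    by (simp add: power_divide field_simps)
  with z' m have "infdist (f z') (frontier \<Omega>) < e" by (intro \<delta>(2)) auto
  then show "infdist (f z) (frontier \<Omega>) \<le> depth_const N K D * root2n (vol (tent z)) + e"
    using infdist_triangle[of "f z" "frontier \<Omega>" "f z'"] z'(3) by (simp add: dist_norm)
qed

text \<open>
  Cut off by the unit ball; the factors leave room for the tents and Whitney balls of points at distance \<open>r\<close> from \<open>\<xi>\<close>.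
\<close>

definition annulus :: "real ^ 'n \<Rightarrow> real \<Rightarrow> (real ^ 'n) set" where
  "annulus \<xi> r = ball 0 1 \<inter> {y. r / 16 < norm (y - \<xi>)} \<inter> {y. norm (y - \<xi>) < 4 * r}"

lemma annulus_open: "open (annulus \<xi> r)"
  unfolding annulus_def by (intro open_Int open_Collect_less continuous_intros open_ball)

lemma annulus_subset: "annulus \<xi> r \<subseteq> ball 0 1"
  by (auto simp: annulus_def)

lemma depth_const_nonneg: "0 \<le> depth_const N K D"
  using half_root_less_1 C_nonneg by (auto simp: depth_const_def intro!: divide_nonneg_nonneg)

text \<open>
  If \<open>z\<close> is close to the sphere compared with \<open>r\<close>, its tent lies in the annulus. Otherwise \<open>z\<close> is joined by a segment to a
  point of this kind; along the segment the depth is at least \<open>r/8\<close>, which both keeps it away from \<open>\<xi>\<close> and bounds the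
  variation of \<open>f\<close>.
\<close>

lemma boundary_distance_le_vol_annulus:
  assumes \<xi>: "norm \<xi> = 1" and r: "0 < r" "r \<le> 1" and z: "z \<in> ball 0 1" "norm (z - \<xi>) = r"
  shows "infdist (f z) (frontier \<Omega>) \<le> (16 * C + depth_const N K D) * root2n (vol (annulus \<xi> r))"
proof -
  define R where "R = root2n (vol (annulus \<xi> r))"
  have dep: "infdist (f p) (frontier \<Omega>) \<le> depth_const N K D * R"
    if p: "p \<in> ball 0 1" "p \<noteq> 0" "1 - norm p \<le> r / 8" "norm (p - \<xi>) = r" for p
  proof -
    have "tent p \<subseteq> annulus \<xi> r"
    proof
      fix y assume y: "y \<in> tent p"
      then have py: "norm (y - p) < 3/8 * r" using p by (simp add: tent_def dist_norm norm_minus_commute)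
      have "r \<le> norm (y - p) + norm (y - \<xi>)"
        using norm_triangle_ineq4[of "y - \<xi>" "y - p"] p(4) by simp
      moreover have "norm (y - \<xi>) \<le> norm (y - p) + r"
        using norm_triangle_ineq[of "y - p" "p - \<xi>"] p(4) by simp
      ultimately show "y \<in> annulus \<xi> r" using y py r by (simp add: tent_def annulus_def)
    qed
    then have "vol (tent p) \<le> vol (annulus \<xi> r)"
      by (intro vol_mono tent_open annulus_open annulus_subset)
    then have "root2n (vol (tent p)) \<le> R"
      unfolding R_def by (intro real_root_le_mono N_pos)
    then have "depth_const N K D * root2n (vol (tent p)) \<le> depth_const N K D * R"
      by (intro mult_left_mono depth_const_nonneg)
    then show ?thesis using boundary_distance_le_vol_tent[OF p(1,2)] by simp
  qed
  have CR: "0 \<le> C * R" using C_root_nonneg by (simp add: R_def)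
  have "infdist (f z) (frontier \<Omega>) \<le> 16 * (C * R) + depth_const N K D * R"
  proof (cases "1 - norm z < r / 8")
    case True
    then have "z \<noteq> 0" using r by auto
    then have "infdist (f z) (frontier \<Omega>) \<le> depth_const N K D * R"
      using True z by (intro dep) auto
    then show ?thesis using CR by simp
  next
    case False
    define p where "p = (1 - r/8) *\<^sub>R \<xi>"
    have "p - \<xi> = (- (r/8)) *\<^sub>R \<xi>" "- p - \<xi> = (- (2 - r/8)) *\<^sub>R \<xi>"
      by (simp_all add: p_def algebra_simps scaleR_2)
    then have np: "norm (p - \<xi>) = r/8" "norm (- p - \<xi>) = 2 - r/8"
      using r \<xi> by (simp_all del: scaleR_minus_left)
    have "norm p = 1 - r/8" using r \<xi> by (simp add: p_def)
    then obtain q where q: "norm q = 1 - r/8" "norm (q - \<xi>) = r"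
      using sphere_intermediate_distance[OF dim, of p "1 - r/8" "- p" \<xi> r] np r by auto
    have qB: "q \<in> ball 0 1" using q r by simp
    have "norm (f z - f q) \<le> C * root2n (vol (annulus \<xi> r)) / (r/8) * norm (z - q)"
    proof (rule variation_on_segment[OF z(1) qB annulus_open annulus_subset])
      fix w assume w: "w \<in> closed_segment z q"
      have "closed_segment z q \<subseteq> cball 0 (1 - r/8)"
        using q False by (intro closed_segment_subset) auto
      with w have w1: "r/8 \<le> 1 - norm w" by auto
      have "closed_segment z q \<subseteq> cball \<xi> r"
        using q z by (intro closed_segment_subset) (auto simp: dist_norm norm_minus_commute)
      with w have w2: "norm (w - \<xi>) \<le> r" by (auto simp: dist_norm norm_minus_commute)
      have w3: "1 - norm w \<le> norm (w - \<xi>)"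
        using norm_triangle_sub[of \<xi> w] \<xi> by (simp add: norm_minus_commute)
      have "y \<in> annulus \<xi> r" if "y \<in> ball w ((1 - norm w) / 8)" for y
      proof -
        have yw: "norm (y - w) < (1 - norm w) / 8" using that by (simp add: dist_norm norm_minus_commute)
        have "norm y < 1" using norm_triangle_sub[of y w] yw w1 r by simp
        moreover have "norm (y - \<xi>) < 4 * r"
          using norm_triangle_ineq[of "y - w" "w - \<xi>"] yw w2 w3 r by simp
        moreover have "r / 16 < norm (y - \<xi>)"
          using norm_triangle_ineq4[of "y - \<xi>" "y - w"] yw w1 w3 r by simp
        ultimately show ?thesis by (simp add: annulus_def)
      qed
      with w1 show "r / 8 \<le> 1 - norm w \<and> ball w ((1 - norm w) / 8) \<subseteq> annulus \<xi> r" by blast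
    qed (use r in auto)
    also have "\<dots> \<le> C * root2n (vol (annulus \<xi> r)) / (r/8) * (2 * r)"
    proof (intro mult_left_mono divide_nonneg_nonneg C_root_nonneg)
      show "norm (z - q) \<le> 2 * r"
        using norm_triangle_ineq4[of "z - \<xi>" "q - \<xi>"] z q by simp
    qed (use r in auto)
    also have "\<dots> = 16 * (C * R)" using r by (simp add: R_def)
    finally have "norm (f z - f q) \<le> 16 * (C * R)" .
    moreover have "infdist (f q) (frontier \<Omega>) \<le> depth_const N K D * R"
      using q qB r by (intro dep) auto
    ultimately show ?thesis
      using infdist_triangle[of "f z" "frontier \<Omega>" "f q"] by (simp add: dist_norm)
  qed
  then show ?thesis by (simp add: R_def algebra_simps)
qed

section \<open>Uniform decay of the stretch at the boundary\<close>

text \<open>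
  The preimage of \<open>E\<close> joins \<open>x\<close> to \<open>0\<close>, so it contains points at every distance between \<open>1 - \<bar>x\<bar>\<close> and \<open>1\<close> from \<open>x/\<bar>x\<bar>\<close>.
  Each of the \<open>m\<close> disjoint annuli of radii \<open>64\<^bsup>-j\<^esup>\<close> then has an image of volume bounded below, and together they do
  not fit into the ball of radius \<open>D\<close>.
\<close>

lemma depth_lower_bound:
  assumes E: "connected E" "E \<subseteq> \<Omega>" "f 0 \<in> E" "f x \<in> E" and x: "x \<in> ball 0 1"
    and e: "e > 0" "\<And>y. y \<in> E \<Longrightarrow> e \<le> infdist y (frontier \<Omega>)"
    and m: "measure lebesgue (cball (0::real^'n) D) < m * (e / (16 * C + depth_const N K D)) ^ (2 * N)"
  shows "(1 / 64) ^ m \<le> 1 - norm x"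
proof (rule ccontr)
  define H where "H = 16 * C + depth_const N K D"
  define d where "d = 1 - norm x"
  assume "\<not> ?thesis"
  then have d: "d < (1 / 64) ^ m" "d > 0" using x by (auto simp: d_def)
  have "(1 / 64::real) ^ m \<le> 1" by (simp add: power_le_one)
  then have "x \<noteq> 0" using d by (auto simp: d_def)
  define \<xi> where "\<xi> = x /\<^sub>R norm x"
  have \<xi>: "norm \<xi> = 1" using \<open>x \<noteq> 0\<close> by (simp add: \<xi>_def)
  have x\<xi>: "norm (x - \<xi>) = d"
  proof -
    have "x - \<xi> = (1 - 1 / norm x) *\<^sub>R x" by (simp add: \<xi>_def algebra_simps divide_inverse)
    then have "norm (x - \<xi>) = \<bar>(1 - 1 / norm x) * norm x\<bar>" by (simp add: abs_mult)
    also have "(1 - 1 / norm x) * norm x = - d" using \<open>x \<noteq> 0\<close> by (simp add: d_def field_simps)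
    finally show ?thesis using d by simp
  qed
  define r where "r = (\<lambda>j::nat. (1 / 64 :: real) ^ j)"
  have r: "0 < r j" "r j \<le> 1" for j by (auto simp: r_def power_le_one)
  have "connected (g ` E)"
    using hom E by (intro connected_continuous_image) (auto simp: homeomorphism_def intro: continuous_on_subset)
  then have con: "connected ((\<lambda>z. norm (z - \<xi>)) ` (g ` E))"
    by (rule connected_continuous_image[rotated]) (intro continuous_intros)
  have "g (f x) = x" "g (f 0) = 0" using hom x by (auto simp: homeomorphism_def)
  then have "x \<in> g ` E" "0 \<in> g ` E" using E by (metis imageI)+
  then have "d \<in> (\<lambda>z. norm (z - \<xi>)) ` (g ` E)" "1 \<in> (\<lambda>z. norm (z - \<xi>)) ` (g ` E)"
    using x\<xi> \<xi> by (force, force simp: image_iff)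
  then have sub: "{d..1} \<subseteq> (\<lambda>z. norm (z - \<xi>)) ` (g ` E)"
    by (rule connected_contains_Icc[OF con])
  have lb: "(e / H) ^ (2 * N) \<le> vol (annulus \<xi> (r j))" if "j < m" for j
  proof -
    have "r m \<le> r j" unfolding r_def using that by (intro power_decreasing) auto
    moreover have "d < r m" using d by (simp add: r_def)
    ultimately have "r j \<in> {d..1}" using r[of j] by simp
    with sub obtain y where y: "y \<in> E" "norm (g y - \<xi>) = r j" by force
    have gy: "g y \<in> ball 0 1" "f (g y) = y" using hom y E by (auto simp: homeomorphism_def)
    have "e \<le> H * root2n (vol (annulus \<xi> (r j)))"
      using boundary_distance_le_vol_annulus[OF \<xi> r gy(1) y(2)] e(2)[OF y(1)] gy by (simp add: H_def)
    moreover have "H \<ge> 0" using C_nonneg depth_const_nonneg by (simp add: H_def)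
    moreover from calculation e have "H \<noteq> 0" by auto
    ultimately have "e / H \<le> root2n (vol (annulus \<xi> (r j)))"
      by (simp add: field_simps)
    then have "(e / H) ^ (2 * N) \<le> root2n (vol (annulus \<xi> (r j))) ^ (2 * N)"
      using e \<open>H \<ge> 0\<close> by (intro power_mono) auto
    then show ?thesis using N_pos vol_nonneg by simp
  qed
  have dis: "disjoint_family_on (\<lambda>j. f ` annulus \<xi> (r j)) {..<m}"
  proof -
    have False if "y \<in> annulus \<xi> (r i)" "y \<in> annulus \<xi> (r j)" "i < j" for y i j
    proof -
      have "r j \<le> r (Suc i)" unfolding r_def using that by (intro power_decreasing) auto
      moreover have "r (Suc i) = r i / 64" by (simp add: r_def)
      ultimately show False using that by (simp add: annulus_def)
    qed
    then have "annulus \<xi> (r i) \<inter> annulus \<xi> (r j) = {}" if "i \<noteq> j" for i j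
      using that by (metis disjoint_iff linorder_neqE_nat)
    then show ?thesis
      unfolding disjoint_family_on_def
      by (metis annulus_subset f_inj image_empty inj_on_image_Int)
  qed
  have "m * (e / H) ^ (2 * N) = (\<Sum>j<m. (e / H) ^ (2 * N))" by simp
  also have "\<dots> \<le> (\<Sum>j<m. vol (annulus \<xi> (r j)))" by (intro sum_mono lb) auto
  also have "\<dots> = measure lebesgue (\<Union>j<m. f ` annulus \<xi> (r j))"
    unfolding vol_def
  proof (rule measure_finite_Union[symmetric, OF _ _ dis])
    show "emeasure lebesgue (f ` annulus \<xi> (r j)) \<noteq> \<infinity>" for j
      unfolding infinity_ennreal_def
      by (rule fmeasurableD2[OF lmeasurable_image[OF annulus_open annulus_subset]])
  qed (auto simp: fmeasurableD lmeasurable_image annulus_open annulus_subset)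
  also have "\<dots> \<le> measure lebesgue (cball (0::real^'n) D)"
    using f_norm annulus_subset
    by (intro measure_mono_fmeasurable)
       (auto intro!: sets.finite_UN fmeasurableD lmeasurable_image annulus_open simp: subset_iff)
  finally show False using m by (simp add: H_def)
qed

lemma stretch_le_boundary_distance:
  assumes x: "x \<in> ball 0 1"
  shows "((1 - norm x) * s x)\<^sup>2 / (128 * K\<^sup>2 * n ^ 4 * D) \<le> infdist (f x) (frontier \<Omega>)"
proof -
  define c where "c = ((1 - norm x) * s x)\<^sup>2 / (128 * K\<^sup>2 * n ^ 4 * D)"
  have "f ` ball x ((1 - norm x) / 8) \<subseteq> \<Omega>"
  proof -
    have "ball x ((1 - norm x) / 8) \<subseteq> ball 0 1"
      using half_depth_cball[OF x] x by force
    then show ?thesis using f_in by blast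
  qed
  then have "ball (f x) c \<subseteq> \<Omega>" using image_contains_ball[OF x] by (simp add: c_def)
  then have "c \<le> dist (f x) q" if "q \<in> frontier \<Omega>" for q
    using that open_\<Omega> by (force simp: frontier_def interior_open)
  then show ?thesis
    using frontier_nonempty by (auto simp: infdist_def c_def intro!: cINF_greatest)
qed

end

text \<open>
  Points that are not too close to the boundary can be joined to \<open>b\<close> without getting arbitrarily close to it.
\<close>

definition connected_exhaustion :: "(real ^ 'n) set \<Rightarrow> real ^ 'n \<Rightarrow> bool" where
  "connected_exhaustion \<Omega> b \<longleftrightarrow> (\<forall>e>0. \<exists>E. connected E \<and> E \<subseteq> \<Omega> \<and> b \<in> E \<and>
     {y \<in> \<Omega>. e \<le> infdist y (frontier \<Omega>)} \<subseteq> E \<and> (\<exists>e'>0. \<forall>y\<in>E. e' \<le> infdist y (frontier \<Omega>)))"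

text \<open>
  Where the normalised stretch is at least \<open>\<eta>\<close>, the image point has a definite distance \<open>e\<close> from the boundary. It then lies
  in a connected set of deep points that also contains \<open>b = f(0)\<close>, and the depth of its preimage is bounded below.
\<close>

lemma stretch_uniformly_small:
  fixes \<Omega> :: "(real ^ 'n) set"
  assumes ex: "connected_exhaustion \<Omega> b" and K: "K \<ge> 1" and D: "D > 0" and \<eta>: "\<eta> > 0"
  shows "\<exists>\<delta>>0. \<forall>f g f' s x. harmonic_qc_map \<Omega> f g f' s K D CARD('n) \<longrightarrow> f 0 = b \<longrightarrow> x \<in> ball 0 1 \<longrightarrow>
       1 - norm x < \<delta> \<longrightarrow> (1 - norm x) * s x < \<eta>"
proof -
  define n where "n = real CARD('n)"
  define e where "e = \<eta>\<^sup>2 / (128 * K\<^sup>2 * n ^ 4 * D)"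
  have n: "n > 0" by (simp add: n_def)
  have "e > 0" using \<eta> K D n by (simp add: e_def)
  from ex[unfolded connected_exhaustion_def, rule_format, OF this]
  obtain E where E: "connected E" "E \<subseteq> \<Omega>" "b \<in> E" "{y \<in> \<Omega>. e \<le> infdist y (frontier \<Omega>)} \<subseteq> E"
    and "\<exists>e'>0. \<forall>y\<in>E. e' \<le> infdist y (frontier \<Omega>)"
    by (elim exE conjE) (rule that; blast)
  then obtain e' where e': "e' > 0" "\<forall>y\<in>E. e' \<le> infdist y (frontier \<Omega>)" by (elim exE conjE)
  define c where "c = (e' / (16 * stretch_const CARD('n) K D + depth_const CARD('n) K D)) ^ (2 * CARD('n))"
  show ?thesis
  proof (cases "16 * stretch_const CARD('n) K D + depth_const CARD('n) K D = 0")
    \<comment> \<open>Division by zero would make \<open>c\<close> vanish; but then \<open>b\<close>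
      would have distance \<open>0\<close> from the boundary, so there is no such map.\<close>
    case True
    show ?thesis
    proof (intro exI[of _ 1] conjI allI impI)
      fix f g :: "real ^ 'n \<Rightarrow> real ^ 'n" and f' :: "real ^ 'n \<Rightarrow> real ^ 'n \<Rightarrow> real ^ 'n"
        and s :: "real ^ 'n \<Rightarrow> real" and x :: "real ^ 'n"
      assume "harmonic_qc_map \<Omega> f g f' s K D CARD('n)" and f0: "f 0 = b"
      then interpret harmonic_qc_map \<Omega> f g f' s K D "CARD('n)" by simp
      have "infdist (f 0) (frontier \<Omega>) \<le> 0"
        using boundary_distance_le_vol_annulus[of "axis undefined 1" 1 0] True by simp
      then show "(1 - norm x) * s x < \<eta>" using bspec[OF e'(2) E(3)] e'(1) f0 by simp
    qed simp
  next
    case False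
    have "c > 0" using False e' by (simp add: c_def zero_less_power_eq)
    then obtain m where m: "measure lebesgue (cball (0::real^'n) D) < real m * c"
      using reals_Archimedean3 by blast
    show ?thesis
    proof (intro exI[of _ "(1/64) ^ m"] conjI allI impI)
      fix f g :: "real ^ 'n \<Rightarrow> real ^ 'n" and f' :: "real ^ 'n \<Rightarrow> real ^ 'n \<Rightarrow> real ^ 'n"
        and s :: "real ^ 'n \<Rightarrow> real" and x :: "real ^ 'n"
      assume h: "harmonic_qc_map \<Omega> f g f' s K D CARD('n)" and f0: "f 0 = b" and x: "x \<in> ball 0 1" "1 - norm x < (1/64) ^ m"
      interpret harmonic_qc_map \<Omega> f g f' s K D "CARD('n)" by (rule h)
      show "(1 - norm x) * s x < \<eta>"
      proof (rule ccontr)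
        assume "\<not> ?thesis"
        then have "\<eta>\<^sup>2 \<le> ((1 - norm x) * s x)\<^sup>2" using \<eta> by (intro power_mono) auto
        then have "e \<le> ((1 - norm x) * s x)\<^sup>2 / (128 * K\<^sup>2 * n ^ 4 * D)"
          unfolding e_def using K D n by (intro divide_right_mono) auto
        also have "\<dots> \<le> infdist (f x) (frontier \<Omega>)"
          using stretch_le_boundary_distance[OF x(1)] by (simp add: n_def)
        finally have "f x \<in> E" using E(4) f_in[OF x(1)] by blast
        then have "(1/64) ^ m \<le> 1 - norm x"
          using depth_lower_bound[of E x e' m] E e' x f0 m by (simp add: c_def)
        then show False using x by simp
      qed
    qed simp
  qed
qed

section \<open>Domains with \<open>C\<^sup>1\<close> boundary\<close>

text \<open>
  In this form the smoothness of the boundary enters the blow-up argument: at small scales, uniformly in the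
  point \<open>q\<close>, the boundary is close to a hyperplane through \<open>q\<close> compared with the scale.
\<close>

definition asymptotically_flat_frontier :: "(real ^ 'n) set \<Rightarrow> bool" where
  "asymptotically_flat_frontier \<Omega> \<longleftrightarrow> (\<forall>\<tau>>0. \<exists>\<delta>>0. \<forall>q\<in>frontier \<Omega>. \<exists>\<nu>. norm \<nu> = 1 \<and>
     (\<forall>y\<in>frontier \<Omega>. norm (y - q) \<le> \<delta> \<longrightarrow> \<bar>(y - q) \<bullet> \<nu>\<bar> \<le> \<tau> * norm (y - q)))"

lemma C1_boundary_parametrisation:
  fixes \<Omega> :: "(real ^ 'n) set"
  assumes "has_C1_boundary \<Omega>" "open \<Omega>"
  obtains \<Phi> \<Psi> :: "real ^ 'n \<Rightarrow> real ^ 'n" where "homeomorphism (cball 0 1) (closure \<Omega>) \<Phi> \<Psi>" "C1_on (cball 0 1) \<Phi>"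
    "C1_on (closure \<Omega>) \<Psi>" "\<Phi> ` ball 0 1 = \<Omega>" "\<Phi> ` sphere 0 1 = frontier \<Omega>"
    "bounded \<Omega>"
proof -
  obtain \<Phi> \<Psi> :: "real ^ 'n \<Rightarrow> real ^ 'n" where h: "homeomorphism (cball 0 1) (closure \<Omega>) \<Phi> \<Psi>" "C1_on (cball 0 1) \<Phi>"
    "C1_on (closure \<Omega>) \<Psi>" "\<Phi> ` ball 0 1 = \<Omega>"
    using assms unfolding has_C1_boundary_def C1_diffeomorphism_def by blast
  have inj: "inj_on \<Phi> (cball 0 1)"
    by (rule inj_on_inverseI[of _ \<Psi>]) (use h(1) in \<open>auto simp: homeomorphism_def\<close>)
  have im: "\<Phi> ` cball 0 1 = closure \<Omega>" using h(1) by (simp add: homeomorphism_def)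
  have "sphere 0 1 = cball 0 1 - (ball 0 1 :: (real^'n) set)" by auto
  then have "\<Phi> ` sphere 0 1 = \<Phi> ` cball 0 1 - \<Phi> ` ball 0 1"
    using inj by (simp add: inj_on_image_set_diff[OF inj])
  then have fr: "\<Phi> ` sphere 0 1 = frontier \<Omega>"
    using im h(4) assms(2) by (simp add: frontier_def interior_open)
  have "continuous_on (cball 0 1) \<Phi>" using h(1) by (simp add: homeomorphism_def)
  then have "compact (\<Phi> ` cball 0 1)" by (intro compact_continuous_image compact_cball)
  then have "bounded \<Omega>"
    using im by (metis bounded_subset closure_subset compact_imp_bounded)
  then show ?thesis using that h fr by blast
qed

text \<open>
  The images of concentric balls under a parametrisation of the domain by the unit ball are connected and exhaust it.
\<close>

lemma C1_boundary_connected_exhaustion: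
  fixes \<Omega> :: "(real ^ 'n) set"
  assumes C1: "has_C1_boundary \<Omega>" and \<Omega>: "open \<Omega>" and b: "b \<in> \<Omega>"
  shows "connected_exhaustion \<Omega> b"
  unfolding connected_exhaustion_def
proof (intro allI impI)
  fix e :: real assume e: "e > 0"
  obtain \<Phi> \<Psi> :: "real ^ 'n \<Rightarrow> real ^ 'n" where h: "homeomorphism (cball 0 1) (closure \<Omega>) \<Phi> \<Psi>" and im: "\<Phi> ` ball 0 1 = \<Omega>"
    and bd: "bounded \<Omega>"
    using C1_boundary_parametrisation[OF C1 \<Omega>] by metis
  have cont: "continuous_on (cball 0 1) \<Phi>" "continuous_on (closure \<Omega>) \<Psi>"
    and inv: "\<And>x. x \<in> cball 0 1 \<Longrightarrow> \<Psi> (\<Phi> x) = x"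
    using h by (auto simp: homeomorphism_def)
  define Y where "Y = insert b {y \<in> \<Omega>. e \<le> infdist y (frontier \<Omega>)}"
  have Y: "compact Y" "Y \<subseteq> \<Omega>"
    unfolding Y_def using compact_deep_points[OF bd e] b by auto
  have "compact (\<Psi> ` Y)"
    using Y closure_subset[of \<Omega>]
    by (intro compact_continuous_image continuous_on_subset[OF cont(2)]) auto
  moreover have "\<Psi> ` Y \<noteq> {}" by (simp add: Y_def)
  ultimately obtain p where p: "p \<in> \<Psi> ` Y" "\<And>x. x \<in> \<Psi> ` Y \<Longrightarrow> norm x \<le> norm p"
    using continuous_attains_sup[of "\<Psi> ` Y" norm] by (auto intro: continuous_intros)
  have "\<Psi> ` Y \<subseteq> ball 0 1"
  proof -
    have "\<Psi> ` \<Omega> = ball 0 1" unfolding im[symmetric] image_image using inv by force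
    then show ?thesis using Y by blast
  qed
  then have "norm p < 1" using p by auto
  define E where "E = \<Phi> ` cball 0 (norm p)"
  have sub: "cball 0 (norm p) \<subseteq> (ball 0 1 :: (real^'n) set)" using \<open>norm p < 1\<close> by auto
  then have contE: "continuous_on (cball 0 (norm p)) \<Phi>"
    by (intro continuous_on_subset[OF cont(1)]) auto
  have E\<Omega>: "E \<subseteq> \<Omega>" using sub im by (auto simp: E_def)
  have "connected E" unfolding E_def by (intro connected_continuous_image contE connected_cball)
  have "Y \<subseteq> E"
  proof
    fix y assume y: "y \<in> Y"
    then obtain x where x: "x \<in> ball 0 1" "y = \<Phi> x" using Y im by blast
    then have "\<Psi> y = x" using inv by simp
    then have "x \<in> \<Psi> ` Y" using y by blast
    then show "y \<in> E" using p x by (auto simp: E_def)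
  qed
  have "compact E" unfolding E_def by (intro compact_continuous_image contE compact_cball)
  moreover have "E \<noteq> {}" using \<open>Y \<subseteq> E\<close> by (auto simp: Y_def)
  ultimately obtain y0 where y0: "y0 \<in> E" "\<And>y. y \<in> E \<Longrightarrow> infdist y0 (frontier \<Omega>) \<le> infdist y (frontier \<Omega>)"
    using continuous_attains_inf[of E "\<lambda>y. infdist y (frontier \<Omega>)"] continuous_on_infdist[OF continuous_on_id]
    by blast
  have "y0 \<notin> frontier \<Omega>" using y0 E\<Omega> \<Omega> by (auto simp: frontier_def interior_open)
  moreover have "frontier \<Omega> \<noteq> {}" using bd b by (auto simp: frontier_eq_empty)
  ultimately have "infdist y0 (frontier \<Omega>) > 0" by (intro infdist_pos_not_in_closed) auto
  with y0 have "\<exists>e'>0. \<forall>y\<in>E. e' \<le> infdist y (frontier \<Omega>)" by blast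
  then show "\<exists>E. connected E \<and> E \<subseteq> \<Omega> \<and> b \<in> E \<and>
     {y \<in> \<Omega>. e \<le> infdist y (frontier \<Omega>)} \<subseteq> E \<and> (\<exists>e'>0. \<forall>y\<in>E. e' \<le> infdist y (frontier \<Omega>))"
    using \<open>connected E\<close> E\<Omega> \<open>Y \<subseteq> E\<close> by (intro exI[of _ E]) (auto simp: Y_def)
qed

text \<open>
  At a boundary point of \<open>S\<close> the derivative within \<open>S\<close> need not be unique, so the chain rule does not show that \<open>B\<close> is a left
  inverse of \<open>A\<close>. In directions along which a segment stays in \<open>S\<close> one-dimensional uniqueness applies.
\<close>

lemma left_inverse_derivative_inward:
  fixes \<Phi> \<Psi> :: "'a::real_normed_vector \<Rightarrow> 'a"
  assumes S: "convex S" "p \<in> S" "x \<in> S"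
    and \<Phi>: "(\<Phi> has_derivative A) (at p within S)"
    and \<Psi>: "(\<Psi> has_derivative B) (at (\<Phi> p) within \<Phi> ` S)"
    and inv: "\<And>x. x \<in> S \<Longrightarrow> \<Psi> (\<Phi> x) = x"
  shows "B (A (x - p)) = x - p"
proof -
  define l where "l = (\<lambda>t::real. p + t *\<^sub>R (x - p))"
  have lS: "l ` {0..1} \<subseteq> S"
  proof
    fix y assume "y \<in> l ` {0..1}"
    then obtain t where t: "0 \<le> t" "t \<le> 1" "y = p + t *\<^sub>R (x - p)" by (auto simp: l_def)
    then have "y = (1 - t) *\<^sub>R p + t *\<^sub>R x" by (simp add: algebra_simps)
    then show "y \<in> S" using convexD_alt[OF S t(1,2)] by simp
  qed
  have dl: "(l has_derivative (\<lambda>t. t *\<^sub>R (x - p))) (at 0 within {0..1})"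
    unfolding l_def by (auto intro!: derivative_eq_intros)
  have l0: "l 0 = p" by (simp add: l_def)
  have "((\<lambda>t. \<Phi> (l t)) has_derivative (\<lambda>t. A (t *\<^sub>R (x - p)))) (at 0 within {0..1})"
    by (rule has_derivative_in_compose[OF dl]) (use has_derivative_subset[OF \<Phi> lS] l0 in simp)
  moreover have "(\<Psi> has_derivative B) (at (\<Phi> (l 0)) within (\<lambda>t. \<Phi> (l t)) ` {0..1})"
    unfolding l0 by (rule has_derivative_subset[OF \<Psi>]) (use lS in blast)
  ultimately have "((\<lambda>t. \<Psi> (\<Phi> (l t))) has_derivative (\<lambda>t. B (A (t *\<^sub>R (x - p))))) (at 0 within {0..1})"
    by (rule has_derivative_in_compose)
  then have "(l has_derivative (\<lambda>t. B (A (t *\<^sub>R (x - p))))) (at 0 within {0..1})"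
    by (rule has_derivative_transform[rotated 2]) (use lS inv in \<open>auto simp: image_subset_iff\<close>)
  moreover have "(\<lambda>t. B (A (t *\<^sub>R (x - p)))) = (\<lambda>t. t *\<^sub>R B (A (x - p)))"
    using linear_scale[OF has_derivative_linear[OF \<Phi>]] linear_scale[OF has_derivative_linear[OF \<Psi>]]
    by simp
  ultimately have "(l has_vector_derivative B (A (x - p))) (at 0 within cbox 0 1)"
    by (simp add: has_vector_derivative_def)
  moreover have "(l has_vector_derivative (x - p)) (at 0 within cbox 0 1)"
    using dl by (simp add: has_vector_derivative_def)
  ultimately show ?thesis
    by (intro vector_derivative_unique_within_closed_interval[of 0 1 0 l]) auto
qed

text \<open>
  Let \<open>\<Phi>\<close> parametrise \<open>\<Omega>\<close> by the ball, with derivative \<open>A\<close>, and let \<open>B\<close> be the derivative of its inverse. The normal at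
  \<open>q = \<Phi>(p)\<close> is \<open>w = B(q)\<^sup>T p\<close>, because \<open>B\<close> takes a difference \<open>y - q\<close> with \<open>y = \<Phi>(x)\<close> back to \<open>x - p\<close> up to a small error,
  and for \<open>\<bar>x\<bar> = \<bar>p\<bar> = 1\<close> the product \<open>(x - p) \<bullet> p = -\<bar>x - p\<bar>\<^sup>2/2\<close> is of second order. Uniform continuity of \<open>A\<close> on the
  compact ball makes the error uniform in \<open>q\<close>.
\<close>

lemma C1_boundary_asymptotically_flat:
  fixes \<Omega> :: "(real ^ 'n) set"
  assumes C1: "has_C1_boundary \<Omega>" and \<Omega>: "open \<Omega>"
  shows "asymptotically_flat_frontier \<Omega>"
  unfolding asymptotically_flat_frontier_def
proof (intro allI impI)
  fix \<tau> :: real assume \<tau>: "\<tau> > 0"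
  obtain \<Phi> \<Psi> :: "real ^ 'n \<Rightarrow> real ^ 'n" where h: "homeomorphism (cball 0 1) (closure \<Omega>) \<Phi> \<Psi>" and c: "C1_on (cball 0 1) \<Phi>" "C1_on (closure \<Omega>) \<Psi>"
    and fr: "\<Phi> ` sphere 0 1 = frontier \<Omega>" and bd: "bounded \<Omega>"
    using C1_boundary_parametrisation[OF C1 \<Omega>] by metis
  have inv: "\<And>x. x \<in> cball 0 1 \<Longrightarrow> \<Psi> (\<Phi> x) = x" and im: "\<Phi> ` cball 0 1 = closure \<Omega>"
    using h by (auto simp: homeomorphism_def)
  obtain A :: "real ^ 'n \<Rightarrow> (real ^ 'n) \<Rightarrow>\<^sub>L (real ^ 'n)" where
    A: "\<And>x. x \<in> cball 0 1 \<Longrightarrow> (\<Phi> has_derivative blinfun_apply (A x)) (at x within cball 0 1)"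
      "continuous_on (cball 0 1) A"
    using c(1) unfolding C1_on_def by blast
  obtain B :: "real ^ 'n \<Rightarrow> (real ^ 'n) \<Rightarrow>\<^sub>L (real ^ 'n)" where
    B: "\<And>x. x \<in> closure \<Omega> \<Longrightarrow> (\<Psi> has_derivative blinfun_apply (B x)) (at x within closure \<Omega>)"
      "continuous_on (closure \<Omega>) B"
    using c(2) unfolding C1_on_def by blast
  have "bounded (A ` cball 0 1)" "bounded (B ` closure \<Omega>)"
    using A(2) B(2) bd
    by (auto intro!: compact_imp_bounded compact_continuous_image simp: compact_closure)
  then obtain LA LB where LA: "LA > 0" "\<And>x. x \<in> cball 0 1 \<Longrightarrow> norm (A x) \<le> LA"
    and LB: "LB > 0" "\<And>x. x \<in> closure \<Omega> \<Longrightarrow> norm (B x) \<le> LB"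
    unfolding bounded_pos by (metis imageI)
  define \<omega> where "\<omega> = min (1 / (2 * LB)) (\<tau> / (4 * LB\<^sup>2 * LA))"
  have \<omega>: "\<omega> > 0" "LB * \<omega> \<le> 1/2" "2 * LA * LB * (LB * \<omega>) \<le> \<tau> / 2"
    using \<tau> LA LB by (auto simp: \<omega>_def min_def field_simps power2_eq_square)
  have "uniformly_continuous_on (cball 0 1) A"
    by (intro compact_uniformly_continuous A compact_cball)
  then obtain \<eta>0 where \<eta>0: "\<eta>0 > 0" "\<And>x p. x \<in> cball 0 1 \<Longrightarrow> p \<in> cball 0 1 \<Longrightarrow> dist x p < \<eta>0 \<Longrightarrow> dist (A x) (A p) < \<omega>"
    using \<omega>(1) unfolding uniformly_continuous_on_def by metis
  define \<eta> where "\<eta> = min \<eta>0 (\<tau> / (2 * LA * LB))"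
  have \<eta>: "\<eta> > 0" "LA * LB * \<eta> \<le> \<tau> / 2" "\<eta> \<le> \<eta>0"
    using \<tau> LA LB \<eta>0 by (auto simp: \<eta>_def min_def field_simps)
  have "uniformly_continuous_on (closure \<Omega>) \<Psi>"
    using h bd by (intro compact_uniformly_continuous) (auto simp: homeomorphism_def compact_closure)
  then obtain \<delta> where \<delta>: "\<delta> > 0" "\<And>y q. y \<in> closure \<Omega> \<Longrightarrow> q \<in> closure \<Omega> \<Longrightarrow> dist y q < \<delta> \<Longrightarrow> dist (\<Psi> y) (\<Psi> q) < \<eta>"
    using \<eta>(1) unfolding uniformly_continuous_on_def by metis
  show "\<exists>\<delta>>0. \<forall>q\<in>frontier \<Omega>. \<exists>\<nu>. norm \<nu> = 1 \<and>
     (\<forall>y\<in>frontier \<Omega>. norm (y - q) \<le> \<delta> \<longrightarrow> \<bar>(y - q) \<bullet> \<nu>\<bar> \<le> \<tau> * norm (y - q))"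
  proof (intro exI[of _ "\<delta>/2"] conjI ballI)
    show "\<delta> / 2 > 0" using \<delta> by simp
    fix q assume "q \<in> frontier \<Omega>"
    then obtain p where p: "norm p = 1" "q = \<Phi> p" using fr by force
    have pB: "p \<in> cball 0 1" using p by simp
    have qC: "q \<in> closure \<Omega>" using im pB p by blast
    have BA: "B q (A p (x - p)) = x - p" if "x \<in> cball 0 1" for x
      by (rule left_inverse_derivative_inward[OF convex_cball pB that A(1)[OF pB] _ inv])
         (use B(1)[OF qC] im p in auto)
    define w where "w = adjoint (B q) p"
    have w: "v \<bullet> w = B q v \<bullet> p" for v
      using adjoint_works[of "blinfun_apply (B q)" v p]
      by (simp add: w_def inner_commute blinfun.bounded_linear_right bounded_linear.linear)
    have "B q (A p p) = p"
      using BA[of 0] by (simp add: blinfun.minus_right)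
    then have "A p p \<bullet> w = 1" using p by (simp add: w dot_square_norm)
    then have "1 \<le> norm (A p p) * norm w" using norm_cauchy_schwarz[of "A p p" w] by simp
    also have "\<dots> \<le> LA * norm w"
      using norm_blinfun[of "A p" p] LA(2)[OF pB] p by (intro mult_right_mono) auto
    finally have w1: "1 \<le> LA * norm w" .
    \<comment> \<open>This lower bound for \<open>w\<close> is what allows the passage to the unit normal.\<close>
    then have w0: "norm w > 0" by (cases "w = 0") auto
    show "\<exists>\<nu>. norm \<nu> = 1 \<and>
       (\<forall>y\<in>frontier \<Omega>. norm (y - q) \<le> \<delta> / 2 \<longrightarrow> \<bar>(y - q) \<bullet> \<nu>\<bar> \<le> \<tau> * norm (y - q))"
    proof (intro exI[of _ "w /\<^sub>R norm w"] conjI ballI impI)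
      show "norm (w /\<^sub>R norm w) = 1" using w0 by simp
      fix y assume "y \<in> frontier \<Omega>" and yq: "norm (y - q) \<le> \<delta> / 2"
      then obtain x where x: "norm x = 1" "y = \<Phi> x" using fr by force
      have xB: "x \<in> cball 0 1" using x by simp
      have yC: "y \<in> closure \<Omega>" using im xB x by blast
      define t where "t = norm (x - p)"
      have "dist (\<Psi> y) (\<Psi> q) < \<eta>"
        using \<delta> yC qC yq by (intro \<delta>(2)) (auto simp: dist_norm)
      then have t: "t < \<eta>" "t \<ge> 0" using x p xB pB inv by (auto simp: t_def dist_norm)
      define e where "e = y - q - A p (x - p)"
      have "norm (\<Phi> x - \<Phi> p - A p (x - p)) \<le> norm (x - p) * \<omega>"
      proof (rule differentiable_bound_linearization[where f' = "\<lambda>x. blinfun_apply (A x)" and S = "cball 0 1 \<inter> cball p t"])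
        show "p + r *\<^sub>R (x - p) \<in> cball 0 1 \<inter> cball p t" if "r \<in> {0..1}" for r
        proof -
          have "p + r *\<^sub>R (x - p) = (1 - r) *\<^sub>R p + r *\<^sub>R x" by (simp add: algebra_simps)
          moreover have "(1 - r) *\<^sub>R p + r *\<^sub>R x \<in> cball 0 1"
            using that pB xB by (intro convexD_alt[OF convex_cball]) auto
          moreover have "dist p (p + r *\<^sub>R (x - p)) \<le> t"
            using that by (simp add: dist_norm t_def mult_left_le_one_le)
          ultimately show ?thesis by simp
        qed
        show "(\<Phi> has_derivative blinfun_apply (A z)) (at z within cball 0 1 \<inter> cball p t)"
          if "z \<in> cball 0 1 \<inter> cball p t" for z
          using that by (intro has_derivative_subset[OF A(1)]) auto
        show "onorm (blinfun_apply (A z) - blinfun_apply (A p)) \<le> \<omega>" if z: "z \<in> cball 0 1 \<inter> cball p t" for z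
        proof -
          have "dist (A z) (A p) < \<omega>"
            using z pB t \<eta>(3) by (intro \<eta>0(2)) (auto simp: dist_commute)
          then have "norm (A z - A p) \<le> \<omega>" by (simp add: dist_norm)
          then have "norm ((A z - A p) v) \<le> \<omega> * norm v" for v
            by (rule order_trans[OF norm_blinfun mult_right_mono]) simp
          then show ?thesis by (intro onorm_le) (simp add: blinfun.diff_left)
        qed
      qed (use pB t in auto)
      then have e: "norm e \<le> \<omega> * t" by (simp add: e_def x p t_def mult.commute)
      have Be: "norm (B q e) \<le> LB * \<omega> * t"
      proof -
        have "norm (B q e) \<le> norm (B q) * norm e" by (rule norm_blinfun)
        also have "\<dots> \<le> LB * (\<omega> * t)" using e LB qC by (intro mult_mono) auto
        finally show ?thesis by simp
      qed
      have Byq: "B q (y - q) = (x - p) + B q e"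
        using BA[OF xB] by (simp add: e_def blinfun.diff_right)
      have "t \<le> 2 * LB * norm (y - q)"
      proof -
        have "t \<le> norm (B q (y - q)) + norm (B q e)"
          using norm_triangle_ineq4[of "B q (y - q)" "B q e"] unfolding Byq by (simp add: t_def)
        moreover have "norm (B q (y - q)) \<le> LB * norm (y - q)"
          using norm_blinfun[of "B q" "y - q"] LB(2)[OF qC]
          by (meson mult_right_mono norm_ge_zero order_trans)
        moreover have "LB * \<omega> * t \<le> 1/2 * t" using \<omega> t by (intro mult_right_mono) auto
        ultimately show ?thesis using Be by simp
      qed
      have "t\<^sup>2 = 2 - 2 * (x \<bullet> p)" "(x - p) \<bullet> p = x \<bullet> p - 1"
        using x p by (simp_all add: t_def power2_norm_eq_inner inner_diff_left inner_diff_right inner_commute norm_eq_1)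
      then have "(x - p) \<bullet> p = - (t\<^sup>2 / 2)" by (simp add: field_simps)
      then have "(y - q) \<bullet> w = - (t\<^sup>2 / 2) + B q e \<bullet> p"
        by (simp add: w Byq inner_add_left)
      moreover have "\<bar>B q e \<bullet> p\<bar> \<le> LB * \<omega> * t"
        using Cauchy_Schwarz_ineq2[of "B q e" p] Be p by simp
      ultimately have "\<bar>(y - q) \<bullet> w\<bar> \<le> t\<^sup>2 / 2 + LB * \<omega> * t"
        using zero_le_power2[of t] by linarith
      also have "t\<^sup>2 / 2 + LB * \<omega> * t = (t / 2 + LB * \<omega>) * t"
        by (simp add: power2_eq_square algebra_simps)
      also have "\<dots> \<le> (\<eta> / 2 + LB * \<omega>) * (2 * LB * norm (y - q))"
        using t \<open>t \<le> 2 * LB * norm (y - q)\<close> LB \<omega> by (intro mult_mono) auto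
      finally have "LA * \<bar>(y - q) \<bullet> w\<bar> \<le> LA * ((\<eta> / 2 + LB * \<omega>) * (2 * LB * norm (y - q)))"
        using LA by (intro mult_left_mono) auto
      also have "\<dots> = (LA * LB * \<eta> + 2 * LA * LB * (LB * \<omega>)) * norm (y - q)"
        by (simp add: algebra_simps)
      also have "\<dots> \<le> \<tau> * norm (y - q)"
        using \<omega>(3) \<eta>(2) by (intro mult_right_mono) auto
      finally have 1: "LA * \<bar>(y - q) \<bullet> w\<bar> \<le> \<tau> * norm (y - q)" .
      have "\<bar>(y - q) \<bullet> (w /\<^sub>R norm w)\<bar> = \<bar>(y - q) \<bullet> w\<bar> * (1 / norm w)"
        by (simp add: abs_mult divide_inverse mult.commute)
      also have "\<dots> \<le> \<bar>(y - q) \<bullet> w\<bar> * LA"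
        using w1 w0 by (intro mult_left_mono) (auto simp: field_simps)
      finally show "\<bar>(y - q) \<bullet> (w /\<^sub>R norm w)\<bar> \<le> \<tau> * norm (y - q)"
        using 1 by (simp add: mult.commute)
    qed
  qed
qed

context harmonic_qc_map
begin

section \<open>Hoelder continuity up to the boundary\<close>

text \<open>
  The argument of Hardy and Littlewood: with \<open>r = \<bar>x - y\<bar>\<close>, go from \<open>x\<close> and \<open>y\<close> inwards to \<open>(1 - r) x\<close> and \<open>(1 - r) y\<close>,
  which costs at most the integral \<open>S r\<^sup>\<alpha>/\<alpha>\<close> each, and join these points inside the ball of radius \<open>1 - r\<close>, where the
  gradient is at most \<open>S r\<^bsup>\<alpha>-1\<^esup>\<close>.
\<close>

lemma hoelder_of_stretch_bound:
  assumes \<alpha>: "0 < \<alpha>" "\<alpha> < 1"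
    and S: "S \<ge> 0" "\<And>x. x \<in> ball 0 1 \<Longrightarrow> s x \<le> S * (1 - norm x) powr (\<alpha> - 1)"
    and x: "x \<in> ball 0 1" and y: "y \<in> ball 0 1"
  shows "norm (f x - f y) \<le> (2 / \<alpha> + 1) * S * norm (x - y) powr \<alpha>"
proof -
  have radial: "norm (f x - f ((1 - r) *\<^sub>R x)) \<le> S * r powr \<alpha> / \<alpha>"
    if x: "x \<in> ball 0 1" and r: "0 < r" "r \<le> 1" for x r
  proof -
    have inB: "(1 - t) *\<^sub>R x \<in> ball 0 1" "t \<le> 1 - norm ((1 - t) *\<^sub>R x)" if "0 \<le> t" "t \<le> 1" for t
    proof -
      have "(1 - t) * norm x \<le> (1 - t) * 1" using that x by (intro mult_left_mono) auto
      then show "t \<le> 1 - norm ((1 - t) *\<^sub>R x)" using that by simp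
      have "(1 - t) * norm x \<le> 1 * norm x" using that by (intro mult_right_mono) auto
      then show "(1 - t) *\<^sub>R x \<in> ball 0 1" using that x by simp
    qed
    have "norm (f ((1 - r) *\<^sub>R x) - f ((1 - 0) *\<^sub>R x)) \<le> S * r powr \<alpha> / \<alpha> - S * 0 powr \<alpha> / \<alpha>"
    proof (rule differentiable_bound_general[OF r(1), where f = "\<lambda>t. f ((1 - t) *\<^sub>R x)" and \<phi> = "\<lambda>t. S * t powr \<alpha> / \<alpha>"])
      show "continuous_on {0..r} (\<lambda>t. f ((1 - t) *\<^sub>R x))"
        by (rule continuous_on_compose2[OF f_cont]) (use inB r in \<open>auto intro!: continuous_intros\<close>)
      show "continuous_on {0..r} (\<lambda>t. S * t powr \<alpha> / \<alpha>)"
        using \<alpha> by (intro continuous_intros continuous_on_powr') auto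
      fix t assume t: "0 < t" "t < r"
      note B = inB[of t]
      have "((\<lambda>t. (1 - t) *\<^sub>R x) has_derivative (\<lambda>h. h *\<^sub>R (- x))) (at t)"
        by (auto intro!: derivative_eq_intros)
      from has_derivative_compose[OF this der[OF B(1)]] t r
      have "((\<lambda>t. f ((1 - t) *\<^sub>R x)) has_derivative (\<lambda>h. f' ((1 - t) *\<^sub>R x) (h *\<^sub>R (- x)))) (at t)"
        by simp
      moreover have "f' ((1 - t) *\<^sub>R x) (h *\<^sub>R (- x)) = h *\<^sub>R f' ((1 - t) *\<^sub>R x) (- x)" for h
        using der[OF B(1)] t r by (intro linear_scale has_derivative_linear) auto
      ultimately show "((\<lambda>t. f ((1 - t) *\<^sub>R x)) has_vector_derivative f' ((1 - t) *\<^sub>R x) (- x)) (at t)"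
        by (simp add: has_vector_derivative_def)
      show "((\<lambda>t. S * t powr \<alpha> / \<alpha>) has_vector_derivative S * t powr (\<alpha> - 1)) (at t)"
        unfolding has_real_derivative_iff_has_vector_derivative[symmetric]
        using t \<alpha> by (auto intro!: derivative_eq_intros)
      have "norm (f' ((1 - t) *\<^sub>R x) (- x)) \<le> s ((1 - t) *\<^sub>R x) * norm (- x)"
        using B t r by (intro upper) auto
      also have "\<dots> \<le> s ((1 - t) *\<^sub>R x) * 1"
        using B t r x s_nonneg by (intro mult_left_mono) auto
      also have "\<dots> \<le> S * (1 - norm ((1 - t) *\<^sub>R x)) powr (\<alpha> - 1)" using S(2)[OF B(1)] t r by simp
      also have "\<dots> \<le> S * t powr (\<alpha> - 1)"
        using S(1) t r \<alpha> B(2) by (intro mult_left_mono powr_mono2') auto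
      finally show "norm (f' ((1 - t) *\<^sub>R x) (- x)) \<le> S * t powr (\<alpha> - 1)" .
    qed
    then show ?thesis by (simp add: norm_minus_commute)
  qed
  define r where "r = norm (x - y)"
  consider "r = 0" | "0 < r" "r \<le> 1" | "r > 1" using norm_ge_zero[of "x - y"] unfolding r_def by linarith
  then show ?thesis
  proof cases
    case 1
    then show ?thesis by (simp add: r_def)
  next
    case 2
    have "norm (f ((1 - r) *\<^sub>R x) - f ((1 - r) *\<^sub>R y)) \<le> S * r powr (\<alpha> - 1) * norm ((1 - r) *\<^sub>R x - (1 - r) *\<^sub>R y)"
    proof (rule differentiable_bound[where f' = f' and S = "cball 0 (1 - r)"])
      fix z :: "real ^ 'n" assume z: "z \<in> cball 0 (1 - r)"
      then have zB: "z \<in> ball 0 1" using 2 by simp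
      show "(f has_derivative f' z) (at z within cball 0 (1 - r))"
        by (rule has_derivative_at_withinI[OF der[OF zB]])
      have "s z \<le> S * r powr (\<alpha> - 1)"
      proof -
        have "s z \<le> S * (1 - norm z) powr (\<alpha> - 1)" by (rule S(2)[OF zB])
        also have "\<dots> \<le> S * r powr (\<alpha> - 1)"
          using S(1) z 2 \<alpha> by (intro mult_left_mono powr_mono2') auto
        finally show ?thesis .
      qed
      then show "onorm (f' z) \<le> S * r powr (\<alpha> - 1)"
        by (intro onorm_le order_trans[OF upper[OF zB]] mult_right_mono) auto
    next
      have "(1 - r) * norm z \<le> (1 - r) * 1" if "z \<in> ball 0 1" for z :: "real ^ 'n"
        using that 2 by (intro mult_left_mono) auto
      then show "(1 - r) *\<^sub>R x \<in> cball 0 (1 - r)" "(1 - r) *\<^sub>R y \<in> cball 0 (1 - r)"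
        using x y 2 by auto
    qed auto
    also have "\<dots> \<le> S * r powr (\<alpha> - 1) * r"
    proof (rule mult_left_mono)
      have "norm ((1 - r) *\<^sub>R x - (1 - r) *\<^sub>R y) = (1 - r) * r"
        using 2 by (simp add: scaleR_diff_right[symmetric] r_def del: scaleR_diff_right)
      also have "\<dots> \<le> 1 * r" using 2 by (intro mult_right_mono) auto
      finally show "norm ((1 - r) *\<^sub>R x - (1 - r) *\<^sub>R y) \<le> r" by simp
    qed (use S in auto)
    also have "\<dots> = S * r powr \<alpha>"
      using 2 by (simp add: powr_diff)
    finally have mid: "norm (f ((1 - r) *\<^sub>R x) - f ((1 - r) *\<^sub>R y)) \<le> S * r powr \<alpha>" .
    have "norm (f x - f y) \<le> S * r powr \<alpha> / \<alpha> + S * r powr \<alpha> + S * r powr \<alpha> / \<alpha>"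
      using norm_triangle_ineq[of "f x - f ((1 - r) *\<^sub>R x)" "f ((1 - r) *\<^sub>R x) - f y"]
        norm_triangle_ineq4[of "f ((1 - r) *\<^sub>R x) - f ((1 - r) *\<^sub>R y)" "f y - f ((1 - r) *\<^sub>R y)"]
        mid radial[OF x 2] radial[OF y 2] by simp
    then show ?thesis by (simp add: r_def field_simps)
  next
    case 3
    have "norm (f x - f y) \<le> norm (f x - f 0) + norm (f y - f 0)"
      using norm_triangle_ineq4[of "f x - f 0" "f y - f 0"] by simp
    also have "\<dots> \<le> (2 / \<alpha>) * S * 1"
      using radial[OF x, of 1] radial[OF y, of 1] by simp
    also have "\<dots> \<le> (2 / \<alpha> + 1) * S * r powr \<alpha>"
      using 3 \<alpha> S by (intro mult_mono) (auto simp: ge_one_powr_ge_zero)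
    finally show ?thesis by (simp add: r_def)
  qed
qed

text \<open>
  The comparison near a boundary point needs boundary values. They exist by uniform continuity, inherit the Hoelder
  estimate along radii, and lie in \<open>\<partial>\<Omega>\<close> because \<open>f\<close> is a proper map.
\<close>

lemma boundary_extension:
  assumes \<alpha>: "0 < \<alpha>" and H: "H \<ge> 0"
    and hol: "\<And>x y. x \<in> ball 0 1 \<Longrightarrow> y \<in> ball 0 1 \<Longrightarrow> norm (f x - f y) \<le> H * norm (x - y) powr \<alpha>"
  obtains F where "continuous_on (cball 0 1) F" "\<And>x. x \<in> ball 0 1 \<Longrightarrow> F x = f x"
    "\<And>x y. x \<in> cball 0 1 \<Longrightarrow> y \<in> cball 0 1 \<Longrightarrow> norm (F x - F y) \<le> H * norm (x - y) powr \<alpha>"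
    "\<And>x. norm x = 1 \<Longrightarrow> F x \<in> frontier \<Omega>"
proof -
  have "uniformly_continuous_on (ball 0 1) f"
    unfolding uniformly_continuous_on_def
  proof (intro allI impI)
    fix e :: real assume e: "e > 0"
    define d where "d = (e / (H + 1)) powr (1 / \<alpha>)"
    have "d > 0" using e H by (simp add: d_def)
    moreover have "dist (f y) (f x) < e" if "x \<in> ball 0 1" "y \<in> ball 0 1" "dist y x < d" for x y
    proof -
      have "norm (y - x) powr \<alpha> \<le> d powr \<alpha>"
        using that \<alpha> by (intro powr_mono2) (auto simp: dist_norm)
      also have "d powr \<alpha> = e / (H + 1)" using \<alpha> e H by (simp add: d_def powr_powr)
      finally have "H * norm (y - x) powr \<alpha> \<le> H * (e / (H + 1))" using H by (rule mult_left_mono)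
      also have "\<dots> < e" using e H by (simp add: field_simps)
      finally show ?thesis using hol[OF that(2,1)] by (simp add: dist_norm)
    qed
    ultimately show "\<exists>d>0. \<forall>x\<in>ball 0 1. \<forall>x'\<in>ball 0 1. dist x' x < d \<longrightarrow> dist (f x') (f x) < e"
      by blast
  qed
  then obtain F where F: "uniformly_continuous_on (closure (ball 0 1)) F" "\<And>x. x \<in> ball 0 1 \<Longrightarrow> f x = F x"
    by (metis uniformly_continuous_on_extension_on_closure)
  have cont: "continuous_on (cball 0 1) F"
    using uniformly_continuous_imp_continuous[OF F(1)] by simp
  define t where "t = (\<lambda>k. 1 - inverse (real (Suc k)))"
  have t: "0 \<le> t k" "t k < 1" for k by (auto simp: t_def field_simps)
  have tlim: "t \<longlonglongrightarrow> 1"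
    using tendsto_diff[OF tendsto_const LIMSEQ_inverse_real_of_nat, of 1] by (simp add: t_def)
  have inB: "t k *\<^sub>R x \<in> ball 0 1" if "x \<in> cball 0 1" for x :: "real ^ 'n" and k
  proof -
    have "t k * norm x \<le> t k * 1" using that t by (intro mult_left_mono) auto
    then show ?thesis using t[of k] by simp
  qed
  have lim: "(\<lambda>k. f (t k *\<^sub>R x)) \<longlonglongrightarrow> F x" if x: "x \<in> cball 0 1" for x
  proof -
    have "(\<lambda>k. t k *\<^sub>R x) \<longlonglongrightarrow> 1 *\<^sub>R x" by (intro tendsto_intros tlim)
    then have "(\<lambda>k. F (t k *\<^sub>R x)) \<longlonglongrightarrow> F x"
      using x inB[OF x] by (intro continuous_on_tendsto_compose[OF cont]) (auto simp: less_imp_le)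
    then show ?thesis using F(2)[OF inB[OF x]] by simp
  qed
  show ?thesis
  proof (rule that[OF cont])
    show "F x = f x" if "x \<in> ball 0 1" for x using F(2)[OF that] by simp
    show "norm (F x - F y) \<le> H * norm (x - y) powr \<alpha>" if "x \<in> cball 0 1" "y \<in> cball 0 1" for x y
    proof (rule tendsto_upperbound)
      show "(\<lambda>k. norm (f (t k *\<^sub>R x) - f (t k *\<^sub>R y))) \<longlonglongrightarrow> norm (F x - F y)"
        by (intro tendsto_intros lim that)
      have "norm (f (t k *\<^sub>R x) - f (t k *\<^sub>R y)) \<le> H * norm (x - y) powr \<alpha>" for k
      proof -
        have "norm (t k *\<^sub>R x - t k *\<^sub>R y) = t k * norm (x - y)"
          using t[of k] by (simp add: scaleR_diff_right[symmetric] del: scaleR_diff_right)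
        also have "\<dots> \<le> 1 * norm (x - y)" using t[of k] by (intro mult_right_mono) auto
        finally have "norm (t k *\<^sub>R x - t k *\<^sub>R y) powr \<alpha> \<le> norm (x - y) powr \<alpha>"
          using \<alpha> by (intro powr_mono2) auto
        then have "H * norm (t k *\<^sub>R x - t k *\<^sub>R y) powr \<alpha> \<le> H * norm (x - y) powr \<alpha>"
          using H by (rule mult_left_mono)
        then show ?thesis using hol[OF inB[OF that(1)] inB[OF that(2)]] order_trans by blast
      qed
      then show "\<forall>\<^sub>F k in sequentially. norm (f (t k *\<^sub>R x) - f (t k *\<^sub>R y)) \<le> H * norm (x - y) powr \<alpha>"
        by simp
    qed simp
    fix x :: "real ^ 'n" assume x: "norm x = 1"
    have "infdist (F x) (frontier \<Omega>) \<le> 0"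
    proof (rule field_le_epsilon)
      fix e :: real assume "e > 0"
      then obtain \<delta> where \<delta>: "\<delta> > 0" "\<And>x. x \<in> ball 0 1 \<Longrightarrow> 1 - norm x < \<delta> \<Longrightarrow> infdist (f x) (frontier \<Omega>) < e"
        using near_boundary by blast
      have "\<forall>\<^sub>F k in sequentially. 1 - \<delta> < t k" using tlim \<delta>(1) by (intro order_tendstoD) auto
      then have "\<forall>\<^sub>F k in sequentially. infdist (f (t k *\<^sub>R x)) (frontier \<Omega>) \<le> e"
      proof eventually_elim
        case (elim k)
        have "infdist (f (t k *\<^sub>R x)) (frontier \<Omega>) < e"
          using x t[of k] elim by (intro \<delta>(2)) auto
        then show ?case by simp
      qed
      moreover have "(\<lambda>k. infdist (f (t k *\<^sub>R x)) (frontier \<Omega>)) \<longlonglongrightarrow> infdist (F x) (frontier \<Omega>)"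
        using x by (intro tendsto_infdist lim) auto
      ultimately show "infdist (F x) (frontier \<Omega>) \<le> 0 + e"
        by (intro tendsto_upperbound[where F = sequentially]) auto
    qed
    then show "F x \<in> frontier \<Omega>"
      using frontier_nonempty infdist_nonneg[of "F x" "frontier \<Omega>"]
      by (subst in_closed_iff_infdist_zero) auto
  qed
qed

section \<open>Points of nearly maximal weighted stretch\<close>

text \<open>
  The estimate behind the theorem, for \<open>u = (f - q) \<bullet> \<nu>\<close> at the boundary point \<open>q = f(\<xi>)\<close> with normal \<open>\<nu>\<close>. Flatness bounds
  \<open>u\<close> by \<open>\<tau> A\<close> on the unit sphere inside the ball of radius \<open>Rd\<close> about \<open>\<xi>\<close>, Hoelder continuity bounds it by \<open>A\<close> everywhere
  in that ball. The comparison lemma for the half-space that touches the unit ball at \<open>\<xi>\<close> and the gradient estimate bound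
  \<open>\<nabla>u(x\<^sub>0)\<close> from above, quasiconformality bounds it from below. The common factor \<open>\<lambda>\<close> cancels.
\<close>

lemma near_maximal_stretch_estimate:
  assumes \<alpha>: "0 < \<alpha>" "\<alpha> < 1" and S: "S > 0"
    and sS: "\<And>x. x \<in> ball 0 1 \<Longrightarrow> s x \<le> S * (1 - norm x) powr (\<alpha> - 1)"
    and x0: "x0 \<in> ball 0 1" "x0 \<noteq> 0" "S / 2 \<le> (1 - norm x0) powr (1 - \<alpha>) * s x0"
    and R: "R \<ge> 2" and \<tau>: "\<tau> > 0"
    and flat: "\<And>q. q \<in> frontier \<Omega> \<Longrightarrow> \<exists>\<nu>. norm \<nu> = 1 \<and>
       (\<forall>y\<in>frontier \<Omega>. norm (y - q) \<le> \<delta> \<longrightarrow> \<bar>(y - q) \<bullet> \<nu>\<bar> \<le> \<tau> * norm (y - q))"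
    and small: "(2 / \<alpha> + 1) * (S * (1 - norm x0) powr \<alpha>) * R powr \<alpha> \<le> \<delta>"
  shows "1 \<le> 4 * n\<^sup>2 * K * (2 / \<alpha> + 1) * R powr \<alpha> * (\<tau> + 3 * n / R)"
proof -
  define d where "d = 1 - norm x0"
  define l where "l = S * d powr \<alpha>"
  define H where "H = 2 / \<alpha> + 1"
  define A where "A = H * l * R powr \<alpha>"
  have d: "0 < d" "d < 1" using x0 by (auto simp: d_def)
  have l: "l > 0" using S d by (simp add: l_def)
  have H: "H > 0" using \<alpha> by (simp add: H_def add_pos_pos)
  have A: "A > 0" "A \<le> \<delta>" using H l R small by (auto simp: A_def l_def d_def H_def)
  obtain F where F: "continuous_on (cball 0 1) F" "\<And>x. x \<in> ball 0 1 \<Longrightarrow> F x = f x"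
    "\<And>x y. x \<in> cball 0 1 \<Longrightarrow> y \<in> cball 0 1 \<Longrightarrow> norm (F x - F y) \<le> H * S * norm (x - y) powr \<alpha>"
    "\<And>x. norm x = 1 \<Longrightarrow> F x \<in> frontier \<Omega>"
  proof (rule boundary_extension[of \<alpha> "H * S"])
    show "norm (f x - f y) \<le> H * S * norm (x - y) powr \<alpha>" if "x \<in> ball 0 1" "y \<in> ball 0 1" for x y
      unfolding H_def using that S by (intro hoelder_of_stretch_bound \<alpha> sS) auto
  qed (use \<alpha> H S in auto)
  define \<xi> where "\<xi> = x0 /\<^sub>R norm x0"
  have \<xi>: "norm \<xi> = 1" using x0 by (simp add: \<xi>_def)
  have x0\<xi>: "norm (x0 - \<xi>) = d"
  proof -
    have "x0 - \<xi> = (1 - 1 / norm x0) *\<^sub>R x0" by (simp add: \<xi>_def algebra_simps divide_inverse)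
    then have "norm (x0 - \<xi>) = \<bar>(1 - 1 / norm x0) * norm x0\<bar>" by (simp add: abs_mult)
    also have "(1 - 1 / norm x0) * norm x0 = - d" using x0 by (simp add: d_def field_simps)
    finally show ?thesis using d by simp
  qed
  define q where "q = F \<xi>"
  have q: "q \<in> frontier \<Omega>" using F(4)[OF \<xi>] by (simp add: q_def)
  obtain \<nu> where \<nu>: "norm \<nu> = 1"
    "\<And>y. y \<in> frontier \<Omega> \<Longrightarrow> norm (y - q) \<le> \<delta> \<Longrightarrow> \<bar>(y - q) \<bullet> \<nu>\<bar> \<le> \<tau> * norm (y - q)"
    using flat[OF q] by blast
  define \<rho> where "\<rho> = R * d"
  have \<rho>: "\<rho> > 0" using R d by (simp add: \<rho>_def)
  define w where "w = (\<lambda>y. (F y - q) \<bullet> \<nu>)"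
  define U where "U = ball 0 1 \<inter> ball \<xi> \<rho>"
  have dist: "norm (F y - q) \<le> A" if "y \<in> cball 0 1" "norm (y - \<xi>) \<le> \<rho>" for y
  proof -
    have "norm (F y - q) \<le> H * S * norm (y - \<xi>) powr \<alpha>"
      unfolding q_def using that \<xi> by (intro F(3)) auto
    also have "\<dots> \<le> H * S * \<rho> powr \<alpha>"
      using that H S \<alpha> by (intro mult_left_mono powr_mono2) auto
    also have "\<dots> = A" using R d by (simp add: A_def l_def \<rho>_def powr_mult)
    finally show ?thesis .
  qed
  have w_le: "\<bar>w y\<bar> \<le> norm (F y - q)" for y
    using Cauchy_Schwarz_ineq2[of "F y - q" \<nu>] \<nu>(1) by (simp add: w_def)
  have lapf: "has_laplacian (\<lambda>y. (f y - q) \<bullet> \<nu>) 0 y" if "y \<in> ball 0 1" for y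
  proof -
    have "has_laplacian (\<lambda>y. f y \<bullet> \<nu> - q \<bullet> \<nu>) (0 - 0) y"
      using harm[of \<nu>] that by (intro has_laplacian_diff has_laplacian_const) (auto simp: harmonic_fun_def)
    then show ?thesis by (simp add: inner_diff_left)
  qed
  have clU: "y \<in> cball 0 1 \<and> norm (y - \<xi>) \<le> \<rho>" if "y \<in> closure U" for y
  proof -
    have "closure U \<subseteq> cball 0 1 \<inter> cball \<xi> \<rho>"
      by (rule closure_minimal) (auto simp: U_def)
    then show ?thesis using that by (auto simp: dist_norm norm_minus_commute)
  qed
  have oU: "open U" by (auto simp: U_def)
  have est: "\<bar>w y\<bar> \<le> A * (\<tau> + 3 * n / R)" if y: "y \<in> cball x0 (d/2)" for y
  proof -
    have yB: "y \<in> ball 0 1" using half_depth_cball[OF x0(1)] y by (auto simp: d_def)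
    have y\<xi>: "norm (y - \<xi>) \<le> 3/2 * d"
      using norm_triangle_ineq[of "y - x0" "x0 - \<xi>"] y x0\<xi> by (simp add: dist_norm norm_minus_commute)
    have "3/2 * d < R * d" using R d by (intro mult_strict_right_mono) auto
    then have yU: "y \<in> U" using yB y\<xi> by (simp add: U_def \<rho>_def dist_norm norm_minus_commute)
    define h where "h = (y - \<xi>) \<bullet> (- \<xi>)"
    have "\<bar>w y\<bar> \<le> \<tau> * A + A * (((norm (y - \<xi>))\<^sup>2 - CARD('n) * ((y - \<xi>) \<bullet> (- \<xi>))\<^sup>2) / \<rho>\<^sup>2 + CARD('n) * ((y - \<xi>) \<bullet> (- \<xi>)) / \<rho>)"
    proof (rule half_ball_comparison[OF _ \<rho> oU _ _ _ _ _ _ _ yU])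
      show "norm (- \<xi>) = 1" using \<xi> by simp
      show "norm (z - \<xi>) < \<rho> \<and> 0 < (z - \<xi>) \<bullet> - \<xi>" if z: "z \<in> U" for z
      proof -
        have "z \<bullet> \<xi> \<le> norm z * norm \<xi>" by (rule norm_cauchy_schwarz)
        also have "\<dots> < 1" using z \<xi> by (simp add: U_def)
        finally show ?thesis using z \<xi> by (simp add: U_def inner_diff_left norm_eq_1 dist_norm norm_minus_commute)
      qed
      show "continuous_on (closure U) w"
        unfolding w_def using clU by (intro continuous_intros continuous_on_subset[OF F(1)]) blast
      show "has_laplacian w 0 z" if "z \<in> U" for z
        by (rule has_laplacian_cong[OF open_ball[of 0 1] _ _ lapf])
           (use that F(2) in \<open>auto simp: w_def U_def\<close>)
      show "\<bar>w z\<bar> \<le> A" if "z \<in> frontier U" for z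
        using w_le[of z] dist[of z] clU[of z] that by (auto simp: frontier_def)
      show "\<bar>w z\<bar> \<le> \<tau> * A" if z: "z \<in> frontier U" "norm (z - \<xi>) < \<rho>" for z
      proof -
        have zc: "z \<in> closure U" "z \<notin> U" using z oU by (auto simp: frontier_def interior_open)
        then have "norm z = 1"
          using clU[OF zc(1)] z(2) by (auto simp: U_def dist_norm norm_minus_commute)
        then have "F z \<in> frontier \<Omega>" by (rule F(4))
        moreover have Fz: "norm (F z - q) \<le> A" using clU[OF zc(1)] by (intro dist) auto
        ultimately have "\<bar>w z\<bar> \<le> \<tau> * norm (F z - q)" unfolding w_def using A by (intro \<nu>(2)) auto
        also have "\<dots> \<le> \<tau> * A" using Fz \<tau> by (intro mult_left_mono) auto
        finally show ?thesis .
      qed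
    qed (use A \<tau> in auto)
    also have "\<dots> = \<tau> * A + A * (((norm (y - \<xi>))\<^sup>2 - n * h\<^sup>2) / \<rho>\<^sup>2 + n * h / \<rho>)"
      by (simp add: h_def N_eq)
    also have "\<dots> \<le> \<tau> * A + A * (3 * n / R)"
    proof (intro add_left_mono mult_left_mono)
      have "h \<le> 3/2 * d"
        using norm_cauchy_schwarz[of "y - \<xi>" "- \<xi>"] \<xi> y\<xi> by (simp add: h_def)
      then have "n * h / \<rho> \<le> n * (3/2 * d) / \<rho>"
        using \<rho> by (intro divide_right_mono mult_left_mono) auto
      also have "\<dots> = 3/2 * n / R" using d R by (simp add: \<rho>_def)
      finally have 1: "n * h / \<rho> \<le> 3/2 * n / R" .
      have "((norm (y - \<xi>))\<^sup>2 - n * h\<^sup>2) / \<rho>\<^sup>2 \<le> (3/2 * d)\<^sup>2 / \<rho>\<^sup>2"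
      proof (rule divide_right_mono)
        have "(norm (y - \<xi>))\<^sup>2 \<le> (3/2 * d)\<^sup>2" using y\<xi> by (intro power_mono) auto
        moreover have "0 \<le> n * h\<^sup>2" by simp
        ultimately show "(norm (y - \<xi>))\<^sup>2 - n * h\<^sup>2 \<le> (3/2 * d)\<^sup>2" by linarith
      qed simp
      also have "\<dots> = 9/4 / R * (1 / R)" using d R by (simp add: \<rho>_def power2_eq_square)
      also have "\<dots> \<le> 9/4 / R * (1/2 * n)"
      proof (rule mult_left_mono)
        have "1 / R \<le> 1 / 2" using R by (simp add: field_simps)
        then show "1 / R \<le> 1/2 * n" using n_ge_1 by linarith
      qed (use R in auto)
      finally have 2: "((norm (y - \<xi>))\<^sup>2 - n * h\<^sup>2) / \<rho>\<^sup>2 \<le> 9/8 * n / R" by simp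
      have "9/8 * n / R + 3/2 * n / R \<le> 3 * n / R" using R n_ge_1 by (simp add: field_simps)
      with 1 2 show "((norm (y - \<xi>))\<^sup>2 - n * h\<^sup>2) / \<rho>\<^sup>2 + n * h / \<rho> \<le> 3 * n / R" by linarith
    qed (use A in auto)
    finally show ?thesis by (simp add: algebra_simps)
  qed
  define m where "m = A * (\<tau> + 3 * n / R)"
  have s0: "s x0 > 0"
  proof -
    have "0 < (1 - norm x0) powr (1 - \<alpha>) * s x0" using x0 S by linarith
    then show ?thesis using s_nonneg[OF x0(1)] by (simp add: zero_less_mult_iff)
  qed
  have lin: "linear (f' x0)" using der[OF x0(1)] by (rule has_derivative_linear)
  have "inj (f' x0)"
    unfolding linear_injective_0[OF lin]
  proof (intro allI impI)
    fix h assume "f' x0 h = 0"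
    then have "s x0 * norm h \<le> 0" using lower[OF x0(1), of h] by simp
    then show "h = 0" using s0 by (simp add: mult_le_0_iff)
  qed
  then have "surj (f' x0)" using linear_injective_imp_surjective[OF lin] by simp
  \<comment> \<open>In the direction \<open>k\<close> the derivative of \<open>u\<close> is \<open>1\<close>, and \<open>k\<close> is short
    because the stretch of \<open>f\<close> is large in all directions.\<close>
  then obtain k where k: "f' x0 k = \<nu>" by (metis surjD)
  have "s x0 * norm k \<le> K" using lower[OF x0(1), of k] k \<nu>(1) by simp
  then have k2: "norm k \<le> K / s x0" using s0 by (simp add: field_simps)
  have m0: "m \<ge> 0" using A \<tau> R by (simp add: m_def)
  have "\<bar>f' x0 k \<bullet> \<nu>\<bar> \<le> CARD('n)\<^sup>2 * m / (d/2) * norm k"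
  proof (rule harmonic_gradient_estimate[where u = "\<lambda>y. (f y - q) \<bullet> \<nu>"])
    have sub: "cball x0 (d/2) \<subseteq> ball 0 1" using half_depth_cball[OF x0(1)] by (simp add: d_def)
    show "((\<lambda>y. (f y - q) \<bullet> \<nu>) has_derivative (\<lambda>h. f' x0 h \<bullet> \<nu>)) (at x0)"
      using der[OF x0(1)] by (auto intro!: derivative_eq_intros)
    show "harmonic_fun (cball x0 (d/2)) (\<lambda>y. (f y - q) \<bullet> \<nu>)"
      unfolding harmonic_fun_def
    proof (intro ballI conjI lapf)
      fix y assume "y \<in> cball x0 (d/2)"
      then show y: "y \<in> ball 0 1" using sub by blast
      have "((\<lambda>y. (f y - q) \<bullet> \<nu>) has_derivative (\<lambda>h. f' y h \<bullet> \<nu>)) (at y)"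
        using der[OF y] by (auto intro!: derivative_eq_intros)
      then show "(\<lambda>y. (f y - q) \<bullet> \<nu>) differentiable at y" by (rule differentiableI)
    qed
    show "\<bar>(f y - q) \<bullet> \<nu>\<bar> \<le> m" if "y \<in> cball x0 (d/2)" for y
      using est[OF that] F(2)[of y] sub that by (auto simp: m_def w_def)
  qed (use d in auto)
  then have "1 \<le> n\<^sup>2 * m / (d/2) * norm k" using k \<nu>(1) by (simp add: dot_square_norm N_eq)
  also have "\<dots> \<le> n\<^sup>2 * m / (d/2) * (K / s x0)"
    using k2 m0 d by (intro mult_left_mono) auto
  finally have "d * s x0 \<le> 2 * n\<^sup>2 * m * K" using d s0 by (simp add: field_simps)
  moreover have "l / 2 \<le> d * s x0"
  proof -
    have "d powr \<alpha> * (S / 2) \<le> d powr \<alpha> * (d powr (1 - \<alpha>) * s x0)"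
      using x0(3) by (intro mult_left_mono) (auto simp: d_def)
    also have "\<dots> = d powr (\<alpha> + (1 - \<alpha>)) * s x0" unfolding powr_add by simp
    also have "\<dots> = d * s x0" using d by simp
    finally show ?thesis by (simp add: l_def mult.commute)
  qed
  ultimately have "l \<le> 2 * (2 * n\<^sup>2 * m * K)" by linarith
  also have "\<dots> = l * (4 * n\<^sup>2 * K * H * R powr \<alpha> * (\<tau> + 3 * n / R))"
    by (simp add: m_def A_def mult_ac)
  finally have "l * 1 \<le> l * (4 * n\<^sup>2 * K * H * R powr \<alpha> * (\<tau> + 3 * n / R))" by simp
  then show ?thesis using l unfolding H_def by (simp only: mult_le_cancel_left_pos)
qed

end

text \<open>
  The conclusion of \<open>near_maximal_stretch_estimate\<close> is false for a suitable choice of \<open>R\<close> and then of \<open>\<tau>\<close>, and one of its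
  hypotheses, the smallness of \<open>\<lambda> R\<^sup>\<alpha>\<close>, holds as soon as \<open>x\<^sub>0\<close> is close enough to the sphere. The order of the choices is \<open>R\<close>,
  \<open>\<tau>\<close>, then \<open>\<delta>\<close> from the flatness of the boundary, then \<open>\<eta>\<close> and the depth that belongs to it.
\<close>

lemma near_maximum_not_near_boundary:
  fixes \<Omega> :: "(real ^ 'n) set"
  assumes ex: "connected_exhaustion \<Omega> b" and flat: "asymptotically_flat_frontier \<Omega>"
    and K: "K \<ge> 1" and D: "D > 0" and \<alpha>: "0 < \<alpha>" "\<alpha> < 1"
  shows "\<exists>\<delta>>0. \<forall>f g f' s S x0. harmonic_qc_map \<Omega> f g f' s K D CARD('n) \<longrightarrow> f 0 = b \<longrightarrow> S > 0 \<longrightarrow>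
       (\<forall>x\<in>ball 0 1. s x \<le> S * (1 - norm x) powr (\<alpha> - 1)) \<longrightarrow> x0 \<in> ball 0 1 \<longrightarrow>
       S / 2 \<le> (1 - norm x0) powr (1 - \<alpha>) * s x0 \<longrightarrow> \<delta> \<le> 1 - norm x0"
proof -
  define n where "n = real CARD('n)"
  define H where "H = 2 / \<alpha> + 1"
  define c where "c = 4 * n\<^sup>2 * K * H"
  have n: "n > 0" by (simp add: n_def)
  have H: "H > 0" using \<alpha> by (simp add: H_def add_pos_pos)
  have c: "c > 0" using n K H by (simp add: c_def)
  have "((\<lambda>R::real. R powr (\<alpha> - 1)) \<longlongrightarrow> 0) at_top"
    using \<alpha> by (intro tendsto_neg_powr filterlim_ident) auto
  then have "\<forall>\<^sub>F R::real in at_top. R powr (\<alpha> - 1) < 1 / (4 * (c * 3 * n))"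
    using c n by (intro order_tendstoD) auto
  then have "\<forall>\<^sub>F R::real in at_top. R powr (\<alpha> - 1) < 1 / (4 * (c * 3 * n)) \<and> R \<ge> 2"
    using eventually_ge_at_top[of 2] by eventually_elim simp
  then obtain R :: real where R: "R powr (\<alpha> - 1) < 1 / (4 * (c * 3 * n))" "R \<ge> 2"
    using eventually_happens' trivial_limit_at_top_linorder by blast
  have Rp: "R powr \<alpha> > 0" using R by simp
  define \<tau> where "\<tau> = 1 / (4 * (c * R powr \<alpha>))"
  have \<tau>: "\<tau> > 0" using c Rp by (simp add: \<tau>_def)
  have less: "c * R powr \<alpha> * (\<tau> + 3 * n / R) < 1"
  proof -
    have "c * R powr \<alpha> * \<tau> = 1/4" using c Rp by (simp add: \<tau>_def)
    moreover have "c * R powr \<alpha> * (3 * n / R) = c * 3 * n * R powr (\<alpha> - 1)"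
      using R by (simp add: powr_diff)
    moreover have "c * 3 * n * R powr (\<alpha> - 1) < 1/4"
      using R c n by (simp add: field_simps)
    ultimately show ?thesis by (simp add: distrib_left)
  qed
  from flat[unfolded asymptotically_flat_frontier_def, rule_format, OF \<tau>]
  obtain \<delta> where \<delta>: "\<delta> > 0" and fl: "\<forall>q\<in>frontier \<Omega>. \<exists>\<nu>. norm \<nu> = 1 \<and>
     (\<forall>y\<in>frontier \<Omega>. norm (y - q) \<le> \<delta> \<longrightarrow> \<bar>(y - q) \<bullet> \<nu>\<bar> \<le> \<tau> * norm (y - q))"
    by (elim exE conjE)
  define \<eta> where "\<eta> = \<delta> / (2 * H * R powr \<alpha>)"
  have "\<eta> > 0" using \<delta> H Rp by (simp add: \<eta>_def)
  from stretch_uniformly_small[OF ex K D this]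
  obtain \<delta>2 where \<delta>2: "\<delta>2 > 0" and
    st: "\<forall>f g f' s x. harmonic_qc_map \<Omega> f g f' s K D CARD('n) \<longrightarrow> f 0 = b \<longrightarrow> x \<in> ball 0 1 \<longrightarrow>
       1 - norm x < \<delta>2 \<longrightarrow> (1 - norm x) * s x < \<eta>"
    by (elim exE conjE)
  show ?thesis
  proof (intro exI[of _ "min \<delta>2 1"] conjI allI impI)
    show "min \<delta>2 1 > 0" using \<delta>2 by simp
    fix f g :: "real ^ 'n \<Rightarrow> real ^ 'n" and f' :: "real ^ 'n \<Rightarrow> real ^ 'n \<Rightarrow> real ^ 'n"
      and s :: "real ^ 'n \<Rightarrow> real" and S :: real and x0 :: "real ^ 'n"
    assume h: "harmonic_qc_map \<Omega> f g f' s K D CARD('n)" and f0: "f 0 = b" and S: "S > 0"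
      and sS: "\<forall>x\<in>ball 0 1. s x \<le> S * (1 - norm x) powr (\<alpha> - 1)"
      and x0: "x0 \<in> ball 0 1" "S / 2 \<le> (1 - norm x0) powr (1 - \<alpha>) * s x0"
    interpret harmonic_qc_map \<Omega> f g f' s K D "CARD('n)" by (rule h)
    show "min \<delta>2 1 \<le> 1 - norm x0"
    proof (rule ccontr)
      assume "\<not> ?thesis"
      then have d: "1 - norm x0 < \<delta>2" "x0 \<noteq> 0" by auto
      define d where "d = 1 - norm x0"
      have d0: "d > 0" using x0 by (simp add: d_def)
      have "d * s x0 < \<eta>" using st[rule_format, OF h f0 x0(1) d(1)] by (simp add: d_def)
      moreover have "d powr \<alpha> * (S / 2) \<le> d * s x0"
      proof -
        have "d powr \<alpha> * (S / 2) \<le> d powr \<alpha> * (d powr (1 - \<alpha>) * s x0)"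
          using x0(2) by (intro mult_left_mono) (auto simp: d_def)
        also have "\<dots> = d powr (\<alpha> + (1 - \<alpha>)) * s x0" unfolding powr_add by simp
        also have "\<dots> = d * s x0" using d0 by simp
        finally show ?thesis .
      qed
      ultimately have "S * d powr \<alpha> \<le> 2 * \<eta>" by (simp add: mult.commute)
      then have "H * (S * d powr \<alpha>) * R powr \<alpha> \<le> H * (2 * \<eta>) * R powr \<alpha>"
        using H by (intro mult_right_mono mult_left_mono) auto
      also have "\<dots> = \<delta>" using H Rp by (simp add: \<eta>_def)
      finally have "H * (S * d powr \<alpha>) * R powr \<alpha> \<le> \<delta>" .
      then have "1 \<le> 4 * (real CARD('n))\<^sup>2 * K * (2 / \<alpha> + 1) * R powr \<alpha> * (\<tau> + 3 * real CARD('n) / R)"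
        using fl d by (intro near_maximal_stretch_estimate[OF \<alpha> S sS[rule_format] x0(1) _ x0(2) R(2) \<tau>])
          (auto simp: H_def d_def)
      then show False using less by (simp add: c_def H_def n_def)
    qed
  qed
qed

section \<open>Harmonic quasiconformal maps in the Bloch space\<close>

lemma partial_eq_derivative:
  assumes "(u has_derivative u') (at x)"
  shows "((\<lambda>t. u (x + t *\<^sub>R axis i 1)) has_vector_derivative u' (axis i 1)) (at 0)"
    and "partial i u x = u' (axis i 1)"
proof -
  have "((\<lambda>t::real. x + t *\<^sub>R axis i 1) has_derivative (\<lambda>t. t *\<^sub>R axis i 1)) (at 0)"
    by (auto intro!: derivative_eq_intros)
  from has_derivative_compose[OF this, of u u'] assms
  have "((\<lambda>t. u (x + t *\<^sub>R axis i 1)) has_derivative (\<lambda>t. u' (t *\<^sub>R axis i 1))) (at 0)" by simp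
  then show d: "((\<lambda>t. u (x + t *\<^sub>R axis i 1)) has_vector_derivative u' (axis i 1)) (at 0)"
    by (simp add: has_vector_derivative_def linear_scale[OF has_derivative_linear[OF assms]])
  then show "partial i u x = u' (axis i 1)" by (simp add: partial_def vector_derivative_at)
qed

lemma gradient_inner:
  assumes "(u has_derivative u') (at x)"
  shows "u' h = gradient u x \<bullet> h"
proof -
  have lin: "linear u'" using assms by (rule has_derivative_linear)
  have "u' h = u' (\<Sum>k\<in>UNIV. (h $ k) *\<^sub>R axis k 1)"
    using basis_expansion[of h] by (simp add: scalar_mult_eq_scaleR)
  then show ?thesis
    by (simp add: linear_sum[OF lin] linear_scale[OF lin] gradient_def inner_vec_def
        partial_eq_derivative(2)[OF assms] mult.commute)
qed

lemma harmonic_on_has_laplacian: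
  fixes u :: "real ^ 'a \<Rightarrow> real"
  assumes u: "harmonic_on S u" and x: "x \<in> S"
  shows "has_laplacian u 0 x" "u differentiable (at x)"
proof -
  have S: "open S" using u by (simp add: harmonic_on_def)
  have du: "u differentiable (at y)" if "y \<in> S" for y
  proof -
    have "u differentiable_on S" using u by (simp add: harmonic_on_def)
    then have "u differentiable (at y within S)" using that by (simp add: differentiable_on_def)
    then show ?thesis unfolding at_within_open[OF that S] .
  qed
  then show "u differentiable (at x)" using x by blast
  have dg: "gradient u differentiable (at x)"
  proof -
    have "C1_on S (gradient u)" using u by (simp add: harmonic_on_def)
    then obtain G :: "real ^ 'a \<Rightarrow> (real ^ 'a) \<Rightarrow>\<^sub>L (real ^ 'a)"
      where "\<forall>y\<in>S. (gradient u has_derivative blinfun_apply (G y)) (at y within S)"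
      unfolding C1_on_def by (elim exE conjE)
    then have "(gradient u has_derivative blinfun_apply (G x)) (at x within S)" using x by (rule bspec)
    then show ?thesis unfolding at_within_open[OF x S] by (rule differentiableI)
  qed
  show "has_laplacian u 0 x"
  proof (rule has_laplacianI[where g = "\<lambda>i t. partial i u (x + t *\<^sub>R axis i 1)" and s = "\<lambda>i. partial i (partial i u) x"])
    fix i
    show "\<forall>\<^sub>F t in nhds 0. ((\<lambda>t. u (x + t *\<^sub>R axis i 1)) has_real_derivative
             partial i u (x + t *\<^sub>R axis i 1)) (at t)"
      using eventually_line_in_open[OF S x, of "axis i 1"]
    proof eventually_elim
      case (elim t)
      obtain u' where u': "(u has_derivative u') (at (x + t *\<^sub>R axis i 1))"
        using du[OF elim] unfolding differentiable_def by blast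
      have "((\<lambda>r::real. x + r *\<^sub>R axis i 1) has_derivative (\<lambda>r. r *\<^sub>R axis i 1)) (at t)"
        by (auto intro!: derivative_eq_intros)
      from has_derivative_compose[OF this u']
      have "((\<lambda>r. u (x + r *\<^sub>R axis i 1)) has_derivative (\<lambda>r. u' (r *\<^sub>R axis i 1))) (at t)" .
      then have "((\<lambda>r. u (x + r *\<^sub>R axis i 1)) has_vector_derivative u' (axis i 1)) (at t)"
        by (simp add: has_vector_derivative_def linear_scale[OF has_derivative_linear[OF u']])
      then show ?case
        by (simp add: has_real_derivative_iff_has_vector_derivative partial_eq_derivative(2)[OF u'])
    qed
    obtain G where "(gradient u has_derivative G) (at x)"
      using dg unfolding differentiable_def by blast
    then have "((\<lambda>y. gradient u y $ i) has_derivative (\<lambda>h. G h $ i)) (at x)"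
      by (rule bounded_linear.has_derivative[OF bounded_linear_vec_nth])
    then have p': "(partial i u has_derivative (\<lambda>h. G h $ i)) (at x)"
      by (simp add: gradient_def)
    show "((\<lambda>t. partial i u (x + t *\<^sub>R axis i 1)) has_real_derivative partial i (partial i u) x) (at 0)"
      using partial_eq_derivative[OF p', of i] by (simp add: has_real_derivative_iff_has_vector_derivative)
  qed (use u x in \<open>simp add: harmonic_on_def\<close>)
qed

lemma harmonic_fun_inner:
  fixes f :: "real ^ 'n \<Rightarrow> real ^ 'm"
  assumes "\<And>j. harmonic_on S (\<lambda>x. f x $ j)"
  shows "harmonic_fun S (\<lambda>x. f x \<bullet> \<nu>)"
  unfolding harmonic_fun_def
proof (intro ballI conjI)
  fix x assume x: "x \<in> S"
  have eq: "(\<lambda>x. f x \<bullet> \<nu>) = (\<lambda>x. \<Sum>j\<in>UNIV. \<nu> $ j * f x $ j)"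
    by (simp add: inner_vec_def mult.commute)
  have "has_laplacian (\<lambda>x. \<Sum>j\<in>UNIV. \<nu> $ j * f x $ j) (\<Sum>j\<in>(UNIV::'m set). \<nu> $ j * 0) x"
    by (intro has_laplacian_sum has_laplacian_cmult harmonic_on_has_laplacian(1)[OF assms x]) auto
  then show "has_laplacian (\<lambda>x. f x \<bullet> \<nu>) 0 x" by (simp add: eq)
  have "(\<lambda>x. f x $ j) differentiable (at x)" for j
    by (rule harmonic_on_has_laplacian(2)[OF assms x])
  then show "(\<lambda>x. f x \<bullet> \<nu>) differentiable (at x)"
    unfolding eq by (intro differentiable_sum differentiable_mult differentiable_const) auto
qed

lemma stretch_bounds:
  fixes f :: "real ^ 'n \<Rightarrow> real ^ 'n"
  assumes "f differentiable (at x)"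
  shows "norm (frechet_derivative f (at x) h) \<le> max_stretch f x * norm h"
    and "min_stretch f x * norm h \<le> norm (frechet_derivative f (at x) h)"
proof -
  define A where "A = frechet_derivative f (at x)"
  have bl: "bounded_linear A"
    using assms has_derivative_bounded_linear unfolding A_def frechet_derivative_works by blast
  have bd: "bdd_above ((\<lambda>h. norm (A h)) ` sphere 0 1)" "bdd_below ((\<lambda>h. norm (A h)) ` sphere 0 1)"
    using onorm[OF bl] by (auto intro!: bdd_aboveI[of _ "onorm A"] bdd_belowI[of _ 0]) (metis mult.right_neutral)
  show "norm (A h) \<le> max_stretch f x * norm h" "min_stretch f x * norm h \<le> norm (A h)"
  proof -
    have *: "norm (A h) = norm (A (h /\<^sub>R norm h)) * norm h" if "h \<noteq> 0"
      using that by (simp add: linear_scale[OF bounded_linear.linear[OF bl]])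
    have "norm (A (h /\<^sub>R norm h)) \<le> max_stretch f x" "min_stretch f x \<le> norm (A (h /\<^sub>R norm h))" if "h \<noteq> 0"
      using that bd unfolding max_stretch_def min_stretch_def A_def[symmetric]
      by (auto intro!: cSUP_upper cINF_lower)
    then show "norm (A h) \<le> max_stretch f x * norm h" "min_stretch f x * norm h \<le> norm (A h)"
      using * by (cases "h = 0"; simp add: linear_0[OF bounded_linear.linear[OF bl]] mult_right_mono)+
  qed
qed

lemma max_stretch_le_sum_gradient:
  fixes f :: "real ^ 'n \<Rightarrow> real ^ 'n"
  assumes "f differentiable (at x)"
  shows "max_stretch f x \<le> (\<Sum>j\<in>UNIV. norm (gradient (\<lambda>x. f x $ j) x))"
  unfolding max_stretch_def
proof (rule cSUP_least)
  show "sphere 0 1 \<noteq> ({} :: (real ^ 'n) set)" by simp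
  fix h :: "real ^ 'n" assume h: "h \<in> sphere 0 1"
  have der: "(f has_derivative frechet_derivative f (at x)) (at x)"
    using assms frechet_derivative_works by blast
  have "norm (frechet_derivative f (at x) h) \<le> (\<Sum>j\<in>UNIV. \<bar>frechet_derivative f (at x) h $ j\<bar>)"
    by (rule norm_le_l1_cart)
  also have "\<dots> \<le> (\<Sum>j\<in>UNIV. norm (gradient (\<lambda>x. f x $ j) x))"
  proof (rule sum_mono)
    fix j
    have "frechet_derivative f (at x) h $ j = gradient (\<lambda>x. f x $ j) x \<bullet> h"
      by (rule gradient_inner[OF bounded_linear.has_derivative[OF bounded_linear_vec_nth der]])
    then show "\<bar>frechet_derivative f (at x) h $ j\<bar> \<le> norm (gradient (\<lambda>x. f x $ j) x)"
      using Cauchy_Schwarz_ineq2[of "gradient (\<lambda>x. f x $ j) x" h] h by simp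
  qed
  finally show "norm (frechet_derivative f (at x) h) \<le> (\<Sum>j\<in>UNIV. norm (gradient (\<lambda>x. f x $ j) x))" .
qed

lemma quasiconformal_harmonic_qc_map:
  fixes \<Omega> :: "(real ^ 'n) set"
  assumes "2 \<le> CARD('n)" "K \<ge> 1" "D > 0" "open \<Omega>" "\<Omega> \<subseteq> cball 0 D"
    and qc: "quasiconformal K (ball 0 1) \<Omega> f" and f: "f \<in> harmonic_Bloch_map \<beta>"
  obtains g where "harmonic_qc_map \<Omega> f g (\<lambda>x. frechet_derivative f (at x)) (max_stretch f) K D CARD('n)"
proof -
  obtain g where g: "homeomorphism (ball 0 1) \<Omega> f g" using qc unfolding quasiconformal_def by blast
  have d: "f differentiable (at x)" "max_stretch f x \<le> K * min_stretch f x" if "x \<in> ball 0 1" for x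
    using qc that by (auto simp: quasiconformal_def)
  have "harmonic_qc_map \<Omega> f g (\<lambda>x. frechet_derivative f (at x)) (max_stretch f) K D CARD('n)"
  proof
    fix x :: "real ^ 'n" assume x: "x \<in> ball 0 1"
    show "(f has_derivative frechet_derivative f (at x)) (at x)"
      using d(1)[OF x] frechet_derivative_works by blast
    show "norm (frechet_derivative f (at x) h) \<le> max_stretch f x * norm h" for h
      by (rule stretch_bounds(1)[OF d(1)[OF x]])
    show "max_stretch f x * norm h \<le> K * norm (frechet_derivative f (at x) h)" for h
    proof -
      have "max_stretch f x * norm h \<le> K * min_stretch f x * norm h"
        by (intro mult_right_mono d(2)[OF x]) simp
      also have "\<dots> = K * (min_stretch f x * norm h)" by simp
      also have "\<dots> \<le> K * norm (frechet_derivative f (at x) h)"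
        using assms(2) by (intro mult_left_mono stretch_bounds(2)[OF d(1)[OF x]]) auto
      finally show ?thesis .
    qed
  next
    show "harmonic_fun (ball 0 1) (\<lambda>x. f x \<bullet> \<nu>)" for \<nu>
      using f by (intro harmonic_fun_inner) (auto simp: harmonic_Bloch_map_def harmonic_Bloch_def)
  qed (use assms g in auto)
  then show ?thesis by (rule that)
qed

lemma Bloch_weighted_stretch_bounded:
  assumes f: "f \<in> harmonic_Bloch_map \<beta>" and qc: "quasiconformal K (ball 0 1) \<Omega> f" and "\<beta> \<le> \<gamma>"
  shows "bdd_above ((\<lambda>x. (1 - norm x) powr \<gamma> * max_stretch f x) ` ball 0 1)"
proof -
  have "\<exists>c. \<forall>x\<in>ball 0 1. (1 - norm x) powr \<beta> * norm (gradient (\<lambda>x. f x $ j) x) \<le> c" for j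
    using f by (force simp: harmonic_Bloch_map_def harmonic_Bloch_def bdd_above_def)
  then obtain c where c: "\<And>j x. x \<in> ball 0 1 \<Longrightarrow> (1 - norm x) powr \<beta> * norm (gradient (\<lambda>x. f x $ j) x) \<le> c j"
    by metis
  show ?thesis
  proof (rule bdd_aboveI2)
    fix x :: "real ^ 'a" assume x: "x \<in> ball 0 1"
    have d: "f differentiable (at x)" using qc x by (auto simp: quasiconformal_def)
    have "(1 - norm x) powr \<gamma> * max_stretch f x \<le> (1 - norm x) powr \<gamma> * (\<Sum>j\<in>UNIV. norm (gradient (\<lambda>x. f x $ j) x))"
      by (intro mult_left_mono max_stretch_le_sum_gradient[OF d]) simp
    also have "\<dots> \<le> (1 - norm x) powr \<beta> * (\<Sum>j\<in>UNIV. norm (gradient (\<lambda>x. f x $ j) x))"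
      using x \<open>\<beta> \<le> \<gamma>\<close> by (intro mult_right_mono powr_mono' sum_nonneg) auto
    also have "\<dots> = (\<Sum>j\<in>UNIV. (1 - norm x) powr \<beta> * norm (gradient (\<lambda>x. f x $ j) x))"
      by (rule sum_distrib_left)
    also have "\<dots> \<le> (\<Sum>j\<in>UNIV. c j)" by (intro sum_mono c x)
    finally show "(1 - norm x) powr \<gamma> * max_stretch f x \<le> (\<Sum>j\<in>UNIV. c j)" .
  qed
qed

text \<open>
  By \<open>near_maximum_not_near_boundary\<close>, \<open>d \<ge> \<delta>\<close> at every point where \<open>d\<^bsup>1-\<alpha>\<^esup> \<bar>\<nabla>f\<bar>\<close> exceeds half of its
  supremum. There \<open>d \<bar>\<nabla>f\<bar>\<close> has the universal bound \<open>stretch_bound\<close>, so the supremum is at most \<open>M1\<close>, a number in which \<open>f\<close> and \<open>\<beta>\<close> do not occur.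
\<close>

theorem theorem1p1:
  fixes \<Omega> :: "(real ^ 'n) set" and b :: "real ^ 'n" and \<alpha> K :: real
  assumes "CARD('n) \<ge> 3"
    and "open \<Omega>" and "connected \<Omega>"
    and "has_C1_boundary \<Omega>"
    and "b \<in> \<Omega>"
    and "0 < \<alpha>" and "\<alpha> < 1"
    and "K \<ge> 1"
  shows "\<exists>M::real. \<forall>\<beta> f. 0 < \<beta> \<and> \<beta> < 1 - \<alpha> \<and>
           quasiconformal K (ball 0 1) \<Omega> f \<and> f \<in> harmonic_Bloch_map \<beta> \<and> f 0 = b \<longrightarrow>
           (\<forall>x\<in>ball 0 1. \<forall>y\<in>ball 0 1. norm (f x - f y) \<le> M * norm (x - y) powr \<alpha>)"
proof -
  have "bounded \<Omega>" by (rule C1_boundary_parametrisation[OF assms(4,2)])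
  then obtain D where D: "D > 0" "\<Omega> \<subseteq> cball 0 D"
    unfolding bounded_pos by (auto simp: subset_iff)
  from near_maximum_not_near_boundary[OF C1_boundary_connected_exhaustion[OF assms(4,2,5)]
      C1_boundary_asymptotically_flat[OF assms(4,2)] assms(8) D(1) assms(6,7)]
  obtain \<delta> where \<delta>: "\<delta> > 0" and
    near_max: "\<forall>f g f' s S x0. harmonic_qc_map \<Omega> f g f' s K D CARD('n) \<longrightarrow> f 0 = b \<longrightarrow> S > 0 \<longrightarrow>
       (\<forall>x\<in>ball 0 1. s x \<le> S * (1 - norm x) powr (\<alpha> - 1)) \<longrightarrow> x0 \<in> ball 0 1 \<longrightarrow>
       S / 2 \<le> (1 - norm x0) powr (1 - \<alpha>) * s x0 \<longrightarrow> \<delta> \<le> 1 - norm x0"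
    by (elim exE conjE)
  define M1 where "M1 = 4 * K * (real CARD('n))\<^sup>2 * D / \<delta>"
  have M1: "M1 \<ge> 0" using assms(8) D \<delta> by (simp add: M1_def)
  show ?thesis
  proof (intro exI[of _ "(2 / \<alpha> + 1) * M1"] allI impI ballI)
    fix \<beta> f and x y :: "real ^ 'n"
    assume "0 < \<beta> \<and> \<beta> < 1 - \<alpha> \<and> quasiconformal K (ball 0 1) \<Omega> f \<and> f \<in> harmonic_Bloch_map \<beta> \<and> f 0 = b"
      and xy: "x \<in> ball 0 1" "y \<in> ball 0 1"
    then have \<beta>: "\<beta> \<le> 1 - \<alpha>" and qc: "quasiconformal K (ball 0 1) \<Omega> f" and f: "f \<in> harmonic_Bloch_map \<beta>"
      and f0: "f 0 = b" by auto
    have dim: "2 \<le> CARD('n)" using assms(1) by simp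
    obtain g where h: "harmonic_qc_map \<Omega> f g (\<lambda>x. frechet_derivative f (at x)) (max_stretch f) K D CARD('n)"
      by (rule quasiconformal_harmonic_qc_map[OF dim assms(8) D(1) assms(2) D(2) qc f])
    interpret harmonic_qc_map \<Omega> f g "\<lambda>x. frechet_derivative f (at x)" "max_stretch f" K D "CARD('n)"
      by (rule h)
    define w where "w = (\<lambda>x. (1 - norm x) powr (1 - \<alpha>) * max_stretch f x)"
    define S where "S = (SUP x\<in>ball 0 1. w x)"
    have bdd: "bdd_above (w ` ball 0 1)"
      unfolding w_def by (rule Bloch_weighted_stretch_bounded[OF f qc \<beta>])
    have wS: "w z \<le> S" if "z \<in> ball 0 1" for z
      unfolding S_def by (rule cSUP_upper[OF that bdd])
    have sS: "max_stretch f z \<le> S * (1 - norm z) powr (\<alpha> - 1)" if z: "z \<in> ball 0 1" for z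
    proof -
      have "w z * (1 - norm z) powr (\<alpha> - 1) \<le> S * (1 - norm z) powr (\<alpha> - 1)"
        by (intro mult_right_mono wS z) simp
      moreover have "(1 - norm z) powr (1 - \<alpha>) * (1 - norm z) powr (\<alpha> - 1) = 1"
        using z unfolding powr_add[symmetric] by simp
      then have "w z * (1 - norm z) powr (\<alpha> - 1) = max_stretch f z"
        by (simp add: w_def mult_ac)
      ultimately show ?thesis by simp
    qed
    have "S \<le> M1"
    proof (cases "S > 0")
      case True
      then have "\<exists>x0\<in>ball 0 1. S / 2 < w x0"
        unfolding S_def using bdd by (intro less_cSUP_iff[THEN iffD1]) auto
      then obtain x0 where x0: "x0 \<in> ball 0 1" "S / 2 < w x0" by blast
      have d: "\<delta> \<le> 1 - norm x0"
        using near_max[rule_format, OF h f0 True] sS x0 by (simp add: w_def)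
      have "w x0 \<le> 1 * max_stretch f x0"
        unfolding w_def using x0(1) s_nonneg[OF x0(1)] assms(7)
        by (intro mult_right_mono powr_le1) auto
      then have "\<delta> * (S / 2) \<le> \<delta> * max_stretch f x0" using x0 \<delta> by (intro mult_left_mono) auto
      also have "\<dots> \<le> (1 - norm x0) * max_stretch f x0"
        using d s_nonneg[OF x0(1)] by (rule mult_right_mono)
      also have "\<dots> \<le> 2 * K * (real CARD('n))\<^sup>2 * D" by (rule stretch_bound[OF x0(1)])
      finally show ?thesis using \<delta> by (simp add: M1_def field_simps)
    qed (use M1 in simp)
    then have "max_stretch f z \<le> M1 * (1 - norm z) powr (\<alpha> - 1)" if "z \<in> ball 0 1" for z
      using sS[OF that] mult_right_mono[of S M1 "(1 - norm z) powr (\<alpha> - 1)"] by simp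
    then show "norm (f x - f y) \<le> (2 / \<alpha> + 1) * M1 * norm (x - y) powr \<alpha>"
      by (rule hoelder_of_stretch_bound[OF assms(6,7) M1 _ xy])
  qed
qed

end
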